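(* Let $(W,S)$ be an arbitrary Coxeter system of finite rank (with $m_{rt}=\infty$ allowed). The isomorphism classes of IR-representations of $(W,S)$ are in one-to-one correspondence (by sending an IR-representation to its attached data $((\delta_{rt}),\chi)$) with the set of data $$\Bigl\{\bigl((\delta_{rt})_{r\ne t\in S},\chi\bigr)\Bigm|\delta_{rt}=\delta_{tr}\in P_{rt}\ \forall r\neq t\in S;\ \chi\text{ a character of }\mathrm{H}_1(\widetilde G)\Bigr\},$$ where the graph $\widetilde G$ is determined by $(\delta_{rt})_{r,t}$.
   Context: $W=\langle S\mid s^2=(st)^{m_{st}}=e,\ \forall s\ne t\in S\rangle$, $S$ finite, $m_{st}\in\{2,3,\dots\}\cup\{\infty\}$ (no relation between $s$ and $t$ if $m_{st}=\infty$). All representations are complex. IR-representation: a representation $V$ of $W$ having a basis $\{\alpha_s\mid s\in S\}$ such that for every $s\in S$ there is a subspace $H_s$ of codimension $1$ with $s|_{H_s}=\mathrm{Id}_{H_s}$, and $s\cdot\alpha_s=-\alpha_s$. Representations of dihedral groups $\langle r,t\rangle$ on $\mathbb{C}\beta_r\oplus\mathbb{C}\beta_t$: for $x,y\in\mathbb{C}$ let $\varrho_{x,y}$ be given by $r\beta_r=-\beta_r$, $r\beta_t=\beta_t+x\beta_r$, $t\beta_t=-\beta_t$, $t\beta_r=\beta_r+y\beta_t$. If $m_{rt}<\infty$ and $1\le k\le m_{rt}/2$, then $\rho_k$ is given by the same formulas with $x=y=2\cos\frac{k\pi}{m_{rt}}$. If $m_{rt}=\infty$: for each $z\in\mathbb{C}$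 fix once and for all $u=u(z)$ with $u^2=z$ (with $u>0$ if $z$ is a positive real number), and put $\varrho_z:=\varrho_{u,u}$; also $\varrho_r^t:=\varrho_{1,0}$ and $\varrho_t^r:=\varrho_{0,1}$. Parameter sets: $P_{rt}=\{\rho_k\mid k\in\mathbb{N},\,1\le k\le m_{rt}/2\}$ if $m_{rt}<\infty$, and $P_{rt}=\{\varrho_r^t,\varrho_t^r\}\cup\{\varrho_z\mid z\in\mathbb{C}\}$ if $m_{rt}=\infty$. The condition $\delta_{rt}=\delta_{tr}$ means that both denote the same representation of $\langle r,t\rangle$. Graph: given $(\delta_{rt})$, define $\widetilde m_{rt}$ by: (i) if $m_{rt}<\infty$ and $\delta_{rt}=\rho_k$, $\widetilde m_{rt}=m_{rt}/\gcd(m_{rt},k)$; (ii) if $m_{rt}=\infty$ and $\delta_{rt}=\varrho_z$ with $z=4\cos^2\frac{k\pi}{m}$ for coprime $k,m\in\mathbb{N}$, $1\le k<m/2$, $\widetilde m_{rt}=m$; (iii) if $m_{rt}=\infty$ and $\delta_{rt}=\varrho_0$, $\widetilde m_{rt}=2$; (iv) otherwise $\widetilde m_{rt}=\infty$. $\widetilde G$ is the graph on $S$ in which $\{r,t\}$ is an edge iff $\widetilde m_{rt}\ge3$ (including $\infty$). $\mathrm{H}_1(\widetilde G)$ is its first integral homology (as a 1-dimensional simplicial complex, labels ignored); a character is a homomorphism to $\mathbb{C}^\times$. Attached data: for an IR-representation $V$ and $r\ne t$, $\langle\alpha_r,\alpha_t\rangle$ is a representation of $\langle r,t\rangle$ isomorphic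 to a unique $\delta_{rt}\in P_{rt}$; choose $a_r^t,a_t^r\in\mathbb{C}^\times$ such that $a_r^t\alpha_r\mapsto\beta_r$, $a_t^r\alpha_t\mapsto\beta_t$ is such an isomorphism. Then $\chi$ is the restriction to $\mathrm{H}_1(\widetilde G)$ of the homomorphism on 1-chains sending the oriented edge $(r,t)$ to $a_t^r/a_r^t$. *)

theory Defs
  imports
    "HOL-Algebra.Elementary_Groups"
    "HOL-Algebra.Group_Action"
    "HOL-Library.Extended_Nat"
    "Jordan_Normal_Form.VS_Connect"
begin

section \<open>Presented groups and Coxeter groups\<close>

text \<open>
  A letter \<open>(s, True)\<close> stands for the generator \<open>s\<close> and \<open>(s, False)\<close> for its formal
  inverse. Two words are related iff they represent the same element of the group
  with generators \<open>S\<close> and relators \<open>R\<close>.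
\<close>

type_synonym 's word = "('s \<times> bool) list"

abbreviation words :: "'s set \<Rightarrow> 's word set" where
  "words S \<equiv> lists (S \<times> UNIV)"

inductive_set pres_rel :: "'s set \<Rightarrow> 's word set \<Rightarrow> ('s word \<times> 's word) set"
  for S :: "'s set" and R :: "'s word set" where
  pres_refl: "w \<in> words S \<Longrightarrow> (w, w) \<in> pres_rel S R"
| pres_sym: "(v, w) \<in> pres_rel S R \<Longrightarrow> (w, v) \<in> pres_rel S R"
| pres_trans: "(v, w) \<in> pres_rel S R \<Longrightarrow> (w, x) \<in> pres_rel S R \<Longrightarrow> (v, x) \<in> pres_rel S R"
| pres_cong: "(v, w) \<in> pres_rel S R \<Longrightarrow> x \<in> words S \<Longrightarrow> y \<in> words S \<Longrightarrow>
    (x @ v @ y, x @ w @ y) \<in> pres_rel S R"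
| pres_cancel: "s \<in> S \<Longrightarrow> ([(s, b), (s, \<not> b)], []) \<in> pres_rel S R"
| pres_relator: "r \<in> R \<Longrightarrow> r \<in> words S \<Longrightarrow> (r, []) \<in> pres_rel S R"

definition presented_group :: "'s set \<Rightarrow> 's word set \<Rightarrow> 's word set monoid" where
  "presented_group S R =
    \<lparr> carrier = words S // pres_rel S R,
      mult = (\<lambda>A B. \<Union>x\<in>A. \<Union>y\<in>B. pres_rel S R `` {x @ y}),
      one = pres_rel S R `` {[]} \<rparr>"

lemma pres_rel_words: "(v, w) \<in> pres_rel S R \<Longrightarrow> v \<in> words S \<and> w \<in> words S"
  by (induction rule: pres_rel.induct) auto

lemma equiv_pres_rel: "equiv (words S) (pres_rel S R)"
proof (rule equivI)
  show "pres_rel S R \<subseteq> words S \<times> words S"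
  proof (rule subsetI)
    fix p assume "p \<in> pres_rel S R"
    then show "p \<in> words S \<times> words S"
      using pres_rel_words[of "fst p" "snd p" S R] by (simp add: mem_Times_iff)
  qed
  show "refl_on (words S) (pres_rel S R)"
    by (rule refl_onI) (rule pres_refl)
  show "sym_on UNIV (pres_rel S R)"
    by (rule symI) (rule pres_sym)
  show "trans_on UNIV (pres_rel S R)"
    by (rule transI) (rule pres_trans)
qed

lemma pres_mult:
  assumes "v \<in> words S" "w \<in> words S"
  shows "pres_rel S R `` {v} \<otimes>\<^bsub>presented_group S R\<^esub> pres_rel S R `` {w} = pres_rel S R `` {v @ w}"
proof -
  have *: "pres_rel S R `` {x @ y} = pres_rel S R `` {v @ w}"
    if "(v, x) \<in> pres_rel S R" "(w, y) \<in> pres_rel S R" for x y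
  proof -
    have "(v @ w, x @ w) \<in> pres_rel S R"
      using pres_cong[OF that(1), of "[]" w] assms by simp
    moreover have "(x @ w, x @ y) \<in> pres_rel S R"
      using pres_cong[OF that(2), of x "[]"] pres_rel_words[OF that(1)] by simp
    ultimately have "(v @ w, x @ y) \<in> pres_rel S R"
      by (rule pres_trans)
    then show ?thesis
      using equiv_class_eq[OF equiv_pres_rel] by metis
  qed
  have "v \<in> pres_rel S R `` {v}" "w \<in> pres_rel S R `` {w}"
    using pres_refl[OF assms(1), of R] pres_refl[OF assms(2), of R] by simp_all
  moreover have "pres_rel S R `` {x @ y} = pres_rel S R `` {v @ w}"
    if "x \<in> pres_rel S R `` {v}" "y \<in> pres_rel S R `` {w}" for x y
    using that by (intro *) simp_all
  ultimately have "(\<Union>x\<in>pres_rel S R `` {v}. \<Union>y\<in>pres_rel S R `` {w}. pres_rel S R `` {x @ y})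
      = pres_rel S R `` {v @ w}"
    by blast
  then show ?thesis
    by (simp add: presented_group_def)
qed

lemma group_presented_group: "group (presented_group S R)"
proof (rule groupI)
  let ?G = "presented_group S R"
  have carr: "carrier ?G = words S // pres_rel S R"
    by (simp add: presented_group_def)
  have one: "\<one>\<^bsub>?G\<^esub> = pres_rel S R `` {[]}"
    by (simp add: presented_group_def)
  have carrE: "\<exists>w. w \<in> words S \<and> A = pres_rel S R `` {w}" if "A \<in> carrier ?G" for A
    using that unfolding carr by (elim quotientE) blast
  have carrI: "pres_rel S R `` {w} \<in> carrier ?G" if "w \<in> words S" for w
    unfolding carr using that by (rule quotientI)
  have app: "v @ w \<in> words S" if "v \<in> words S" "w \<in> words S" for v w
    using that by simp
  show "\<one>\<^bsub>?G\<^esub> \<in> carrier ?G"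
    unfolding one by (rule carrI) simp
  show "A \<otimes>\<^bsub>?G\<^esub> B \<in> carrier ?G" if "A \<in> carrier ?G" "B \<in> carrier ?G" for A B
    using carrE[OF that(1)] carrE[OF that(2)] by (metis pres_mult carrI app)
  show "A \<otimes>\<^bsub>?G\<^esub> B \<otimes>\<^bsub>?G\<^esub> C = A \<otimes>\<^bsub>?G\<^esub> (B \<otimes>\<^bsub>?G\<^esub> C)"
    if "A \<in> carrier ?G" "B \<in> carrier ?G" "C \<in> carrier ?G" for A B C
    using carrE[OF that(1)] carrE[OF that(2)] carrE[OF that(3)]
    by (metis pres_mult app append_assoc)
  show "\<one>\<^bsub>?G\<^esub> \<otimes>\<^bsub>?G\<^esub> A = A" if "A \<in> carrier ?G" for A
    using carrE[OF that] unfolding one by (metis pres_mult lists.Nil append_Nil)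
  show "\<exists>B\<in>carrier ?G. B \<otimes>\<^bsub>?G\<^esub> A = \<one>\<^bsub>?G\<^esub>" if A: "A \<in> carrier ?G" for A
  proof -
    have ex: "\<exists>w'\<in>words S. (w' @ w, []) \<in> pres_rel S R" if "w \<in> words S" for w
      using that
    proof (induction w)
      case Nil
      then show ?case
        by (intro bexI[of _ "[]"]) (auto intro: pres_refl)
    next
      case (Cons l w)
      then obtain w' where w': "w' \<in> words S" "(w' @ w, []) \<in> pres_rel S R"
        by auto
      obtain s b where l: "l = (s, b)" "s \<in> S"
        using Cons by (cases l) auto
      have "(w' @ [(s, \<not> b), (s, b)] @ w, w' @ [] @ w) \<in> pres_rel S R"
        using pres_cancel[of s S "\<not> b" R] l w' Cons by (intro pres_cong) auto
      then have "(w' @ [(s, \<not> b), (s, b)] @ w, []) \<in> pres_rel S R"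
        using w'(2) by (simp only: append_Nil) (rule pres_trans)
      then have "((w' @ [(s, \<not> b)]) @ l # w, []) \<in> pres_rel S R"
        using l by simp
      then show ?case
        using w' l by (intro bexI[of _ "w' @ [(s, \<not> b)]"]) auto
    qed
    obtain w where w: "w \<in> words S" "A = pres_rel S R `` {w}"
      using carrE[OF A] by blast
    obtain w' where w': "w' \<in> words S" "(w' @ w, []) \<in> pres_rel S R"
      using ex w by blast
    have "pres_rel S R `` {w'} \<otimes>\<^bsub>?G\<^esub> A = \<one>\<^bsub>?G\<^esub>"
      using pres_mult[OF w'(1) w(1), of R] equiv_class_eq[OF equiv_pres_rel w'(2)]
      unfolding w(2) one by metis
    then show ?thesis
      using carrI[OF w'(1)] by blast
  qed
qed

text \<open>
  \<open>m\<close> is only used off the diagonal; \<open>m s t = \<infinity>\<close> contributes no relator.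
\<close>

definition coxeter_relators :: "'s set \<Rightarrow> ('s \<Rightarrow> 's \<Rightarrow> enat) \<Rightarrow> 's word set" where
  "coxeter_relators S m =
    {[(s, True), (s, True)] | s. s \<in> S} \<union>
    {concat (replicate n [(s, True), (t, True)]) | s t n. s \<in> S \<and> t \<in> S \<and> s \<noteq> t \<and> m s t = enat n}"

definition coxeter_group :: "'s set \<Rightarrow> ('s \<Rightarrow> 's \<Rightarrow> enat) \<Rightarrow> 's word set monoid" where
  "coxeter_group S m = presented_group S (coxeter_relators S m)"

definition cox_gen :: "'s set \<Rightarrow> ('s \<Rightarrow> 's \<Rightarrow> enat) \<Rightarrow> 's \<Rightarrow> 's word set" where
  "cox_gen S m s = pres_rel S (coxeter_relators S m) `` {[(s, True)]}"

definition dihedral_subgroup ::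
    "'s set \<Rightarrow> ('s \<Rightarrow> 's \<Rightarrow> enat) \<Rightarrow> 's \<Rightarrow> 's \<Rightarrow> 's word set monoid" where
  "dihedral_subgroup S m r t = subgroup_generated (coxeter_group S m) {cox_gen S m r, cox_gen S m t}"

section \<open>Complex representations\<close>

abbreviation cring_complex :: "complex ring" ("\<complex>\<^sub>R") where
  "\<complex>\<^sub>R \<equiv> class_ring"

definition representation ::
    "('g, 'c) monoid_scheme \<Rightarrow> (complex, 'v) module \<Rightarrow> ('g \<Rightarrow> 'v \<Rightarrow> 'v) \<Rightarrow> bool" where
  "representation G V \<phi> \<longleftrightarrow>
    vectorspace \<complex>\<^sub>R V \<and> group_action G (carrier V) \<phi> \<and>
    (\<forall>g\<in>carrier G. \<phi> g \<in> module_hom \<complex>\<^sub>R V V)"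

definition rep_iso ::
    "('g, 'c) monoid_scheme \<Rightarrow> (complex, 'v) module \<Rightarrow> ('g \<Rightarrow> 'v \<Rightarrow> 'v) \<Rightarrow>
     (complex, 'w) module \<Rightarrow> ('g \<Rightarrow> 'w \<Rightarrow> 'w) \<Rightarrow> ('v \<Rightarrow> 'w) \<Rightarrow> bool" where
  "rep_iso G V \<phi> V' \<phi>' f \<longleftrightarrow>
    f \<in> module_hom \<complex>\<^sub>R V V' \<and> bij_betw f (carrier V) (carrier V') \<and>
    (\<forall>g\<in>carrier G. \<forall>v\<in>carrier V. \<phi> g v \<in> carrier V \<and> f (\<phi> g v) = \<phi>' g (f v))"

section \<open>IR-representations\<close>

text \<open>
  Codimension is expressed through dimensions: a space with a basis indexed by the finite
  set \<open>S\<close> is finite-dimensional.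
\<close>

definition IR_basis ::
    "'s set \<Rightarrow> ('s \<Rightarrow> 's \<Rightarrow> enat) \<Rightarrow> (complex, 'v) module \<Rightarrow> ('s word set \<Rightarrow> 'v \<Rightarrow> 'v) \<Rightarrow>
     ('s \<Rightarrow> 'v) \<Rightarrow> bool" where
  "IR_basis S m V \<phi> \<alpha> \<longleftrightarrow>
    inj_on \<alpha> S \<and> vectorspace.basis \<complex>\<^sub>R V (\<alpha> ` S) \<and>
    (\<forall>s\<in>S.
      (\<exists>H. VectorSpace.subspace \<complex>\<^sub>R H V \<and>
           vectorspace.dim \<complex>\<^sub>R (V\<lparr>carrier := H\<rparr>) + 1 = vectorspace.dim \<complex>\<^sub>R V \<and>
           (\<forall>v\<in>H. \<phi> (cox_gen S m s) v = v)) \<and>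
      \<phi> (cox_gen S m s) (\<alpha> s) = \<ominus>\<^bsub>V\<^esub> \<alpha> s)"

text \<open>
  The carriers of the spaces considered range over all subsets of the type \<open>'v\<close>, with
  arbitrary vector space structures. If \<open>'v\<close> has at least the cardinality of the continuum,
  every finite-dimensional complex vector space has an isomorphic copy among them.
\<close>

definition IR_reps ::
    "'s set \<Rightarrow> ('s \<Rightarrow> 's \<Rightarrow> enat) \<Rightarrow> ((complex, 'v) module \<times> ('s word set \<Rightarrow> 'v \<Rightarrow> 'v)) set" where
  "IR_reps S m = {(V, \<phi>). representation (coxeter_group S m) V \<phi> \<and> (\<exists>\<alpha>. IR_basis S m V \<phi> \<alpha>)}"

definition IR_iso ::
    "'s set \<Rightarrow> ('s \<Rightarrow> 's \<Rightarrow> enat) \<Rightarrow>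
     (((complex, 'v) module \<times> ('s word set \<Rightarrow> 'v \<Rightarrow> 'v)) \<times>
      ((complex, 'v) module \<times> ('s word set \<Rightarrow> 'v \<Rightarrow> 'v))) set" where
  "IR_iso S m = {((V, \<phi>), (V', \<phi>')). (V, \<phi>) \<in> IR_reps S m \<and> (V', \<phi>') \<in> IR_reps S m \<and>
    (\<exists>f. rep_iso (coxeter_group S m) V \<phi> V' \<phi>' f)}"

section \<open>Representations of the dihedral subgroups\<close>

text \<open>
  \<open>\<complex>\<beta>\<^sub>r \<oplus> \<complex>\<beta>\<^sub>t\<close> is the space of functions on the unordered pair \<open>{r, t}\<close>, so that
  representations indexed by \<open>(r, t)\<close> and by \<open>(t, r)\<close> can be compared by equality.
\<close>

abbreviation pair_space :: "'s \<Rightarrow> 's \<Rightarrow> (complex, 's \<Rightarrow> complex) module" where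
  "pair_space r t \<equiv> ring.func_space \<complex>\<^sub>R {r, t}"

definition pair_basis :: "'s \<Rightarrow> 's \<Rightarrow> 's \<Rightarrow> ('s \<Rightarrow> complex)" where
  "pair_basis r t s = (\<lambda>x\<in>{r, t}. if x = s then 1 else 0)"

type_synonym 's dihedral_rep = "'s word set \<Rightarrow> ('s \<Rightarrow> complex) \<Rightarrow> ('s \<Rightarrow> complex)"

definition varrho2 ::
    "'s set \<Rightarrow> ('s \<Rightarrow> 's \<Rightarrow> enat) \<Rightarrow> 's \<Rightarrow> 's \<Rightarrow> complex \<Rightarrow> complex \<Rightarrow> 's dihedral_rep" where
  "varrho2 S m r t x y =
    (let D = dihedral_subgroup S m r t; U = pair_space r t;
         \<beta>\<^sub>r = pair_basis r t r; \<beta>\<^sub>t = pair_basis r t t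
     in THE \<phi>. \<phi> \<in> extensional (carrier D) \<and> representation D U \<phi> \<and>
          \<phi> (cox_gen S m r) \<beta>\<^sub>r = \<ominus>\<^bsub>U\<^esub> \<beta>\<^sub>r \<and>
          \<phi> (cox_gen S m r) \<beta>\<^sub>t = \<beta>\<^sub>t \<oplus>\<^bsub>U\<^esub> x \<odot>\<^bsub>U\<^esub> \<beta>\<^sub>r \<and>
          \<phi> (cox_gen S m t) \<beta>\<^sub>t = \<ominus>\<^bsub>U\<^esub> \<beta>\<^sub>t \<and>
          \<phi> (cox_gen S m t) \<beta>\<^sub>r = \<beta>\<^sub>r \<oplus>\<^bsub>U\<^esub> y \<odot>\<^bsub>U\<^esub> \<beta>\<^sub>t)"

definition rho ::
    "'s set \<Rightarrow> ('s \<Rightarrow> 's \<Rightarrow> enat) \<Rightarrow> 's \<Rightarrow> 's \<Rightarrow> nat \<Rightarrow> 's dihedral_rep" where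
  "rho S m r t k =
    (let c = complex_of_real (2 * cos (real k * pi / real (the_enat (m r t)))) in varrho2 S m r t c c)"

text \<open>In the following, \<open>u\<close> is the fixed choice of square roots.\<close>

definition varrho ::
    "'s set \<Rightarrow> ('s \<Rightarrow> 's \<Rightarrow> enat) \<Rightarrow> (complex \<Rightarrow> complex) \<Rightarrow> 's \<Rightarrow> 's \<Rightarrow> complex \<Rightarrow> 's dihedral_rep" where
  "varrho S m u r t z = varrho2 S m r t (u z) (u z)"

definition dihedral_params ::
    "'s set \<Rightarrow> ('s \<Rightarrow> 's \<Rightarrow> enat) \<Rightarrow> (complex \<Rightarrow> complex) \<Rightarrow> 's \<Rightarrow> 's \<Rightarrow> 's dihedral_rep set" where
  "dihedral_params S m u r t =
    (case m r t of
       enat n \<Rightarrow> {rho S m r t k | k. 1 \<le> k \<and> 2 * k \<le> n}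
     | \<infinity> \<Rightarrow> {varrho2 S m r t 1 0, varrho2 S m r t 0 1} \<union> range (varrho S m u r t))"

section \<open>The graph and the characters of its first homology\<close>

definition is_cos_param ::
    "'s set \<Rightarrow> ('s \<Rightarrow> 's \<Rightarrow> enat) \<Rightarrow> (complex \<Rightarrow> complex) \<Rightarrow> ('s \<times> 's \<Rightarrow> 's dihedral_rep) \<Rightarrow>
     's \<Rightarrow> 's \<Rightarrow> nat \<Rightarrow> bool" where
  "is_cos_param S m u \<delta> r t n \<longleftrightarrow>
    (\<exists>k. coprime k n \<and> 1 \<le> k \<and> 2 * k < n \<and>
      \<delta> (r, t) = varrho S m u r t (complex_of_real (4 * (cos (real k * pi / real n))\<^sup>2)))"

definition mtilde ::
    "'s set \<Rightarrow> ('s \<Rightarrow> 's \<Rightarrow> enat) \<Rightarrow> (complex \<Rightarrow> complex) \<Rightarrow> ('s \<times> 's \<Rightarrow> 's dihedral_rep) \<Rightarrow>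
     's \<Rightarrow> 's \<Rightarrow> enat" where
  "mtilde S m u \<delta> r t =
    (case m r t of
       enat n \<Rightarrow> enat (n div gcd n (THE k. 1 \<le> k \<and> 2 * k \<le> n \<and> \<delta> (r, t) = rho S m r t k))
     | \<infinity> \<Rightarrow> if \<exists>n. is_cos_param S m u \<delta> r t n then enat (THE n. is_cos_param S m u \<delta> r t n)
           else if \<delta> (r, t) = varrho S m u r t 0 then 2
           else \<infinity>)"

text \<open>Edges are recorded in both orientations.\<close>

definition graph_edges ::
    "'s set \<Rightarrow> ('s \<Rightarrow> 's \<Rightarrow> enat) \<Rightarrow> (complex \<Rightarrow> complex) \<Rightarrow> ('s \<times> 's \<Rightarrow> 's dihedral_rep) \<Rightarrow>
     ('s \<times> 's) set" where
  "graph_edges S m u \<delta> = {(r, t). r \<in> S \<and> t \<in> S \<and> r \<noteq> t \<and> 3 \<le> mtilde S m u \<delta> r t}"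

text \<open>
  Oriented simplicial 1-chains: the free abelian group on the oriented edges modulo
  \<open>(t, r) = - (r, t)\<close>, realised as the antisymmetric integer functions supported on the edges.
  The boundary of \<open>(r, t)\<close> is \<open>t - r\<close>; there are no 2-simplices, so \<open>H\<^sub>1\<close> is the group of 1-cycles.
\<close>

definition chain_group :: "('s \<times> 's) set \<Rightarrow> ('s \<times> 's \<Rightarrow> int) monoid" where
  "chain_group E =
    \<lparr> carrier = {c. (\<forall>r t. c (t, r) = - c (r, t)) \<and> (\<forall>e. e \<notin> E \<longrightarrow> c e = 0)},
      mult = (\<lambda>c d e. c e + d e),
      one = (\<lambda>e. 0) \<rparr>"

definition oriented_edge :: "'s \<Rightarrow> 's \<Rightarrow> ('s \<times> 's \<Rightarrow> int)" where
  "oriented_edge r t = (\<lambda>e. if e = (r, t) then 1 else if e = (t, r) then -1 else 0)"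

definition chain_boundary :: "'s set \<Rightarrow> ('s \<times> 's \<Rightarrow> int) \<Rightarrow> 's \<Rightarrow> int" where
  "chain_boundary S c t = (\<Sum>r\<in>S. c (r, t))"

definition H1_group :: "'s set \<Rightarrow> ('s \<times> 's) set \<Rightarrow> ('s \<times> 's \<Rightarrow> int) monoid" where
  "H1_group S E =
    (chain_group E)\<lparr>carrier := {c \<in> carrier (chain_group E). \<forall>t\<in>S. chain_boundary S c t = 0}\<rparr>"

definition H1_characters :: "'s set \<Rightarrow> ('s \<times> 's) set \<Rightarrow> (('s \<times> 's \<Rightarrow> int) \<Rightarrow> complex) set" where
  "H1_characters S E = hom (H1_group S E) (units_of \<complex>\<^sub>R) \<inter> extensional (carrier (H1_group S E))"

section \<open>The parametrising data and the data attached to an IR-representation\<close>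

definition off_diagonal :: "'s set \<Rightarrow> ('s \<times> 's) set" where
  "off_diagonal S = {(r, t). r \<in> S \<and> t \<in> S \<and> r \<noteq> t}"

type_synonym 's IR_datum = "('s \<times> 's \<Rightarrow> 's dihedral_rep) \<times> (('s \<times> 's \<Rightarrow> int) \<Rightarrow> complex)"

definition IR_data ::
    "'s set \<Rightarrow> ('s \<Rightarrow> 's \<Rightarrow> enat) \<Rightarrow> (complex \<Rightarrow> complex) \<Rightarrow> 's IR_datum set" where
  "IR_data S m u =
    {(\<delta>, \<chi>). \<delta> \<in> (\<Pi>\<^sub>E (r, t)\<in>off_diagonal S. dihedral_params S m u r t) \<and>
             (\<forall>(r, t)\<in>off_diagonal S. \<delta> (r, t) = \<delta> (t, r)) \<and>
             \<chi> \<in> H1_characters S (graph_edges S m u \<delta>)}"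

text \<open>
  \<open>a r t\<close> is the scalar \<open>a\<^sub>r\<^sup>t\<close>. All choices (the basis \<open>\<alpha>\<close>, the scalars \<open>a\<close>) are quantified
  existentially; that the datum does not depend on them is part of the theorem.
\<close>

definition is_attached ::
    "'s set \<Rightarrow> ('s \<Rightarrow> 's \<Rightarrow> enat) \<Rightarrow> (complex \<Rightarrow> complex) \<Rightarrow>
     (complex, 'v) module \<times> ('s word set \<Rightarrow> 'v \<Rightarrow> 'v) \<Rightarrow> 's IR_datum \<Rightarrow> bool" where
  "is_attached S m u = (\<lambda>(V, \<phi>) (\<delta>, \<chi>).
    \<exists>\<alpha> a \<psi>.
      IR_basis S m V \<phi> \<alpha> \<and>
      \<delta> \<in> (\<Pi>\<^sub>E (r, t)\<in>off_diagonal S. dihedral_params S m u r t) \<and>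
      (\<forall>(r, t)\<in>off_diagonal S.
        a r t \<noteq> 0 \<and>
        (\<exists>f. rep_iso (dihedral_subgroup S m r t)
               (V\<lparr>carrier := module.span \<complex>\<^sub>R V {\<alpha> r, \<alpha> t}\<rparr>) \<phi> (pair_space r t) (\<delta> (r, t)) f \<and>
             f (a r t \<odot>\<^bsub>V\<^esub> \<alpha> r) = pair_basis r t r \<and>
             f (a t r \<odot>\<^bsub>V\<^esub> \<alpha> t) = pair_basis r t t)) \<and>
      \<psi> \<in> hom (chain_group (graph_edges S m u \<delta>)) (units_of \<complex>\<^sub>R) \<and>
      (\<forall>(r, t)\<in>graph_edges S m u \<delta>. \<psi> (oriented_edge r t) = a t r / a r t) \<and>
      \<chi> = restrict \<psi> (carrier (H1_group S (graph_edges S m u \<delta>))))"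

definition attached_data ::
    "'s set \<Rightarrow> ('s \<Rightarrow> 's \<Rightarrow> enat) \<Rightarrow> (complex \<Rightarrow> complex) \<Rightarrow>
     (complex, 'v) module \<times> ('s word set \<Rightarrow> 'v \<Rightarrow> 'v) \<Rightarrow> 's IR_datum" where
  "attached_data S m u V = (THE d. is_attached S m u V d)"

end

theory Submission
  imports Defs
begin

text \<open>
  With respect to a basis \<open>\<alpha>\<close> as in the definition of an IR-representation, each generator acts by
  \<open>s \<alpha>\<^sub>t = \<alpha>\<^sub>t + X\<^sub>s\<^sub>t \<alpha>\<^sub>s\<close> with \<open>X\<^sub>s\<^sub>s = -2\<close>, and \<open>\<alpha>\<^sub>s\<close> is unique up to a scalar because it spans
  the \<open>-1\<close>-eigenspace of \<open>s\<close>. Hence isomorphism classes of IR-representations are matrices \<open>X\<close>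
  satisfying the conditions imposed by the braid relations, up to conjugation by diagonal matrices.
  The braid relation of \<open>r\<close> and \<open>t\<close> only involves the pair \<open>X\<^sub>r\<^sub>t\<close>, \<open>X\<^sub>t\<^sub>r\<close>: for finite \<open>m\<^sub>r\<^sub>t\<close> it says that
  \<open>X\<^sub>r\<^sub>t X\<^sub>t\<^sub>r = 4 cos\<^sup>2 (k \<pi> / m\<^sub>r\<^sub>t)\<close> for some \<open>k\<close>, and that the two entries vanish simultaneously. Diagonal
  rescaling brings each single pair into the normal form recorded by \<open>\<delta>\<^sub>r\<^sub>t\<close>, uniquely; the obstruction to
  doing this for all pairs at once is a character of the chains of the graph of nonzero pairs, modulo
  coboundaries, that is, a character of its first homology.
\<close>

section \<open>Characters of chain groups\<close>

text \<open>The dihedral subgroup of \<open>r\<close> and \<open>t\<close> is given only inside W,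
  without a presentation of its own. Its model representations are therefore not built from
  relators: an admissible pair of coefficients is completed to a full matrix, the matrix is realised
  by W, and the plane of \<open>r\<close> and \<open>t\<close> is cut out. Realising matrices thus
  serves twice, for the models and for surjectivity. The obstacle in realising a matrix is that the
  product of \<open>r\<close> and \<open>t\<close> must have finite order on the whole space and not
  only on their plane. This rests on the product of the two entries never being 4 for a finite bond.
  A rescaling of a pair to normal form has its ratio \<open>a t r / a r t\<close> forced as soon as
  one of the two entries is nonzero, and free when both vanish; this is why exactly the nonzero
  pairs are the edges. For an infinite bond a single entry may vanish, so the ratio has to be read
  off from whichever entry survives.\<close>

lemma Units_cring_complex: "Units \<complex>\<^sub>R = - {0}"
  using class_field.field_Units by auto

lemma hom_units_complex_iff:
  "\<psi> \<in> hom G (units_of \<complex>\<^sub>R) \<longleftrightarrow>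
    (\<forall>c\<in>carrier G. \<psi> c \<noteq> 0) \<and> (\<forall>c\<in>carrier G. \<forall>d\<in>carrier G. \<psi> (c \<otimes>\<^bsub>G\<^esub> d) = \<psi> c * \<psi> d)"
  by (auto simp: hom_def units_of_carrier units_of_mult Units_cring_complex Pi_def)

definition chain_graph :: "'s set \<Rightarrow> ('s \<times> 's) set \<Rightarrow> bool" where
  "chain_graph S E \<longleftrightarrow> finite S \<and> E \<subseteq> S \<times> S \<and> sym E \<and> irrefl E"

lemma chain_graph_finite:
  assumes "chain_graph S E"
  shows "finite S" "finite E"
  using assms by (auto simp: chain_graph_def intro: finite_subset[of E "S \<times> S"])

lemma chain_graphD:
  assumes "chain_graph S E" "(r, t) \<in> E"
  shows "r \<in> S" "t \<in> S" "(t, r) \<in> E" "r \<noteq> t"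
  using assms symD[of E r t] by (auto simp: chain_graph_def irrefl_def)

lemma chain_groupI:
  "(\<And>r t. c (t, r) = - c (r, t)) \<Longrightarrow> (\<And>e. e \<notin> E \<Longrightarrow> c e = 0) \<Longrightarrow> c \<in> carrier (chain_group E)"
  unfolding chain_group_def partial_object.select_convs mem_Collect_eq by blast

lemma chain_group_antisym: "c \<in> carrier (chain_group E) \<Longrightarrow> c (t, r) = - c (r, t)"
  unfolding chain_group_def partial_object.select_convs mem_Collect_eq by blast

lemma chain_group_support: "c \<in> carrier (chain_group E) \<Longrightarrow> e \<notin> E \<Longrightarrow> c e = 0"
  unfolding chain_group_def partial_object.select_convs mem_Collect_eq by blast

lemma chain_group_mult: "c \<otimes>\<^bsub>chain_group E\<^esub> d = (\<lambda>e. c e + d e)"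
  by (simp add: chain_group_def)

lemma H1_group_carrier:
  "c \<in> carrier (H1_group S E) \<longleftrightarrow>
    c \<in> carrier (chain_group E) \<and> (\<forall>t\<in>S. chain_boundary S c t = 0)"
  by (simp add: H1_group_def)

lemma H1_group_mult: "c \<otimes>\<^bsub>H1_group S E\<^esub> d = (\<lambda>e. c e + d e)"
  by (simp add: H1_group_def chain_group_def)

lemma chain_group_add_closed:
  assumes "c \<in> carrier (chain_group E)" "d \<in> carrier (chain_group E)"
  shows "(\<lambda>e. c e + d e) \<in> carrier (chain_group E)"
proof (rule chain_groupI)
  show "c (t, r) + d (t, r) = - (c (r, t) + d (r, t))" for r t
    using chain_group_antisym[OF assms(1), of t r] chain_group_antisym[OF assms(2), of t r] by linarith
qed (simp add: chain_group_support[OF assms(1)] chain_group_support[OF assms(2)])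

lemma chain_group_diff_closed:
  assumes "c \<in> carrier (chain_group E)" "d \<in> carrier (chain_group E)"
  shows "(\<lambda>e. c e - d e) \<in> carrier (chain_group E)"
proof (rule chain_groupI)
  show "c (t, r) - d (t, r) = - (c (r, t) - d (r, t))" for r t
    using chain_group_antisym[OF assms(1), of t r] chain_group_antisym[OF assms(2), of t r] by linarith
qed (simp add: chain_group_support[OF assms(1)] chain_group_support[OF assms(2)])

lemma chain_group_zero_closed: "(\<lambda>e. 0) \<in> carrier (chain_group E)"
  by (intro chain_groupI) auto

lemma oriented_edge_closed:
  "chain_graph S E \<Longrightarrow> (r, t) \<in> E \<Longrightarrow> oriented_edge r t \<in> carrier (chain_group E)"
  using chain_graphD[of S E r t] by (intro chain_groupI) (auto simp: oriented_edge_def)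

lemma chain_boundary_add:
  "chain_boundary S (\<lambda>e. c e + d e) t = chain_boundary S c t + chain_boundary S d t"
  by (simp add: chain_boundary_def sum.distrib)

lemma chain_boundary_diff:
  "chain_boundary S (\<lambda>e. c e - d e) t = chain_boundary S c t - chain_boundary S d t"
  by (simp add: chain_boundary_def sum_subtractf)

lemma chain_boundary_sum:
  "chain_boundary S (\<lambda>e. \<Sum>i\<in>I. k i * c i e) t = (\<Sum>i\<in>I. k i * chain_boundary S (c i) t)"
  unfolding chain_boundary_def by (subst sum.swap) (simp add: sum_distrib_left)

lemma chain_boundary_oriented_edge:
  assumes "finite S" "r \<in> S" "t \<in> S" "r \<noteq> t"
  shows "chain_boundary S (oriented_edge r t) v = of_bool (v = t) - of_bool (v = r)"
proof -
  have "chain_boundary S (oriented_edge r t) v =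
      (\<Sum>w\<in>S. (if w = r then of_bool (v = t) else 0) - (if w = t then of_bool (v = r) else 0))"
    unfolding chain_boundary_def oriented_edge_def using assms(4)
    by (intro sum.cong) auto
  then show ?thesis
    using assms by (simp add: sum_subtractf)
qed

text \<open>Induction on the sum of the absolute values over \<open>E\<close>. By antisymmetry a
  nonzero chain has a positive coefficient somewhere, so there is always an oriented edge to peel
  off; negative multiples of an edge are covered by its reversal.\<close>

lemma chain_induct [consumes 2, case_names zero add]:
  assumes E: "chain_graph S E" and c: "c \<in> carrier (chain_group E)"
    and zero: "P (\<lambda>e. 0)"
    and add: "\<And>c r t. c \<in> carrier (chain_group E) \<Longrightarrow> (r, t) \<in> E \<Longrightarrow> P c \<Longrightarrow>
      P (\<lambda>e. c e + oriented_edge r t e)"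
  shows "P c"
  using c
proof (induction "\<Sum>e\<in>E. nat \<bar>c e\<bar>" arbitrary: c rule: less_induct)
  case less
  note fin = chain_graph_finite(2)[OF E]
  show ?case
  proof (cases "\<exists>r t. c (r, t) > 0")
    case False
    have "c (r, t) = 0" for r t
    proof -
      have "c (r, t) \<le> 0" "c (t, r) \<le> 0"
        using False by (auto simp: not_less)
      moreover have "c (t, r) = - c (r, t)"
        using less.prems by (rule chain_group_antisym)
      ultimately show ?thesis by linarith
    qed
    then have "c = (\<lambda>e. 0)"
      by auto
    then show ?thesis
      using zero by simp
  next
    case True
    then obtain r t where rt: "c (r, t) > 0"
      by auto
    then have e: "(r, t) \<in> E"
      using chain_group_support[OF less.prems, of "(r, t)"] by auto
    define d where "d = (\<lambda>e. c e - oriented_edge r t e)"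
    have d: "d \<in> carrier (chain_group E)"
      unfolding d_def using less.prems oriented_edge_closed[OF E e] by (rule chain_group_diff_closed)
    have "c (t, r) = - c (r, t)"
      using less.prems by (rule chain_group_antisym)
    then have "c (t, r) < 0"
      using rt by simp
    \<comment> \<open>The entries at \<open>(r, t)\<close> and \<open>(t, r)\<close> have opposite
      signs, and both move towards zero.\<close>
    then have "\<bar>d e\<bar> \<le> \<bar>c e\<bar>" for e
      unfolding d_def oriented_edge_def using rt chain_graphD(4)[OF E e] by auto
    then have "nat \<bar>d e\<bar> \<le> nat \<bar>c e\<bar>" for e
      by (simp add: nat_mono)
    moreover have "\<bar>d (r, t)\<bar> < \<bar>c (r, t)\<bar>"
      unfolding d_def oriented_edge_def using rt by simp
    then have "nat \<bar>d (r, t)\<bar> < nat \<bar>c (r, t)\<bar>"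
      using nat_mono_iff by linarith
    ultimately have "(\<Sum>e\<in>E. nat \<bar>d e\<bar>) < (\<Sum>e\<in>E. nat \<bar>c e\<bar>)"
      using fin e by (intro sum_strict_mono_ex1) blast+
    then have "P d"
      using d by (rule less.hyps)
    with d e have "P (\<lambda>e. d e + oriented_edge r t e)"
      by (rule add)
    then show ?thesis
      by (simp add: d_def)
  qed
qed

lemma hom_chain_group_zero:
  assumes "\<psi> \<in> hom (chain_group E) (units_of \<complex>\<^sub>R)"
  shows "\<psi> (\<lambda>e. 0) = 1"
proof -
  have "\<psi> (\<lambda>e. 0) = \<psi> (\<lambda>e. 0) * \<psi> (\<lambda>e. 0)" "\<psi> (\<lambda>e. 0) \<noteq> 0"
    using assms chain_group_zero_closed[of E]
    by (force simp: hom_units_complex_iff chain_group_mult)+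
  then show ?thesis by simp
qed

lemma hom_chain_group_add:
  assumes "\<psi> \<in> hom (chain_group E) (units_of \<complex>\<^sub>R)"
    "c \<in> carrier (chain_group E)" "d \<in> carrier (chain_group E)"
  shows "\<psi> (\<lambda>e. c e + d e) = \<psi> c * \<psi> d"
  using assms by (simp add: hom_units_complex_iff chain_group_mult)

lemma hom_chain_group_nonzero:
  assumes "\<psi> \<in> hom (chain_group E) (units_of \<complex>\<^sub>R)" "c \<in> carrier (chain_group E)"
  shows "\<psi> c \<noteq> 0"
  using assms by (simp add: hom_units_complex_iff)

lemma hom_chain_group_reverse:
  assumes "chain_graph S E" "\<psi> \<in> hom (chain_group E) (units_of \<complex>\<^sub>R)" "(r, t) \<in> E"
  shows "\<psi> (oriented_edge t r) * \<psi> (oriented_edge r t) = 1"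
proof -
  have "(\<lambda>e. oriented_edge t r e + oriented_edge r t e) = (\<lambda>e. 0)"
    using chain_graphD(4)[OF assms(1,3)] by (auto simp: oriented_edge_def)
  then show ?thesis
    using hom_chain_group_add[OF assms(2), of "oriented_edge t r" "oriented_edge r t"]
      hom_chain_group_zero[OF assms(2)] oriented_edge_closed[OF assms(1)] assms(3)
      chain_graphD(3)[OF assms(1,3)]
    by simp
qed

lemma hom_chain_group_eqI:
  assumes E: "chain_graph S E"
    and \<psi>: "\<psi> \<in> hom (chain_group E) (units_of \<complex>\<^sub>R)" "\<psi>' \<in> hom (chain_group E) (units_of \<complex>\<^sub>R)"
    and eq: "\<And>r t. (r, t) \<in> E \<Longrightarrow> \<psi> (oriented_edge r t) = \<psi>' (oriented_edge r t)"
    and c: "c \<in> carrier (chain_group E)"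
  shows "\<psi> c = \<psi>' c"
  using E c
proof (induction rule: chain_induct)
  case zero
  then show ?case using \<psi> by (simp add: hom_chain_group_zero)
next
  case (add c r t)
  then show ?case
    using \<psi> eq oriented_edge_closed[OF E] by (simp add: hom_chain_group_add)
qed

text \<open>The chains are free on one orientation of every edge, so the weights can be prescribed
  there; the second condition on \<open>w\<close> settles the opposite orientation.\<close>

lemma hom_chain_group_exists:
  fixes w :: "'s \<Rightarrow> 's \<Rightarrow> complex"
  assumes E: "chain_graph S E"
    and w: "\<And>r t. (r, t) \<in> E \<Longrightarrow> w r t \<noteq> 0" "\<And>r t. (r, t) \<in> E \<Longrightarrow> w t r = inverse (w r t)"
  shows "\<exists>\<psi>\<in>hom (chain_group E) (units_of \<complex>\<^sub>R). \<forall>(r, t)\<in>E. \<psi> (oriented_edge r t) = w r t"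
proof -
  note fin = chain_graph_finite(2)[OF E]
  obtain idx :: "'s \<Rightarrow> nat" where idx: "inj_on idx S"
    using finite_imp_inj_to_nat_seg[OF chain_graph_finite(1)[OF E]] by auto
  \<comment> \<open>The injection \<open>idx\<close> into the naturals singles out one orientation
    of each edge.\<close>
  define F where "F = {(r, t)\<in>E. idx r < idx t}"
  have F: "finite F" "\<And>r t. (r, t) \<in> F \<Longrightarrow> w r t \<noteq> 0"
    using w finite_subset[OF _ fin, of F] by (auto simp: F_def)
  define \<psi> where "\<psi> = (\<lambda>c :: 's \<times> 's \<Rightarrow> int. \<Prod>(r, t)\<in>F. w r t powi c (r, t))"
  have "\<psi> c \<noteq> 0" for c
    using F by (auto simp: \<psi>_def)
  moreover have "\<psi> (\<lambda>e. c e + d e) = \<psi> c * \<psi> d" for c d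
    unfolding \<psi>_def prod.distrib[symmetric]
    using F by (intro prod.cong) (auto simp: power_int_add)
  ultimately have hom: "\<psi> \<in> hom (chain_group E) (units_of \<complex>\<^sub>R)"
    by (simp add: hom_units_complex_iff chain_group_mult)
  have F1: "\<psi> (oriented_edge r t) = w r t" if "(r, t) \<in> F" for r t
  proof -
    have "\<psi> (oriented_edge r t) = (\<Prod>e\<in>F. if e = (r, t) then w r t else 1)"
      unfolding \<psi>_def
    proof (intro prod.cong refl)
      fix e assume "e \<in> F"
      then have "e \<noteq> (t, r)"
        using that by (auto simp: F_def)
      then show "(case e of (r', t') \<Rightarrow> w r' t' powi oriented_edge r t (r', t')) =
          (if e = (r, t) then w r t else 1)"
        by (cases e) (auto simp: oriented_edge_def)
    qed
    then show ?thesis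
      using F that by simp
  qed
  have "\<psi> (oriented_edge r t) = w r t" if e: "(r, t) \<in> E" for r t
  proof (cases "(r, t) \<in> F")
    case False
    moreover have "idx r \<noteq> idx t"
      using inj_onD[OF idx, of r t] chain_graphD[OF E e] by blast
    ultimately have "(t, r) \<in> F"
      using e chain_graphD(3)[OF E e] by (simp add: F_def)
    moreover have "\<psi> (oriented_edge t r) * \<psi> (oriented_edge r t) = 1"
      by (rule hom_chain_group_reverse[OF E hom e])
    ultimately show ?thesis
      using F1 w[OF e] by (auto simp: field_simps)
  qed (simp add: F1)
  then show ?thesis
    using hom by blast
qed

section \<open>Paths from component roots; characters of cycles against characters of chains\<close>

text \<open>A substitute for a spanning forest: only the boundary of \<open>p t\<close> matters, so
  the chain of any walk from the root will do.\<close>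

lemma chain_graph_paths:
  assumes E: "chain_graph S E"
  obtains root p where
    "\<And>t. t \<in> S \<Longrightarrow> root t \<in> S"
    "\<And>r t. (r, t) \<in> E \<Longrightarrow> root r = root t"
    "\<And>t. t \<in> S \<Longrightarrow> p t \<in> carrier (chain_group E)"
    "\<And>t v. t \<in> S \<Longrightarrow> chain_boundary S (p t) v = of_bool (v = t) - of_bool (v = root t)"
proof -
  \<comment> \<open>Both ends of an edge are reachable from the same vertices, so the choice
    operator is applied to the same predicate and picks the same root.\<close>
  define root where "root = (\<lambda>t. SOME r. (r, t) \<in> E\<^sup>*)"
  have root: "(root t, t) \<in> E\<^sup>*" for t
    unfolding root_def by (rule someI[of _ t]) simp
  have rootS: "root t \<in> S" if "t \<in> S" for t
    using root[of t] that by (induction rule: converse_rtrancl_induct) (auto dest: chain_graphD[OF E])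
  have root_eq: "root r = root t" if "(r, t) \<in> E" for r t
  proof -
    have "(q, r) \<in> E\<^sup>* \<longleftrightarrow> (q, t) \<in> E\<^sup>*" for q
      using that chain_graphD(3)[OF E that] by (blast intro: rtrancl.rtrancl_into_rtrancl)
    then show ?thesis by (simp add: root_def)
  qed
  have path: "\<exists>p\<in>carrier (chain_group E).
      \<forall>v. chain_boundary S p v = of_bool (v = t) - of_bool (v = q)"
    if "(q, t) \<in> E\<^sup>*" for q t
    using that
  proof (induction rule: rtrancl_induct)
    case base
    show ?case
      by (intro bexI[of _ "\<lambda>e. 0"]) (auto simp: chain_boundary_def chain_group_zero_closed)
  next
    case (step s t)
    then obtain p where p: "p \<in> carrier (chain_group E)"
      "\<And>v. chain_boundary S p v = of_bool (v = s) - of_bool (v = q)"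
      by blast
    show ?case
      using p chain_graph_finite(1)[OF E] chain_graphD[OF E step(2)] oriented_edge_closed[OF E step(2)]
      by (intro bexI[of _ "\<lambda>e. p e + oriented_edge s t e"])
        (auto simp: chain_boundary_add chain_boundary_oriented_edge chain_group_add_closed)
  qed
  have "\<forall>t. \<exists>p. p \<in> carrier (chain_group E) \<and>
      (\<forall>v. chain_boundary S p v = of_bool (v = t) - of_bool (v = root t))"
    using path[OF root] by blast
  then obtain p where "\<And>t. p t \<in> carrier (chain_group E)"
    "\<And>t v. chain_boundary S (p t) v = of_bool (v = t) - of_bool (v = root t)"
    by metis
  then show ?thesis
    using that rootS root_eq by blast
qed

text \<open>
  Subtracting from a chain the paths from the roots to the points of its boundary is a retraction
  of the chains onto the cycles, along which characters extend.
\<close>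

lemma H1_character_extends:
  assumes E: "chain_graph S E" and \<chi>: "\<chi> \<in> H1_characters S E"
  obtains \<psi> where "\<psi> \<in> hom (chain_group E) (units_of \<complex>\<^sub>R)"
    "\<chi> = restrict \<psi> (carrier (H1_group S E))"
proof -
  obtain root p where
    root: "\<And>t. t \<in> S \<Longrightarrow> root t \<in> S" "\<And>r t. (r, t) \<in> E \<Longrightarrow> root r = root t" and
    p: "\<And>t. t \<in> S \<Longrightarrow> p t \<in> carrier (chain_group E)"
      "\<And>t v. t \<in> S \<Longrightarrow> chain_boundary S (p t) v = of_bool (v = t) - of_bool (v = root t)"
    by (rule chain_graph_paths[OF E]) (rule that; assumption)
  note fin = chain_graph_finite(1)[OF E]
  define R where "R = (\<lambda>c e. c e - (\<Sum>t\<in>S. chain_boundary S c t * p t e))"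
  have R_chain: "R c \<in> carrier (chain_group E)" if "c \<in> carrier (chain_group E)" for c
  proof (rule chain_groupI)
    show "R c (t, r) = - R c (r, t)" for r t
      using chain_group_antisym[OF that, of t r] chain_group_antisym[OF p(1), of _ t r]
      by (simp add: R_def sum_negf)
    show "R c e = 0" if "e \<notin> E" for e
      using chain_group_support[OF \<open>c \<in> carrier (chain_group E)\<close> that]
        chain_group_support[OF p(1) that] by (simp add: R_def)
  qed
  \<comment> \<open>The boundary has total coefficient zero on every component, because each edge
    contributes \<open>t - r\<close> and its ends share a root. Hence the root terms cancel in the
    boundary of \<open>R c\<close>.\<close>
  have component: "(\<Sum>t\<in>S. chain_boundary S c t * of_bool (v = root t)) = 0"
    if "c \<in> carrier (chain_group E)" for c v
    using E that
  proof (induction rule: chain_induct)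
    case zero
    then show ?case by (simp add: chain_boundary_def)
  next
    case (add c r t)
    have "(\<Sum>u\<in>S. chain_boundary S (oriented_edge r t) u * of_bool (v = root u)) =
        (\<Sum>u\<in>S. (if u = t then of_bool (v = root t) else 0) - (if u = r then of_bool (v = root r) else 0))"
      using chain_graphD[OF E add(2)] chain_graph_finite(1)[OF E] by (intro sum.cong) (auto simp: chain_boundary_oriented_edge)
    also have "\<dots> = 0"
      using chain_graphD[OF E add(2)] chain_graph_finite(1)[OF E] root(2)[OF add(2)] by (simp add: sum_subtractf)
    finally show ?case
      using add by (simp add: chain_boundary_add distrib_right sum.distrib)
  qed
  have R_cycle: "R c \<in> carrier (H1_group S E)" if c: "c \<in> carrier (chain_group E)" for c
  proof -
    have "chain_boundary S (R c) v = 0" if v: "v \<in> S" for v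
    proof -
      have "chain_boundary S (R c) v =
          chain_boundary S c v - (\<Sum>t\<in>S. chain_boundary S c t * chain_boundary S (p t) v)"
        unfolding R_def chain_boundary_diff chain_boundary_sum ..
      also have "(\<Sum>t\<in>S. chain_boundary S c t * chain_boundary S (p t) v) =
          (\<Sum>t\<in>S. (if t = v then chain_boundary S c t else 0) - chain_boundary S c t * of_bool (v = root t))"
        by (intro sum.cong) (auto simp: p(2))
      also have "\<dots> = chain_boundary S c v"
        using v fin component[OF c] by (simp add: sum_subtractf)
      finally show ?thesis by simp
    qed
    then show ?thesis
      using R_chain[OF c] by (simp add: H1_group_carrier)
  qed
  have R_add: "R (\<lambda>e. c e + d e) = (\<lambda>e. R c e + R d e)" for c d
    by (simp add: R_def chain_boundary_add distrib_right sum.distrib fun_eq_iff)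
  have R_id: "R c = c" if "c \<in> carrier (H1_group S E)" for c
    using that by (simp add: R_def H1_group_carrier)
  have \<chi>_hom: "\<chi> \<in> hom (H1_group S E) (units_of \<complex>\<^sub>R)" "\<chi> \<in> extensional (carrier (H1_group S E))"
    using \<chi> by (auto simp: H1_characters_def)
  have "\<chi> \<circ> R \<in> hom (chain_group E) (units_of \<complex>\<^sub>R)"
    using \<chi>_hom(1) R_cycle by (auto simp: hom_units_complex_iff chain_group_mult H1_group_mult R_add)
  moreover have "\<chi> = restrict (\<chi> \<circ> R) (carrier (H1_group S E))"
    by (rule extensionalityI[OF \<chi>_hom(2)]) (simp_all add: R_id)
  ultimately show ?thesis
    using that by blast
qed

text \<open>Integration along the paths: \<open>f t\<close> is the quotient of the two characters on
  the path to \<open>t\<close>. An edge closed up by the paths to its ends is a cycle, and there the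
  characters agree.\<close>

lemma coboundary_of_eq_on_H1:
  assumes E: "chain_graph S E"
    and \<psi>: "\<psi> \<in> hom (chain_group E) (units_of \<complex>\<^sub>R)" "\<psi>' \<in> hom (chain_group E) (units_of \<complex>\<^sub>R)"
    and eq: "\<And>c. c \<in> carrier (H1_group S E) \<Longrightarrow> \<psi> c = \<psi>' c"
  obtains f where "\<And>t. t \<in> S \<Longrightarrow> f t \<noteq> 0"
    "\<And>r t. (r, t) \<in> E \<Longrightarrow> \<psi>' (oriented_edge r t) = \<psi> (oriented_edge r t) * f t / f r"
proof -
  obtain root p where
    root: "\<And>t. t \<in> S \<Longrightarrow> root t \<in> S" "\<And>r t. (r, t) \<in> E \<Longrightarrow> root r = root t" and
    p: "\<And>t. t \<in> S \<Longrightarrow> p t \<in> carrier (chain_group E)"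
      "\<And>t v. t \<in> S \<Longrightarrow> chain_boundary S (p t) v = of_bool (v = t) - of_bool (v = root t)"
    by (rule chain_graph_paths[OF E]) (rule that; assumption)
  have "\<psi>' (oriented_edge r t) = \<psi> (oriented_edge r t) * (\<psi>' (p t) / \<psi> (p t)) / (\<psi>' (p r) / \<psi> (p r))"
    if e: "(r, t) \<in> E" for r t
  proof -
    note rt = chain_graphD[OF E e]
    \<comment> \<open>Its boundary vanishes because the paths to \<open>r\<close> and
      \<open>t\<close> start at the same root.\<close>
    define z where "z = (\<lambda>e. (p r e + oriented_edge r t e) - p t e)"
    have pe: "(\<lambda>e. p r e + oriented_edge r t e) \<in> carrier (chain_group E)"
      using p(1)[OF rt(1)] oriented_edge_closed[OF E e] by (rule chain_group_add_closed)
    then have z: "z \<in> carrier (chain_group E)"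
      unfolding z_def using p(1)[OF rt(2)] by (rule chain_group_diff_closed)
    moreover have "chain_boundary S z v = 0" for v
      unfolding z_def chain_boundary_diff chain_boundary_add
      using rt root(2)[OF e] chain_graph_finite(1)[OF E] by (simp add: chain_boundary_oriented_edge p(2))
    ultimately have "\<psi> z = \<psi>' z"
      by (intro eq) (simp add: H1_group_carrier)
    moreover have "\<theta> z * \<theta> (p t) = \<theta> (p r) * \<theta> (oriented_edge r t)"
      if "\<theta> \<in> hom (chain_group E) (units_of \<complex>\<^sub>R)" for \<theta>
    proof -
      have "(\<lambda>e. z e + p t e) = (\<lambda>e. p r e + oriented_edge r t e)"
        by (simp add: z_def)
      then show ?thesis
        using hom_chain_group_add[OF that z p(1)[OF rt(2)]]
          hom_chain_group_add[OF that p(1)[OF rt(1)] oriented_edge_closed[OF E e]] by simp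
    qed
    note this[OF \<psi>(1)] this[OF \<psi>(2)]
    moreover have nz: "\<psi> (p r) \<noteq> 0" "\<psi> (p t) \<noteq> 0" "\<psi>' (p r) \<noteq> 0"
      using hom_chain_group_nonzero \<psi> p(1) rt by blast+
    ultimately have "\<psi> (oriented_edge r t) = \<psi> z * \<psi> (p t) / \<psi> (p r)"
      "\<psi>' (oriented_edge r t) = \<psi> z * \<psi>' (p t) / \<psi>' (p r)"
      by (simp_all add: field_simps)
    then show ?thesis
      using nz by simp
  qed
  moreover have "\<psi>' (p t) / \<psi> (p t) \<noteq> 0" if "t \<in> S" for t
    using hom_chain_group_nonzero[OF \<psi>(1) p(1)[OF that]] hom_chain_group_nonzero[OF \<psi>(2) p(1)[OF that]]
    by simp
  ultimately show ?thesis
    using that[of "\<lambda>t. \<psi>' (p t) / \<psi> (p t)"] by blast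
qed

text \<open>The coboundary of \<open>f\<close> extends to all chains as the product of the powers
  \<open>f t powi chain_boundary S c t\<close>, and this product is 1 on cycles.\<close>

lemma eq_on_H1_of_coboundary:
  assumes E: "chain_graph S E"
    and \<psi>: "\<psi> \<in> hom (chain_group E) (units_of \<complex>\<^sub>R)" "\<psi>' \<in> hom (chain_group E) (units_of \<complex>\<^sub>R)"
    and f: "\<And>t. t \<in> S \<Longrightarrow> f t \<noteq> 0"
    and cob: "\<And>r t. (r, t) \<in> E \<Longrightarrow> \<psi>' (oriented_edge r t) = \<psi> (oriented_edge r t) * f t / f r"
    and c: "c \<in> carrier (H1_group S E)"
  shows "\<psi> c = \<psi>' c"
proof -
  define \<kappa> where "\<kappa> = (\<lambda>c. \<psi> c * (\<Prod>t\<in>S. f t powi chain_boundary S c t))"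
  note fin = chain_graph_finite(1)[OF E]
  have "\<kappa> \<in> hom (chain_group E) (units_of \<complex>\<^sub>R)"
    unfolding hom_units_complex_iff chain_group_mult
  proof (intro conjI ballI)
    show "\<kappa> c \<noteq> 0" if "c \<in> carrier (chain_group E)" for c
      using hom_chain_group_nonzero[OF \<psi>(1) that] f fin by (auto simp: \<kappa>_def)
    show "\<kappa> (\<lambda>e. c e + d e) = \<kappa> c * \<kappa> d"
      if "c \<in> carrier (chain_group E)" "d \<in> carrier (chain_group E)" for c d
      using hom_chain_group_add[OF \<psi>(1) that] f
      by (simp add: \<kappa>_def chain_boundary_add power_int_add prod.distrib)
  qed
  then have "\<kappa> c = \<psi>' c"
  proof (rule hom_chain_group_eqI[OF E _ \<psi>(2)])
  show "\<kappa> (oriented_edge r t) = \<psi>' (oriented_edge r t)" if e: "(r, t) \<in> E" for r t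
  proof -
    note rt = chain_graphD[OF E e]
    have "(\<Prod>v\<in>S. f v powi chain_boundary S (oriented_edge r t) v) =
        (\<Prod>v\<in>S. (if v = t then f t else 1) * (if v = r then inverse (f r) else 1))"
      using rt fin by (intro prod.cong) (auto simp: chain_boundary_oriented_edge)
    also have "\<dots> = f t / f r"
      using rt fin by (simp add: prod.distrib divide_inverse)
    finally show ?thesis
      using cob[OF e] by (simp add: \<kappa>_def)
  qed
  qed (use c in \<open>simp add: H1_group_carrier\<close>)
  then show ?thesis
    using c by (simp add: \<kappa>_def H1_group_carrier)
qed

section \<open>Products of two reflections in the plane\<close>

text \<open>
  The matrix of \<open>rt\<close> in the basis \<open>\<beta>\<^sub>r, \<beta>\<^sub>t\<close>. Its determinant is \<open>1\<close> and its trace \<open>x y - 2\<close>, so by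
  Cayley-Hamilton its powers are governed by the recurrence of \<open>trace_seq (x y - 2)\<close>.
\<close>

definition rotation :: "complex \<Rightarrow> complex \<Rightarrow> complex \<times> complex \<Rightarrow> complex \<times> complex" where
  "rotation x y = (\<lambda>(p, q). ((x * y - 1) * p - x * q, y * p - q))"

text \<open>Chebyshev polynomials of the second kind at \<open>\<tau> / 2\<close>, with the index
  shifted by one so that the sequence starts with 0.\<close>

fun trace_seq :: "complex \<Rightarrow> nat \<Rightarrow> complex" where
  "trace_seq \<tau> 0 = 0"
| "trace_seq \<tau> (Suc 0) = 1"
| "trace_seq \<tau> (Suc (Suc j)) = \<tau> * trace_seq \<tau> (Suc j) - trace_seq \<tau> j"

text \<open>Cayley-Hamilton in the form \<open>M ^ Suc j = U (Suc j) * M - U j\<close> for a matrix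
  \<open>M\<close> of determinant 1; with the exponent \<open>Suc j\<close> both indices stay
  natural numbers.\<close>

lemma rotation_funpow:
  "(rotation x y ^^ Suc j) (p, q) =
    (let U = trace_seq (x * y - 2) in
      (U (Suc j) * ((x * y - 1) * p - x * q) - U j * p, U (Suc j) * (y * p - q) - U j * q))"
proof (induction j)
  case 0
  then show ?case by (simp add: rotation_def)
next
  case (Suc j)
  have "(rotation x y ^^ Suc (Suc j)) (p, q) = rotation x y ((rotation x y ^^ Suc j) (p, q))"
    by simp
  then show ?case
    unfolding Suc by (simp add: rotation_def Let_def algebra_simps)
qed

text \<open>The traces 2 and -2 are those with a double eigenvalue, where the formula of
  \<open>trace_seq_inverse\<close> degenerates to \<open>0 = 0\<close>.\<close>

lemma trace_seq_2: "trace_seq 2 j = of_nat j"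
  by (induction "2 :: complex" j rule: trace_seq.induct) (auto simp: algebra_simps)

lemma trace_seq_minus_2: "trace_seq (-2) j = - ((-1) ^ j * of_nat j)"
  by (induction "-2 :: complex" j rule: trace_seq.induct) (auto simp: algebra_simps)

text \<open>Here \<open>w\<close> and \<open>inverse w\<close> are the eigenvalues of a matrix with
  determinant 1 and trace \<tau>. The usual quotient is multiplied out, so that no division by
  \<open>w - inverse w\<close> occurs.\<close>

lemma trace_seq_inverse:
  assumes "w \<noteq> 0" "\<tau> = w + inverse w"
  shows "(w - inverse w) * trace_seq \<tau> j = w ^ j - inverse w ^ j"
  using assms(2)
proof (induction \<tau> j rule: trace_seq.induct)
  case (3 \<tau> j)
  have "(w - inverse w) * trace_seq \<tau> (Suc (Suc j)) =
      \<tau> * ((w - inverse w) * trace_seq \<tau> (Suc j)) - (w - inverse w) * trace_seq \<tau> j"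
    by (simp add: algebra_simps)
  also have "\<dots> = (w + inverse w) * (w ^ Suc j - inverse w ^ Suc j) - (w ^ j - inverse w ^ j)"
    using 3 by simp
  also have "\<dots> = w ^ Suc (Suc j) - inverse w ^ Suc (Suc j)"
  proof -
    have "w * (inverse w * z) = z" for z
      using assms(1) by (simp flip: mult.assoc)
    note cancel = this
    show ?thesis
      by (simp add: algebra_simps cancel)
  qed
  finally show ?case .
qed auto

text \<open>The simultaneous vanishing comes from finite order: with product zero and just one
  nonzero entry, the rotation is -1 times a nontrivial unipotent matrix.\<close>

definition dihedral_valid :: "enat \<Rightarrow> complex \<Rightarrow> complex \<Rightarrow> bool" where
  "dihedral_valid m x y \<longleftrightarrow>
    (\<forall>n. m = enat n \<longrightarrow> (x = 0 \<longleftrightarrow> y = 0) \<and>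
      (\<exists>k. 1 \<le> k \<and> 2 * k \<le> n \<and> x * y = complex_of_real ((2 * cos (real k * pi / real n))\<^sup>2)))"

text \<open>The trace \<open>x * y - 2\<close> becomes twice the cosine of the doubled angle, which
  exhibits the eigenvalues of the rotation.\<close>

lemma cos_double_param:
  "complex_of_real ((2 * cos (real k * pi / real n))\<^sup>2) - 2 =
    cis (2 * pi * real k / real n) + inverse (cis (2 * pi * real k / real n))"
proof -
  have "(2 * cos (real k * pi / real n))\<^sup>2 - 2 = 2 * cos (2 * (real k * pi / real n))"
    unfolding cos_double_cos by (simp add: power_mult_distrib)
  also have "2 * (real k * pi / real n) = 2 * pi * real k / real n"
    by simp
  finally have "complex_of_real ((2 * cos (real k * pi / real n))\<^sup>2 - 2) =
      complex_of_real (2 * cos (2 * pi * real k / real n))"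
    by (simp only:)
  then show ?thesis
    by (simp add: complex_eq_iff cis_inverse)
qed

text \<open>The angles lie in the first quadrant. There the cosine is nonnegative, hence recoverable
  from its square, and vanishes only at the right end.\<close>

lemma cos_param_bounds:
  assumes "1 \<le> k" "2 * k \<le> n"
  shows "0 < real k * pi / real n" "real k * pi / real n \<le> pi / 2"
    "2 * k < n \<Longrightarrow> real k * pi / real n < pi / 2" "0 \<le> cos (real k * pi / real n)"
    "cos (real k * pi / real n) = 0 \<longleftrightarrow> 2 * k = n"
proof -
  have n: "0 < real n" "2 * real k \<le> real n"
    using assms by linarith+
  show 1: "0 < real k * pi / real n" "real k * pi / real n \<le> pi / 2"
    using assms n by (simp_all add: field_simps)
  show 2: "real k * pi / real n < pi / 2" if "2 * k < n"
    using that n by (simp add: field_simps)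
  show 3: "0 \<le> cos (real k * pi / real n)"
    by (intro cos_ge_zero) (use 1 pi_gt_zero in linarith)+
  show "cos (real k * pi / real n) = 0 \<longleftrightarrow> 2 * k = n"
  proof (cases "2 * k < n")
    case True
    then have "0 < cos (real k * pi / real n)"
      by (intro cos_gt_zero_pi) (use 1 2 pi_gt_zero in linarith)+
    then show ?thesis using True by simp
  next
    case False
    then have "n = 2 * k" using assms by simp
    moreover have "real k * pi / real (2 * k) = pi / 2"
      using assms by simp
    ultimately show ?thesis by (simp only: cos_pi_half simp_thms)
  qed
qed

text \<open>If \<open>2 * k = n\<close>, the rotation is -1 and \<open>n\<close> is even. Otherwise
  its eigenvalue \<open>w\<close> is an \<open>n\<close>-th root of unity different from its
  inverse, so \<open>trace_seq\<close> takes the value 0 at \<open>n\<close> and -1 at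
  \<open>n - 1\<close>, and Cayley-Hamilton yields the identity.\<close>

lemma rotation_period_if_valid:
  assumes "dihedral_valid (enat n) x y"
  shows "(rotation x y ^^ n) v = v"
proof -
  obtain p q where v: "v = (p, q)" by (cases v)
  obtain k where k: "1 \<le> k" "2 * k \<le> n" and zero: "x = 0 \<longleftrightarrow> y = 0"
    and xy: "x * y = complex_of_real ((2 * cos (real k * pi / real n))\<^sup>2)"
    using assms unfolding dihedral_valid_def by blast
  note b = cos_param_bounds[OF k]
  show ?thesis
  proof (cases "2 * k = n")
    case True
    then have "x * y = 0"
      unfolding xy using b(5) by simp
    then have "x = 0" "y = 0"
      using zero by auto
    then have "(rotation x y ^^ j) (p, q) = ((-1) ^ j * p, (-1) ^ j * q)" for j
      by (induction j) (auto simp: rotation_def)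
    moreover have "(-1 :: complex) ^ n = 1"
      using True by auto
    ultimately show ?thesis
      using v by simp
  next
    case False
    define w where "w = cis (2 * pi * real k / real n)"
    have w: "w \<noteq> 0" "x * y - 2 = w + inverse w"
      unfolding w_def xy by (simp, rule cos_double_param)
    have wn: "w ^ n = 1"
      unfolding w_def using k by (subst DeMoivre) (simp add: cis_2pi mult.commute[of "real k"] flip: cis_power_int)
    \<comment> \<open>The doubled angle lies strictly between 0 and \<pi>, so \<open>w\<close> is
      not real and the two eigenvalues differ.\<close>
    have "Im w > 0"
      unfolding w_def using b(1,3) False k
      by (simp, intro sin_gt_zero) (auto simp: field_simps)
    then have ww: "w - inverse w \<noteq> 0"
      by (auto simp: w_def complex_eq_iff cis_inverse)
    obtain j where j: "n = Suc j" using k by (cases n) auto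
    have "(w - inverse w) * trace_seq (x * y - 2) n = 0"
      using trace_seq_inverse[OF w, of n] wn by (simp add: power_inverse)
    then have "trace_seq (x * y - 2) (Suc j) = 0"
      using ww unfolding j mult_eq_0_iff by blast
    moreover have "trace_seq (x * y - 2) j = -1"
    proof -
      have "w ^ j = inverse w"
        using wn w(1) unfolding j by (simp add: field_simps)
      then have "(w - inverse w) * trace_seq (x * y - 2) j = - (w - inverse w)"
        using trace_seq_inverse[OF w, of j] by (simp add: power_inverse)
      then have "(w - inverse w) * (trace_seq (x * y - 2) j + 1) = 0"
        by (simp add: algebra_simps)
      then show ?thesis using ww by (simp add: add_eq_0_iff2)
    qed
    ultimately show ?thesis
      unfolding v j rotation_funpow by (simp add: Let_def)
  qed
qed

text \<open>A root of \<open>w * w - \<tau> * w + 1\<close>, that is, an eigenvalue of a matrix with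
  determinant 1 and trace \<tau>.\<close>

lemma exists_inverse_sum: "\<exists>w :: complex. w \<noteq> 0 \<and> w + inverse w = \<tau>"
proof -
  define d where "d = csqrt (\<tau>\<^sup>2 - 4)"
  define w where "w = (\<tau> + d) / 2"
  have "d\<^sup>2 = \<tau>\<^sup>2 - 4" by (simp add: d_def)
  then have "w * (\<tau> - w) = 1"
    by (simp add: w_def field_simps power2_eq_square)
  then have "w \<noteq> 0" "inverse w = \<tau> - w"
    by (auto intro: inverse_unique)
  then show ?thesis by (intro exI[of _ w]) simp
qed

text \<open>Comparing coefficients in Cayley-Hamilton at exponent \<open>n\<close> gives
  \<open>U * x = U * y = 0\<close> and \<open>U + U' = -1\<close>. An eigenvalue 1 is incompatible
  with \<open>x * y = 4\<close>, an eigenvalue -1 forces both coefficients to vanish and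
  \<open>n\<close> to be even, and any other eigenvalue is an \<open>n\<close>-th root of
  unity.\<close>

lemma valid_if_rotation_period:
  assumes n: "2 \<le> n" and per: "\<And>v. (rotation x y ^^ n) v = v"
  shows "dihedral_valid (enat n) x y"
proof -
  define \<tau> where "\<tau> = x * y - 2"
  obtain j where j: "n = Suc j" using n by (cases n) auto
  define U where "U = trace_seq \<tau> n"
  define U' where "U' = trace_seq \<tau> j"
  have "(U * ((x * y - 1) * p - x * q) - U' * p, U * (y * p - q) - U' * q) = (p, q)" for p q
    using per[of "(p, q)"] unfolding j rotation_funpow Let_def U_def U'_def \<tau>_def .
  \<comment> \<open>The images of the two basis vectors are the columns of the matrix
    identity.\<close>
  from this[of 1 0] this[of 0 1]
  have eq: "U * x = 0" "U * y = 0" and "- U - U' = 1"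
    by auto
  moreover have "U + U' = - (- U - U')"
    by simp
  ultimately have eq3: "U + U' = -1"
    by simp
  obtain w where w: "w \<noteq> 0" "\<tau> = w + inverse w"
    using exists_inverse_sum by metis
  have xy: "w * (x * y) = (w + 1)\<^sup>2"
  proof -
    have "x * y = w + inverse w + 2" using w(2) by (simp add: \<tau>_def diff_eq_eq)
    then show ?thesis using w(1) by (simp add: field_simps power2_eq_square)
  qed
  consider "w = 1" | "w = -1" | "w \<noteq> 1" "w \<noteq> -1" by blast
  then show ?thesis
  proof cases
    case 1
    then have "U = of_nat n" unfolding U_def w(2) using trace_seq_2 by simp
    then have "x = 0" using eq(1) n by simp
    then show ?thesis using xy 1 by simp
  next
    case 2
    then have U: "U = - ((-1) ^ n * of_nat n)" "U' = - ((-1) ^ j * of_nat j)"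
      unfolding U_def U'_def w(2) using trace_seq_minus_2 by simp_all
    then have x: "x = 0" "y = 0" using eq n by simp_all
    have "even n"
    proof (rule ccontr)
      assume "odd n"
      then have "of_nat n - of_nat j = (-1 :: complex)"
        using eq3 U j by simp
      then show False unfolding j by simp
    qed
    then obtain k where k: "n = 2 * k" by (elim evenE)
    have "x * y = complex_of_real ((2 * cos (real k * pi / real n))\<^sup>2)"
      using x k n cos_param_bounds(5)[of k n] by simp
    then show ?thesis
      unfolding dihedral_valid_def using x k n by (auto intro!: exI[of _ k])
  next
    case 3
    have nz: "x \<noteq> 0" "y \<noteq> 0"
      using xy 3 w(1) by (auto simp: add_eq_0_iff2)
    then have U: "U = 0" "U' = -1" using eq eq3 by auto
    have ww: "w - inverse w \<noteq> 0"
    proof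
      assume "w - inverse w = 0"
      then have "w * w = 1" using w(1) by (simp add: field_simps)
      then show False using 3 by (simp add: square_eq_1_iff)
    qed
    have "w ^ n = inverse w ^ n"
      using trace_seq_inverse[OF w, of n] U by (simp add: U_def)
    moreover have "inverse w - w = w ^ j - inverse w ^ j"
      using trace_seq_inverse[OF w, of j] U by (simp add: U'_def)
    moreover have "w ^ j = w ^ n * inverse w" "inverse w ^ j = inverse w ^ n * w"
      using w(1) unfolding j by simp_all
    ultimately have "w ^ n * (w - inverse w) = w - inverse w"
      by (simp add: algebra_simps)
    then have "w ^ n = 1"
      using ww by simp
    then obtain l where l: "l < n" "w = cis (2 * pi * real l / real n)"
      using n bij_betw_roots_unity[of n] by (auto simp: bij_betw_def image_iff)
    \<comment> \<open>Replacing \<open>w\<close> by its inverse does not change the trace, so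
      \<open>l\<close> may be reflected to \<open>n - l\<close> to reach the range
      \<open>2 * k \<le> n\<close>.\<close>
    define k where "k = (if 2 * l \<le> n then l else n - l)"
    have l0: "l \<noteq> 0"
      using 3(1) l(2) by (intro notI) simp
    then have k: "1 \<le> k" "2 * k \<le> n"
      using l(1) by (auto simp: k_def)
    have "cos (2 * pi * real k / real n) = cos (2 * pi * real l / real n)"
    proof (cases "2 * l \<le> n")
      case False
      then have "2 * pi * real k / real n = 2 * pi - 2 * pi * real l / real n"
        using l(1) by (simp add: k_def of_nat_diff field_simps)
      then show ?thesis by (simp add: cos_diff)
    qed (simp add: k_def)
    then have "w + inverse w = cis (2 * pi * real k / real n) + inverse (cis (2 * pi * real k / real n))"
      unfolding l(2) by (simp add: complex_eq_iff cis_inverse)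
    then have "x * y - 2 = complex_of_real ((2 * cos (real k * pi / real n))\<^sup>2) - 2"
      using w(2) cos_double_param[of k n] unfolding \<tau>_def by (simp only:)
    then have "x * y = complex_of_real ((2 * cos (real k * pi / real n))\<^sup>2)"
      by (metis diff_add_cancel)
    then show ?thesis
      unfolding dihedral_valid_def using nz k by auto
  qed
qed

text \<open>The angle is positive because \<open>1 \<le> k\<close>, so its cosine stays below 1. The
  number \<open>4 - x * y\<close> is the determinant of the two linear forms of \<open>r\<close> and
  \<open>t\<close> on their plane, to be inverted in
  \<open>matrix_reflection_period\<close>.\<close>

lemma valid_prod_ne_4:
  assumes "dihedral_valid (enat n) x y"
  shows "x * y \<noteq> 4"
proof -
  obtain k where k: "1 \<le> k" "2 * k \<le> n"
    and xy: "x * y = complex_of_real ((2 * cos (real k * pi / real n))\<^sup>2)"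
    using assms unfolding dihedral_valid_def by blast
  note b = cos_param_bounds[OF k]
  have "cos (real k * pi / real n) < cos 0"
    by (intro cos_monotone_0_pi) (use b(1,2) pi_gt_zero in linarith)+
  then have "(2 * cos (real k * pi / real n))\<^sup>2 < 2\<^sup>2"
    using b(4) by (intro power_strict_mono) auto
  then have "(2 * cos (real k * pi / real n))\<^sup>2 \<noteq> 4"
    by simp
  then show ?thesis
    unfolding xy by (metis of_real_eq_iff of_real_numeral)
qed

section \<open>Group actions\<close>

text \<open>Bijectivity follows from the multiplicative law, since \<open>inv g\<close> acts as a
  two-sided inverse of \<open>g\<close>.\<close>

lemma group_actionI:
  assumes G: "group G"
    and ext: "\<And>g. g \<in> carrier G \<Longrightarrow> \<phi> g \<in> extensional E"
    and closed: "\<And>g x. g \<in> carrier G \<Longrightarrow> x \<in> E \<Longrightarrow> \<phi> g x \<in> E"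
    and one: "\<And>x. x \<in> E \<Longrightarrow> \<phi> \<one>\<^bsub>G\<^esub> x = x"
    and mult: "\<And>g h x. g \<in> carrier G \<Longrightarrow> h \<in> carrier G \<Longrightarrow> x \<in> E \<Longrightarrow>
      \<phi> (g \<otimes>\<^bsub>G\<^esub> h) x = \<phi> g (\<phi> h x)"
  shows "group_action G E \<phi>"
proof -
  interpret group G by (rule G)
  have inv: "\<phi> (inv\<^bsub>G\<^esub> g) (\<phi> g x) = x" if "g \<in> carrier G" "x \<in> E" for g x
    using mult[of "inv\<^bsub>G\<^esub> g" g x] that one by simp
  have inv': "\<phi> g (\<phi> (inv\<^bsub>G\<^esub> g) x) = x" if "g \<in> carrier G" "x \<in> E" for g x
    using mult[of g "inv\<^bsub>G\<^esub> g" x] that one by simp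
  have bij: "\<phi> g \<in> Bij E" if g: "g \<in> carrier G" for g
  proof -
    have "bij_betw (\<phi> g) E E"
      using g closed inv inv' by (intro bij_betw_byWitness[of E "\<phi> (inv\<^bsub>G\<^esub> g)"]) auto
    then show ?thesis
      using ext[OF g] by (simp add: Bij_def)
  qed
  have "\<phi> (g \<otimes>\<^bsub>G\<^esub> h) = compose E (\<phi> g) (\<phi> h)" if gh: "g \<in> carrier G" "h \<in> carrier G" for g h
  proof (rule extensionalityI)
    show "\<phi> (g \<otimes>\<^bsub>G\<^esub> h) \<in> extensional E"
      using gh by (intro ext) simp
    show "\<phi> (g \<otimes>\<^bsub>G\<^esub> h) x = compose E (\<phi> g) (\<phi> h) x" if "x \<in> E" for x
      using mult[OF gh that] that by (simp add: compose_eq)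
  qed simp
  then have "\<phi> \<in> hom G (BijGroup E)"
    using bij by (auto simp: hom_def BijGroup_def)
  then show ?thesis
    by (simp add: group_action_def group_hom_def group_hom_axioms_def G group_BijGroup)
qed

lemma group_action_extensional:
  assumes "group_action G E \<phi>" "g \<in> carrier G"
  shows "\<phi> g \<in> extensional E"
  using group_action.bij_prop0[OF assms] by (simp add: Bij_def)

lemma group_action_closed:
  assumes "group_action G E \<phi>" "g \<in> carrier G" "x \<in> E"
  shows "\<phi> g x \<in> E"
  using group_action.element_image[OF assms refl] .

lemma group_action_one:
  assumes "group_action G E \<phi>" "x \<in> E"
  shows "\<phi> \<one>\<^bsub>G\<^esub> x = x"
  using group_action.id_eq_one[OF assms(1)] assms(2) by (metis restrict_apply')

lemma group_action_group: "group_action G E \<phi> \<Longrightarrow> group G"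
  by (simp add: group_action_def group_hom_def)

lemma group_action_subgroup_generated:
  assumes "group_action G E \<phi>"
  shows "group_action (subgroup_generated G B) E \<phi>"
proof -
  interpret group G using assms by (rule group_action_group)
  have "carrier (subgroup_generated G B) \<subseteq> carrier G"
    by (rule carrier_subgroup_generated_subset)
  then show ?thesis
    using assms
    by (intro group_actionI)
      (auto simp: group_action_extensional group_action_closed group_action_one
        intro: group_action.composition_rule)
qed

text \<open>For an inverse letter, the relation for the letter itself is applied at the preimage
  \<open>\<phi> (inv b) v\<close> and then solved.\<close>

lemma generate_intertwine:
  assumes \<phi>: "group_action G E \<phi>" "group_action G E' \<phi>'"
    and B: "B \<subseteq> carrier G"
    and f: "\<And>v. v \<in> E \<Longrightarrow> f v \<in> E'" "\<And>b v. b \<in> B \<Longrightarrow> v \<in> E \<Longrightarrow> f (\<phi> b v) = \<phi>' b (f v)"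
    and g: "g \<in> generate G B"
    and v: "v \<in> E"
  shows "f (\<phi> g v) = \<phi>' g (f v)"
  using g v
proof (induction arbitrary: v)
  case one
  then show ?case
    using f(1) by (simp add: group_action_one[OF \<phi>(1)] group_action_one[OF \<phi>(2)])
next
  case (incl b)
  then show ?case using f(2) by simp
next
  case (inv b)
  interpret group G using \<phi>(1) by (rule group_action_group)
  have b: "b \<in> carrier G" using inv B by blast
  define w where "w = \<phi> (inv\<^bsub>G\<^esub> b) v"
  have w: "w \<in> E"
    unfolding w_def using b inv by (intro group_action_closed[OF \<phi>(1)]) auto
  have "\<phi> b w = v"
    using group_action.orbit_sym_aux[OF \<phi>(1), of "inv\<^bsub>G\<^esub> b" v w] b inv(2) by (simp add: w_def)
  then have "f v = \<phi>' b (f w)"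
    using f(2)[OF inv(1) w] by simp
  then have "\<phi>' (inv\<^bsub>G\<^esub> b) (f v) = f w"
    using group_action.orbit_sym_aux[OF \<phi>(2) b f(1)[OF w]] by simp
  then show ?case by (simp add: w_def)
next
  case (eng g h)
  interpret group G using \<phi>(1) by (rule group_action_group)
  have gh: "g \<in> carrier G" "h \<in> carrier G"
    using generate_in_carrier[OF B] eng(1,2) by auto
  show ?case
    using eng(3,4,5) gh f(1)
    by (simp add: group_action.composition_rule[OF \<phi>(1)] group_action.composition_rule[OF \<phi>(2)]
        group_action_closed[OF \<phi>(1)])
qed

text \<open>The generators are involutions, so an inverse letter is the letter itself and invariance
  passes to inverses.\<close>

lemma generate_invariant:
  assumes \<phi>: "group_action G E \<phi>"
    and B: "B \<subseteq> carrier G" "\<And>b. b \<in> B \<Longrightarrow> b \<otimes>\<^bsub>G\<^esub> b = \<one>\<^bsub>G\<^esub>"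
    and U: "U \<subseteq> E" "\<And>b v. b \<in> B \<Longrightarrow> v \<in> U \<Longrightarrow> \<phi> b v \<in> U"
    and g: "g \<in> generate G B"
    and v: "v \<in> U"
  shows "\<phi> g v \<in> U"
  using g v
proof (induction arbitrary: v)
  case one
  then show ?case using U(1) group_action_one[OF \<phi>] by (metis subsetD)
next
  case (incl b)
  then show ?case using U(2) by simp
next
  case (inv b)
  interpret group G using \<phi> by (rule group_action_group)
  have "inv\<^bsub>G\<^esub> b = b"
    using B inv(1) by (intro inv_equality) auto
  then show ?case using U(2) inv by simp
next
  case (eng g h)
  interpret group G using \<phi> by (rule group_action_group)
  have gh: "g \<in> carrier G" "h \<in> carrier G"
    using generate_in_carrier[OF B(1)] eng(1,2) by auto
  have "v \<in> E" using U(1) eng by blast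
  then show ?case
    using eng gh by (simp add: group_action.composition_rule[OF \<phi>])
qed

text \<open>Pull-back of an action along an injection with invariant image. It serves both for
  restricting to a subspace and for replacing the carrier by a copy.\<close>

lemma group_action_transport:
  assumes \<phi>: "group_action G E \<phi>"
    and L: "inj_on L U" "L ` U \<subseteq> E"
    and invariant: "\<And>g u. g \<in> carrier G \<Longrightarrow> u \<in> U \<Longrightarrow> \<phi> g (L u) \<in> L ` U"
  obtains \<phi>' where "group_action G U \<phi>'"
    "\<And>g u. g \<in> carrier G \<Longrightarrow> u \<in> U \<Longrightarrow> L (\<phi>' g u) = \<phi> g (L u)"
proof -
  define \<phi>' where "\<phi>' = (\<lambda>g. \<lambda>u\<in>U. inv_into U L (\<phi> g (L u)))"
  have L\<phi>': "L (\<phi>' g u) = \<phi> g (L u)" if "g \<in> carrier G" "u \<in> U" for g u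
    using invariant[OF that] that by (simp add: \<phi>'_def f_inv_into_f)
  have closed: "\<phi>' g u \<in> U" if "g \<in> carrier G" "u \<in> U" for g u
    using invariant[OF that] that by (simp add: \<phi>'_def inv_into_into)
  interpret group G using \<phi> by (rule group_action_group)
  have "group_action G U \<phi>'"
  proof (rule group_actionI)
    show "\<phi>' \<one>\<^bsub>G\<^esub> u = u" if "u \<in> U" for u
    proof (rule inj_onD[OF L(1) _ closed[OF one_closed that] that])
      have "L u \<in> E" using L(2) that by blast
      then show "L (\<phi>' \<one>\<^bsub>G\<^esub> u) = L u"
        using L\<phi>'[OF one_closed that] group_action_one[OF \<phi>] by simp
    qed
    show "\<phi>' (g \<otimes>\<^bsub>G\<^esub> h) u = \<phi>' g (\<phi>' h u)"
      if gh: "g \<in> carrier G" "h \<in> carrier G" and u: "u \<in> U" for g h u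
    proof (rule inj_onD[OF L(1)])
      have "L u \<in> E" using L(2) u by blast
      then show "L (\<phi>' (g \<otimes>\<^bsub>G\<^esub> h) u) = L (\<phi>' g (\<phi>' h u))"
        using gh u closed by (simp add: L\<phi>' group_action.composition_rule[OF \<phi>])
    qed (use gh u closed in auto)
  qed (use closed in \<open>auto simp: \<phi>'_def\<close>)
  then show ?thesis
    using that L\<phi>' by blast
qed

section \<open>Actions of groups presented by involutions\<close>

text \<open>The sign of a letter is dropped: for involutions, a generator and its formal inverse act
  alike.\<close>

definition involution_act :: "('s \<Rightarrow> 'x \<Rightarrow> 'x) \<Rightarrow> 's word \<Rightarrow> 'x \<Rightarrow> 'x" where
  "involution_act f w = foldr (\<lambda>l. f (fst l)) w"

lemma involution_act_simps [simp]:
  "involution_act f [] c = c"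
  "involution_act f (l # w) c = f (fst l) (involution_act f w c)"
  "involution_act f (v @ w) c = involution_act f v (involution_act f w c)"
  by (simp_all add: involution_act_def)

text \<open>The universal property of a presentation: equivalent words act alike, by induction on
  the relation. The cancellation rule is respected because the maps are involutions.\<close>

lemma presented_group_acts:
  fixes f :: "'s \<Rightarrow> 'x \<Rightarrow> 'x"
  assumes closed: "\<And>s c. s \<in> S \<Longrightarrow> c \<in> C \<Longrightarrow> f s c \<in> C"
    and invol: "\<And>s c. s \<in> S \<Longrightarrow> c \<in> C \<Longrightarrow> f s (f s c) = c"
    and relators: "\<And>r c. r \<in> R \<Longrightarrow> r \<in> words S \<Longrightarrow> c \<in> C \<Longrightarrow> involution_act f r c = c"
  obtains \<phi> where "group_action (presented_group S R) C \<phi>"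
    "\<And>w c. w \<in> words S \<Longrightarrow> c \<in> C \<Longrightarrow> \<phi> (pres_rel S R `` {w}) c = involution_act f w c"
proof -
  let ?G = "presented_group S R"
  have act_closed: "involution_act f w c \<in> C" if "w \<in> words S" "c \<in> C" for w c
    using that by (induction w) (auto intro: closed)
  have act_rel: "\<forall>c\<in>C. involution_act f v c = involution_act f w c" if "(v, w) \<in> pres_rel S R" for v w
    using that
  proof (induction rule: pres_rel.induct)
    case (pres_cong v w x y)
    then show ?case by (simp add: act_closed)
  qed (auto simp: invol relators)
  \<comment> \<open>A class acts through an arbitrary representative; \<open>act_rel\<close> makes
    the value independent of it.\<close>
  define \<phi> where "\<phi> = (\<lambda>A. \<lambda>c\<in>C. involution_act f (SOME w. w \<in> A) c)"
  have \<phi>: "\<phi> (pres_rel S R `` {w}) c = involution_act f w c" if "w \<in> words S" "c \<in> C" for w c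
  proof -
    have "w \<in> pres_rel S R `` {w}"
      using pres_refl[OF that(1)] by simp
    then have "(SOME v. v \<in> pres_rel S R `` {w}) \<in> pres_rel S R `` {w}"
      by (rule someI)
    then show ?thesis
      using act_rel that by (auto simp: \<phi>_def)
  qed
  have carr: "\<exists>w\<in>words S. A = pres_rel S R `` {w}" if "A \<in> carrier ?G" for A
    using that by (auto simp: presented_group_def elim!: quotientE)
  have one: "\<one>\<^bsub>?G\<^esub> = pres_rel S R `` {[]}"
    by (simp add: presented_group_def)
  have "group_action ?G C \<phi>"
  proof (rule group_actionI)
    show "\<phi> g \<in> extensional C" for g
      by (simp add: \<phi>_def)
    show "\<phi> g c \<in> C" if "g \<in> carrier ?G" "c \<in> C" for g c
      using carr[OF that(1)] that(2) \<phi> act_closed by metis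
    show "\<phi> \<one>\<^bsub>?G\<^esub> c = c" if "c \<in> C" for c
      unfolding one using \<phi>[of "[]" c] that by simp
    show "\<phi> (g \<otimes>\<^bsub>?G\<^esub> h) c = \<phi> g (\<phi> h c)"
      if gh: "g \<in> carrier ?G" "h \<in> carrier ?G" and c: "c \<in> C" for g h c
    proof -
      obtain v w where vw: "v \<in> words S" "w \<in> words S"
        and g: "g = pres_rel S R `` {v}" and h: "h = pres_rel S R `` {w}"
        using carr gh by metis
      have "v @ w \<in> words S" using vw by simp
      then show ?thesis
        unfolding g h pres_mult[OF vw] using vw c by (simp add: \<phi> act_closed)
    qed
  qed (rule group_presented_group)
  then show ?thesis
    using that \<phi> by blast
qed

section \<open>Generators of Coxeter groups\<close>

lemma group_coxeter_group: "group (coxeter_group S m)"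
  unfolding coxeter_group_def by (rule group_presented_group)

lemma cox_gen_closed: "s \<in> S \<Longrightarrow> cox_gen S m s \<in> carrier (coxeter_group S m)"
  by (auto simp: coxeter_group_def presented_group_def cox_gen_def intro!: quotientI)

lemma coxeter_relator_class:
  assumes "w \<in> coxeter_relators S m" "w \<in> words S"
  shows "pres_rel S (coxeter_relators S m) `` {w} = \<one>\<^bsub>coxeter_group S m\<^esub>"
  using equiv_class_eq[OF equiv_pres_rel pres_relator[OF assms]]
  by (simp add: coxeter_group_def presented_group_def)

lemma cox_gen_square:
  assumes "s \<in> S"
  shows "cox_gen S m s \<otimes>\<^bsub>coxeter_group S m\<^esub> cox_gen S m s = \<one>\<^bsub>coxeter_group S m\<^esub>"
proof -
  have "[(s, True)] \<in> words S" using assms by simp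
  note pres_mult[OF this this, of "coxeter_relators S m"]
  moreover have "[(s, True), (s, True)] \<in> coxeter_relators S m"
    using assms by (auto simp: coxeter_relators_def)
  ultimately show ?thesis
    using assms coxeter_relator_class[of "[(s, True), (s, True)]" S m]
    by (simp add: cox_gen_def coxeter_group_def)
qed

text \<open>The formal inverse represents the group inverse by the cancellation rule, and the
  relator of length two identifies that inverse with the generator.\<close>

lemma cox_gen_inverse_letter:
  assumes "s \<in> S"
  shows "pres_rel S (coxeter_relators S m) `` {[(s, b)]} = cox_gen S m s"
proof (cases b)
  case False
  have w: "[(s, True)] \<in> words S" "[(s, False)] \<in> words S" using assms by simp_all
  interpret group "coxeter_group S m" by (rule group_coxeter_group)
  have "pres_rel S (coxeter_relators S m) `` {[(s, False)]} \<otimes>\<^bsub>coxeter_group S m\<^esub> cox_gen S m s =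
      pres_rel S (coxeter_relators S m) `` {[(s, False), (s, True)]}"
    using pres_mult[OF w(2,1), of "coxeter_relators S m"] by (simp add: cox_gen_def coxeter_group_def)
  also have "\<dots> = \<one>\<^bsub>coxeter_group S m\<^esub>"
    using equiv_class_eq[OF equiv_pres_rel pres_cancel[OF assms, of False]]
    by (simp add: coxeter_group_def presented_group_def)
  finally have "pres_rel S (coxeter_relators S m) `` {[(s, False)]} = inv\<^bsub>coxeter_group S m\<^esub> cox_gen S m s"
    using w(2) assms
    by (intro inv_equality[symmetric] cox_gen_closed)
      (auto simp: coxeter_group_def presented_group_def intro!: quotientI)
  also have "\<dots> = cox_gen S m s"
    using assms by (intro inv_equality cox_gen_square cox_gen_closed)
  finally show ?thesis using False by simp
qed (simp add: cox_gen_def)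

lemma generate_cox_gen: "generate (coxeter_group S m) (cox_gen S m ` S) = carrier (coxeter_group S m)"
proof -
  interpret group "coxeter_group S m" by (rule group_coxeter_group)
  have "pres_rel S (coxeter_relators S m) `` {w} \<in> generate (coxeter_group S m) (cox_gen S m ` S)"
    if "w \<in> words S" for w
    using that
  proof (induction w)
    case Nil
    have "pres_rel S (coxeter_relators S m) `` {[]} = \<one>\<^bsub>coxeter_group S m\<^esub>"
      by (simp add: coxeter_group_def presented_group_def)
    then show ?case by (simp add: generate.one)
  next
    case (Cons l w)
    obtain s b where l: "l = (s, b)" "s \<in> S" using Cons by (cases l) auto
    have ww: "[l] \<in> words S" "w \<in> words S" using l Cons.hyps by auto
    have "pres_rel S (coxeter_relators S m) `` {l # w} =
        cox_gen S m s \<otimes>\<^bsub>coxeter_group S m\<^esub> pres_rel S (coxeter_relators S m) `` {w}"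
      using pres_mult[OF ww, of "coxeter_relators S m"] cox_gen_inverse_letter[OF l(2), of m b]
      by (simp add: l coxeter_group_def)
    moreover have "cox_gen S m s \<in> generate (coxeter_group S m) (cox_gen S m ` S)"
      using l by (intro generate.incl imageI)
    ultimately show ?case
      using Cons.IH by (simp add: generate.eng)
  qed
  then have "carrier (coxeter_group S m) \<subseteq> generate (coxeter_group S m) (cox_gen S m ` S)"
    by (auto simp: coxeter_group_def presented_group_def elim!: quotientE)
  moreover have "generate (coxeter_group S m) (cox_gen S m ` S) \<subseteq> carrier (coxeter_group S m)"
    by (rule generate_incl) (auto simp: cox_gen_closed)
  ultimately show ?thesis by (rule equalityI[rotated])
qed

lemma carrier_dihedral_subgroup:
  assumes "r \<in> S" "t \<in> S"
  shows "carrier (dihedral_subgroup S m r t) = generate (coxeter_group S m) {cox_gen S m r, cox_gen S m t}"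
proof -
  have "{cox_gen S m r, cox_gen S m t} \<subseteq> carrier (coxeter_group S m)"
    using assms by (simp add: cox_gen_closed)
  then show ?thesis
    unfolding dihedral_subgroup_def carrier_subgroup_generated by (simp only: Int_absorb1)
qed

lemma dihedral_subgroup_commute: "dihedral_subgroup S m r t = dihedral_subgroup S m t r"
  by (simp add: dihedral_subgroup_def insert_commute)

text \<open>The relator word acts as an iterate of the product of two reflections, which is the form
  in which \<open>rotation\<close> is iterated.\<close>

lemma cox_gen_pair_relation:
  assumes "s \<in> S" "t \<in> S" "s \<noteq> t" "m s t = enat n"
    and \<phi>: "group_action (coxeter_group S m) E \<phi>" and v: "v \<in> E"
  shows "((\<lambda>v. \<phi> (cox_gen S m s) (\<phi> (cox_gen S m t) v)) ^^ n) v = v"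
proof -
  let ?W = "coxeter_group S m"
  let ?R = "coxeter_relators S m"
  let ?w = "\<lambda>j. concat (replicate j [(s, True), (t, True)])"
  interpret group ?W by (rule group_coxeter_group)
  have words: "?w j \<in> words S" for j
    using assms(1,2) by (induction j) auto
  have cl: "pres_rel S ?R `` {?w j} \<in> carrier ?W" for j
    using words by (auto simp: coxeter_group_def presented_group_def intro!: quotientI)
  have iter: "\<phi> (pres_rel S ?R `` {?w j}) v =
      ((\<lambda>v. \<phi> (cox_gen S m s) (\<phi> (cox_gen S m t) v)) ^^ j) v" for j
  proof (induction j)
    case 0
    have "pres_rel S ?R `` {[]} = \<one>\<^bsub>?W\<^esub>"
      by (simp add: coxeter_group_def presented_group_def)
    then show ?case using group_action_one[OF \<phi> v] by simp
  next
    case (Suc j)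
    have st: "[(s, True)] \<in> words S" "[(t, True)] \<in> words S" using assms by simp_all
    have tw: "[(t, True)] @ ?w j \<in> words S" using st words by simp
    have "pres_rel S ?R `` {?w (Suc j)} =
        cox_gen S m s \<otimes>\<^bsub>?W\<^esub> (cox_gen S m t \<otimes>\<^bsub>?W\<^esub> pres_rel S ?R `` {?w j})"
      using pres_mult[OF st(1) tw, of ?R] pres_mult[OF st(2) words, of ?R j]
      by (simp add: cox_gen_def coxeter_group_def)
    then show ?case
      using cl[of j] v assms(1,2) unfolding funpow.simps comp_def Suc[symmetric]
      by (simp add: group_action.composition_rule[OF \<phi>] group_action_closed[OF \<phi>] cox_gen_closed
          del: replicate.simps concat.simps)
  qed
  have "?w n \<in> ?R"
    using assms by (auto simp: coxeter_relators_def)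
  then have "pres_rel S ?R `` {?w n} = \<one>\<^bsub>?W\<^esub>"
    by (rule coxeter_relator_class[OF _ words])
  then show ?thesis
    using group_action_one[OF \<phi> v] unfolding iter[symmetric] by (simp only:)
qed

section \<open>Complex vector spaces with an indexed basis\<close>

text \<open>The rules with prefix \<open>csmult\<close> restate the module laws with the scalar ring
  unfolded to complex arithmetic, ready for rewriting.\<close>

locale complex_vs = vectorspace cring_complex V for V :: "(complex, 'v) module" (structure)
begin

lemma csmult_closed [simp, intro]: "x \<in> carrier V \<Longrightarrow> (a :: complex) \<odot> x \<in> carrier V"
  by (rule smult_closed) simp_all

lemma csmult_add_left: "x \<in> carrier V \<Longrightarrow> (a + b) \<odot> x = a \<odot> x \<oplus> b \<odot> x"
  using smult_l_distr[of a b x] by simp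

lemma csmult_add_right: "x \<in> carrier V \<Longrightarrow> y \<in> carrier V \<Longrightarrow> a \<odot> (x \<oplus> y) = a \<odot> x \<oplus> a \<odot> y"
  using smult_r_distr[of a x y] by simp

lemma csmult_csmult: "x \<in> carrier V \<Longrightarrow> a \<odot> (b \<odot> x) = (a * b) \<odot> x"
  using smult_assoc1[of a b x] by simp

lemma csmult_one: "x \<in> carrier V \<Longrightarrow> 1 \<odot> x = x"
  using smult_one[of x] by simp

lemma csmult_zero_left: "x \<in> carrier V \<Longrightarrow> 0 \<odot> x = \<zero>"
  using lmult_0[of x] by simp

lemma csmult_zero_right: "(a :: complex) \<odot> \<zero> = \<zero>"
  using rmult_0[of a] by simp

lemma csmult_minus_one: "x \<in> carrier V \<Longrightarrow> \<ominus> x = (-1) \<odot> x"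
proof -
  assume x: "x \<in> carrier V"
  have "(-1) \<odot> x \<oplus> x = (-1 + 1) \<odot> x"
    using x by (subst csmult_add_left) (simp_all add: csmult_one)
  then show ?thesis
    using x by (intro M.minus_equality) (simp_all add: csmult_zero_left)
qed

lemma csmult_eq_zero:
  assumes "a \<odot> x = \<zero>" "x \<in> carrier V" "x \<noteq> \<zero>"
  shows "a = 0"
proof (rule ccontr)
  assume "a \<noteq> 0"
  then have "x = inverse a \<odot> (a \<odot> x)"
    using assms(2) by (simp add: csmult_csmult csmult_one)
  then show False
    using assms by (simp add: csmult_zero_right)
qed

end

lemma complex_vs_iff: "complex_vs V \<longleftrightarrow> vectorspace \<complex>\<^sub>R V"
  by (simp add: complex_vs_def)

lemma module_hom_complex:
  "f \<in> module_hom \<complex>\<^sub>R V V' \<longleftrightarrow> (\<forall>v\<in>carrier V. f v \<in> carrier V') \<and>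
    (\<forall>v\<in>carrier V. \<forall>w\<in>carrier V. f (v \<oplus>\<^bsub>V\<^esub> w) = f v \<oplus>\<^bsub>V'\<^esub> f w) \<and>
    (\<forall>a. \<forall>v\<in>carrier V. f (a \<odot>\<^bsub>V\<^esub> v) = a \<odot>\<^bsub>V'\<^esub> f v)"
  by (auto simp: module_hom_def Pi_def)

lemma module_homI:
  assumes "\<And>v. v \<in> carrier V \<Longrightarrow> f v \<in> carrier V'"
    "\<And>v w. v \<in> carrier V \<Longrightarrow> w \<in> carrier V \<Longrightarrow> f (v \<oplus>\<^bsub>V\<^esub> w) = f v \<oplus>\<^bsub>V'\<^esub> f w"
    "\<And>a v. v \<in> carrier V \<Longrightarrow> f (a \<odot>\<^bsub>V\<^esub> v) = a \<odot>\<^bsub>V'\<^esub> f v"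
  shows "f \<in> module_hom \<complex>\<^sub>R V V'"
  using assms by (simp add: module_hom_complex)

lemma module_homD:
  assumes "f \<in> module_hom \<complex>\<^sub>R V V'" "v \<in> carrier V"
  shows "f v \<in> carrier V'" "w \<in> carrier V \<Longrightarrow> f (v \<oplus>\<^bsub>V\<^esub> w) = f v \<oplus>\<^bsub>V'\<^esub> f w"
    "f (a \<odot>\<^bsub>V\<^esub> v) = a \<odot>\<^bsub>V'\<^esub> f v"
  using assms by (simp_all add: module_hom_complex)

lemma module_hom_comp:
  assumes "f \<in> module_hom \<complex>\<^sub>R V V'" "g \<in> module_hom \<complex>\<^sub>R V' V''"
  shows "g \<circ> f \<in> module_hom \<complex>\<^sub>R V V''"
  using assms by (simp add: module_hom_complex)

lemma module_hom_inv_into: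
  assumes V: "complex_vs V"
    and f: "f \<in> module_hom \<complex>\<^sub>R V V'" "bij_betw f (carrier V) (carrier V')"
  shows "inv_into (carrier V) f \<in> module_hom \<complex>\<^sub>R V' V"
proof -
  interpret complex_vs V by (rule V)
  let ?g = "inv_into (carrier V) f"
  have g: "?g w \<in> carrier V" "f (?g w) = w" if "w \<in> carrier V'" for w
    using that f(2) by (auto simp: bij_betw_def f_inv_into_f intro: inv_into_into)
  have eq: "?g w = v" if "v \<in> carrier V" "f v = w" for v w
    using that f(2) by (auto simp: bij_betw_def)
  show ?thesis
  proof (rule module_homI)
    show "?g w \<in> carrier V" if "w \<in> carrier V'" for w
      by (rule g(1)[OF that])
    show "?g (w \<oplus>\<^bsub>V'\<^esub> w') = ?g w \<oplus>\<^bsub>V\<^esub> ?g w'" if "w \<in> carrier V'" "w' \<in> carrier V'" for w w'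
      using g[OF that(1)] g[OF that(2)] by (intro eq) (simp_all add: module_homD[OF f(1)])
    show "?g (a \<odot>\<^bsub>V'\<^esub> w) = a \<odot>\<^bsub>V\<^esub> ?g w" if "w \<in> carrier V'" for a w
      using g[OF that(1)] by (intro eq) (simp_all add: module_homD[OF f(1)])
  qed
qed

lemma func_space_sel:
  "carrier (ring.func_space \<complex>\<^sub>R S) = S \<rightarrow>\<^sub>E (UNIV :: complex set)"
  "f \<oplus>\<^bsub>ring.func_space \<complex>\<^sub>R S\<^esub> g = (\<lambda>v\<in>S. f v + g v)"
  "a \<odot>\<^bsub>ring.func_space \<complex>\<^sub>R S\<^esub> f = (\<lambda>v\<in>S. a * f v)"
  "\<zero>\<^bsub>ring.func_space \<complex>\<^sub>R S\<^esub> = (\<lambda>v\<in>S. 0)"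
  by (simp_all add: ring.func_space_def[OF class_ring.ring_axioms])

lemma complex_vs_func_space: "complex_vs (ring.func_space \<complex>\<^sub>R S :: (complex, 's \<Rightarrow> complex) module)"
proof -
  have "module \<complex>\<^sub>R (ring.func_space \<complex>\<^sub>R S :: (complex, 's \<Rightarrow> complex) module)"
    by (rule cring.func_space_is_module) (rule class_cring.cring_axioms)
  then show ?thesis
    using class_field by (simp add: complex_vs_def vectorspace_def)
qed

text \<open>\<open>basis\<close> is a property of a set of vectors. Injectivity preserves the
  indexing, so that coordinates become functions on \<open>S\<close>.\<close>

definition basis_family :: "'s set \<Rightarrow> (complex, 'v) module \<Rightarrow> ('s \<Rightarrow> 'v) \<Rightarrow> bool" where
  "basis_family S V \<alpha> \<longleftrightarrow>
    complex_vs V \<and> finite S \<and> inj_on \<alpha> S \<and> vectorspace.basis \<complex>\<^sub>R V (\<alpha> ` S)"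

lemma basis_familyD:
  assumes "basis_family S V \<alpha>"
  shows "complex_vs V" "finite S" "inj_on \<alpha> S" "vectorspace.basis \<complex>\<^sub>R V (\<alpha> ` S)"
    "\<alpha> ` S \<subseteq> carrier V" "s \<in> S \<Longrightarrow> \<alpha> s \<in> carrier V"
proof -
  show V: "complex_vs V" "finite S" "inj_on \<alpha> S" and b: "vectorspace.basis \<complex>\<^sub>R V (\<alpha> ` S)"
    using assms by (auto simp: basis_family_def)
  interpret complex_vs V by (rule V)
  show "\<alpha> ` S \<subseteq> carrier V"
    using b by (simp add: basis_def)
  then show "s \<in> S \<Longrightarrow> \<alpha> s \<in> carrier V" by blast
qed

text \<open>Coefficients are indexed by \<open>S\<close> and not, as in \<open>lincomb\<close>, by
  the vectors themselves; coordinates in different bases can then be compared directly.\<close>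

definition comb :: "(complex, 'v) module \<Rightarrow> ('s \<Rightarrow> 'v) \<Rightarrow> 's set \<Rightarrow> ('s \<Rightarrow> complex) \<Rightarrow> 'v" where
  "comb V \<alpha> S c = (\<Oplus>\<^bsub>V\<^esub>s\<in>S. c s \<odot>\<^bsub>V\<^esub> \<alpha> s)"

text \<open>Turns the criterion of unique coordinates for a basis into a bijection, which composes
  well with linear isomorphisms.\<close>

lemma bij_betw_iff_ex1:
  assumes "\<And>c. c \<in> A \<Longrightarrow> g c \<in> B"
  shows "bij_betw g A B \<longleftrightarrow> (\<forall>v\<in>B. \<exists>!c. c \<in> A \<and> g c = v)"
proof
  assume "bij_betw g A B"
  then show "\<forall>v\<in>B. \<exists>!c. c \<in> A \<and> g c = v"
    by (auto simp: bij_betw_def inj_on_def)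
next
  assume *: "\<forall>v\<in>B. \<exists>!c. c \<in> A \<and> g c = v"
  have "inj_on g A"
  proof (rule inj_onI)
    fix c d assume "c \<in> A" "d \<in> A" "g c = g d"
    moreover have "g d \<in> B" using assms \<open>d \<in> A\<close> .
    ultimately show "c = d" using * by blast
  qed
  moreover have "g ` A = B"
    using * assms by (auto simp: image_iff)
  ultimately show "bij_betw g A B"
    by (simp add: bij_betw_def)
qed

context complex_vs
begin

lemma comb_closed: "\<alpha> ` S \<subseteq> carrier V \<Longrightarrow> comb V \<alpha> S c \<in> carrier V"
  unfolding comb_def by (intro M.finsum_closed) auto

lemma comb_cong:
  assumes "\<alpha> ` S \<subseteq> carrier V" "\<And>s. s \<in> S \<Longrightarrow> c s = d s"
  shows "comb V \<alpha> S c = comb V \<alpha> S d"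
  unfolding comb_def using assms by (intro M.finsum_cong') auto

lemma comb_add:
  assumes "\<alpha> ` S \<subseteq> carrier V"
  shows "comb V \<alpha> S (\<lambda>s. c s + d s) = comb V \<alpha> S c \<oplus> comb V \<alpha> S d"
proof -
  have "comb V \<alpha> S (\<lambda>s. c s + d s) = (\<Oplus>s\<in>S. c s \<odot> \<alpha> s \<oplus> d s \<odot> \<alpha> s)"
    unfolding comb_def using assms by (intro M.finsum_cong') (auto simp: csmult_add_left)
  also have "\<dots> = comb V \<alpha> S c \<oplus> comb V \<alpha> S d"
    unfolding comb_def using assms by (intro M.finsum_addf) auto
  finally show ?thesis .
qed

lemma comb_insert:
  assumes "finite S" "s \<notin> S" "\<alpha> ` insert s S \<subseteq> carrier V"
  shows "comb V \<alpha> (insert s S) c = c s \<odot> \<alpha> s \<oplus> comb V \<alpha> S c"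
  unfolding comb_def using assms by (intro M.finsum_insert) auto

lemma comb_empty: "comb V \<alpha> {} c = \<zero>"
  by (simp add: comb_def)

lemma comb_smult:
  assumes "finite S" "\<alpha> ` S \<subseteq> carrier V"
  shows "comb V \<alpha> S (\<lambda>s. a * c s) = a \<odot> comb V \<alpha> S c"
  using assms
proof (induction S)
  case empty
  then show ?case by (simp add: comb_empty csmult_zero_right)
next
  case (insert s S)
  then have "\<alpha> ` S \<subseteq> carrier V" "\<alpha> s \<in> carrier V" by auto
  then show ?case
    using insert by (simp add: comb_insert csmult_add_right csmult_csmult comb_closed)
qed

lemma comb_unit:
  assumes "finite S" "\<alpha> ` S \<subseteq> carrier V" "s \<in> S"
  shows "comb V \<alpha> S (\<lambda>t. if t = s then a else 0) = a \<odot> \<alpha> s"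
proof -
  have S: "insert s (S - {s}) = S" using assms by blast
  have sub: "\<alpha> ` (S - {s}) \<subseteq> carrier V" "\<alpha> s \<in> carrier V" using assms by auto
  have "comb V \<alpha> (S - {s}) (\<lambda>t. if t = s then a else 0) = comb V \<alpha> (S - {s}) (\<lambda>t. 0 * 0)"
    using sub by (intro comb_cong) auto
  also have "\<dots> = 0 \<odot> comb V \<alpha> (S - {s}) (\<lambda>t. 0)"
    using assms sub by (intro comb_smult) auto
  also have "\<dots> = \<zero>"
    using sub by (intro csmult_zero_left comb_closed)
  finally have "comb V \<alpha> (insert s (S - {s})) (\<lambda>t. if t = s then a else 0) = a \<odot> \<alpha> s"
    using assms sub by (subst comb_insert) auto
  then show ?thesis
    unfolding S .
qed

lemma lincomb_image:
  assumes "inj_on \<alpha> S" "\<alpha> ` S \<subseteq> carrier V"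
  shows "lincomb a (\<alpha> ` S) = comb V \<alpha> S (\<lambda>s. a (\<alpha> s))"
  unfolding lincomb_def comb_def using assms by (intro M.finsum_reindex) auto

lemma comb_module_hom:
  assumes "finite S" "\<alpha> ` S \<subseteq> carrier V"
  shows "comb V \<alpha> S \<in> module_hom \<complex>\<^sub>R (ring.func_space \<complex>\<^sub>R S) V"
proof (rule module_homI)
  show "comb V \<alpha> S c \<in> carrier V" for c
    using assms by (intro comb_closed)
  show "comb V \<alpha> S (c \<oplus>\<^bsub>ring.func_space \<complex>\<^sub>R S\<^esub> d) = comb V \<alpha> S c \<oplus> comb V \<alpha> S d" for c d
    unfolding func_space_sel comb_add[OF assms(2), symmetric] using assms(2) by (rule comb_cong) simp
  show "comb V \<alpha> S (a \<odot>\<^bsub>ring.func_space \<complex>\<^sub>R S\<^esub> c) = a \<odot> comb V \<alpha> S c" for a c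
    unfolding func_space_sel comb_smult[OF assms, symmetric] using assms(2) by (rule comb_cong) simp
qed

text \<open>The criterion of unique coordinates speaks of coefficient functions on the set of
  vectors; reindexing along \<alpha> is a bijection from these to the functions on
  \<open>S\<close>.\<close>

lemma basis_iff_comb_bij:
  assumes "finite S" "inj_on \<alpha> S" "\<alpha> ` S \<subseteq> carrier V"
  shows "basis (\<alpha> ` S) \<longleftrightarrow> bij_betw (comb V \<alpha> S) (S \<rightarrow>\<^sub>E UNIV) (carrier V)"
proof -
  let ?A = "\<alpha> ` S"
  have lc: "lincomb a ?A = comb V \<alpha> S (\<lambda>s\<in>S. a (\<alpha> s))" for a
    unfolding lincomb_image[OF assms(2,3)] using assms(3) by (rule comb_cong) simp
  let ?f = "\<lambda>a. \<lambda>s\<in>S. a (\<alpha> s) :: complex"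
  let ?g = "\<lambda>c. \<lambda>x\<in>?A. c (inv_into S \<alpha> x) :: complex"
  have f: "bij_betw ?f (?A \<rightarrow>\<^sub>E UNIV) (S \<rightarrow>\<^sub>E UNIV)"
  proof (rule bij_betw_byWitness[of _ ?g])
    show "\<forall>a\<in>?A \<rightarrow>\<^sub>E UNIV. ?g (?f a) = a"
      using assms(2) by (intro ballI extensionalityI[of _ ?A]) (auto simp: PiE_def)
    show "\<forall>c\<in>S \<rightarrow>\<^sub>E UNIV. ?f (?g c) = c"
      using assms(2) by (intro ballI extensionalityI[of _ S]) (auto simp: PiE_def)
  qed auto
  have "basis ?A \<longleftrightarrow> (\<forall>v\<in>carrier V. \<exists>!a. a \<in> ?A \<rightarrow>\<^sub>E UNIV \<and> lincomb a ?A = v)"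
    using basis_criterion[of ?A] assms by (simp add: Ball_def)
  also have "\<dots> \<longleftrightarrow> bij_betw (\<lambda>a. lincomb a ?A) (?A \<rightarrow>\<^sub>E UNIV) (carrier V)"
    by (rule bij_betw_iff_ex1[symmetric]) (use assms in auto)
  also have "(\<lambda>a. lincomb a ?A) = comb V \<alpha> S \<circ> ?f"
    using lc by (simp add: fun_eq_iff)
  also have "bij_betw (comb V \<alpha> S \<circ> ?f) (?A \<rightarrow>\<^sub>E UNIV) (carrier V) \<longleftrightarrow>
      bij_betw (comb V \<alpha> S) (S \<rightarrow>\<^sub>E UNIV) (carrier V)"
    using bij_betw_comp_iff[OF f] by (rule sym)
  finally show ?thesis .
qed

end

lemma comb_bij_betw:
  assumes "basis_family S V \<alpha>"
  shows "bij_betw (comb V \<alpha> S) (S \<rightarrow>\<^sub>E UNIV) (carrier V)"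
  using assms basis_familyD[OF assms] complex_vs.basis_iff_comb_bij by metis

lemma comb_hom:
  fixes V (structure)
  assumes V: "complex_vs V" "complex_vs V'" and f: "f \<in> module_hom \<complex>\<^sub>R V V'"
    and S: "finite S" "\<alpha> ` S \<subseteq> carrier V"
  shows "f (comb V \<alpha> S c) = comb V' (f \<circ> \<alpha>) S c"
proof -
  interpret V: complex_vs V by (rule V)
  interpret V': complex_vs V' by (rule V)
  show ?thesis
    using S
  proof (induction S)
    case empty
    have "f \<zero> = f (0 \<odot> \<zero>)"
      by (simp only: V.csmult_zero_right)
    also have "\<dots> = 0 \<odot>\<^bsub>V'\<^esub> f \<zero>"
      by (rule module_homD(3)[OF f V.M.zero_closed])
    also have "\<dots> = \<zero>\<^bsub>V'\<^esub>"
      by (rule V'.csmult_zero_left[OF module_homD(1)[OF f V.M.zero_closed]])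
    finally show ?case by (simp add: V.comb_empty V'.comb_empty)
  next
    case (insert s S)
    then have sub: "\<alpha> ` S \<subseteq> carrier V" "\<alpha> s \<in> carrier V" "\<alpha> ` insert s S \<subseteq> carrier V" by auto
    then have sub': "(f \<circ> \<alpha>) ` insert s S \<subseteq> carrier V'" using module_homD(1)[OF f] by auto
    show ?case
      unfolding V.comb_insert[OF insert(1,2) sub(3)] V'.comb_insert[OF insert(1,2) sub']
      using insert(3)[OF sub(1)] sub
      by (simp add: module_homD[OF f] V.comb_closed comp_def)
  qed
qed

lemma basis_family_hom_eqI:
  assumes \<alpha>: "basis_family S V \<alpha>" and V': "complex_vs V'"
    and f: "f \<in> module_hom \<complex>\<^sub>R V V'" "g \<in> module_hom \<complex>\<^sub>R V V'"
    and eq: "\<And>s. s \<in> S \<Longrightarrow> f (\<alpha> s) = g (\<alpha> s)" and v: "v \<in> carrier V"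
  shows "f v = g v"
proof -
  note D = basis_familyD[OF \<alpha>]
  obtain c where v: "v = comb V \<alpha> S c"
    using comb_bij_betw[OF \<alpha>] v by (auto simp: bij_betw_def)
  have "comb V' (f \<circ> \<alpha>) S c = comb V' (g \<circ> \<alpha>) S c"
    unfolding comb_def using eq D(6) module_homD(1)[OF f(1)] module_homD(1)[OF f(2)] V'
    by (intro abelian_monoid.finsum_cong')
      (auto simp: complex_vs_def vectorspace_def module_def abelian_group_def intro!: complex_vs.csmult_closed)
  then show ?thesis
    unfolding v comb_hom[OF D(1) V' f(1) D(2,5)] comb_hom[OF D(1) V' f(2) D(2,5)] .
qed

lemma basis_family_image:
  assumes \<alpha>: "basis_family S V \<alpha>" and V': "complex_vs V'"
    and f: "f \<in> module_hom \<complex>\<^sub>R V V'" "bij_betw f (carrier V) (carrier V')"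
  shows "basis_family S V' (f \<circ> \<alpha>)"
proof -
  note D = basis_familyD[OF \<alpha>]
  interpret V': complex_vs V' by (rule V')
  have inj: "inj_on (f \<circ> \<alpha>) S"
    using D f(2) by (intro comp_inj_on) (auto simp: bij_betw_def intro: inj_on_subset)
  have sub: "(f \<circ> \<alpha>) ` S \<subseteq> carrier V'"
    using D(6) module_homD(1)[OF f(1)] by auto
  have "bij_betw (f \<circ> comb V \<alpha> S) (S \<rightarrow>\<^sub>E UNIV) (carrier V')"
    using comb_bij_betw[OF \<alpha>] f(2) by (rule bij_betw_trans)
  moreover have "f \<circ> comb V \<alpha> S = comb V' (f \<circ> \<alpha>) S"
    using comb_hom[OF D(1) V' f(1) D(2,5)] by auto
  ultimately have "V'.basis ((f \<circ> \<alpha>) ` S)"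
    using V'.basis_iff_comb_bij[OF D(2) inj sub] by simp
  then show ?thesis
    using V' D(2) inj by (simp add: basis_family_def)
qed

definition func_unit :: "'s set \<Rightarrow> 's \<Rightarrow> 's \<Rightarrow> complex" where
  "func_unit S s = (\<lambda>x\<in>S. if x = s then 1 else 0)"

lemma pair_basis_eq_func_unit: "pair_basis r t s = func_unit {r, t} s"
  by (simp add: pair_basis_def func_unit_def)

lemma comb_func_unit:
  fixes S :: "'s set"
  assumes "finite S" "c \<in> S \<rightarrow>\<^sub>E (UNIV :: complex set)"
  shows "comb (ring.func_space \<complex>\<^sub>R S) (func_unit S) S c = c"
proof -
  let ?F = "ring.func_space \<complex>\<^sub>R S :: (complex, 's \<Rightarrow> complex) module"
  interpret F: complex_vs ?F by (rule complex_vs_func_space)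
  have unit: "func_unit S s \<in> carrier ?F" for s
    by (simp add: func_unit_def func_space_sel)
  \<comment> \<open>Generalised to subsets \<open>T\<close> for the induction: the partial sums are
    the truncations of \<open>c\<close>.\<close>
  have "comb ?F (func_unit S) T c = (\<lambda>x\<in>S. if x \<in> T then c x else 0)" if "finite T" "T \<subseteq> S" for T
    using that
  proof (induction T)
    case empty
    then show ?case by (simp add: F.comb_empty func_space_sel)
  next
    case (insert s T)
    then have IH: "comb ?F (func_unit S) T c = (\<lambda>x\<in>S. if x \<in> T then c x else 0)" and s: "s \<in> S"
      by auto
    have ins: "comb ?F (func_unit S) (insert s T) c = c s \<odot>\<^bsub>?F\<^esub> func_unit S s \<oplus>\<^bsub>?F\<^esub> comb ?F (func_unit S) T c"
      using insert(1,2) unit by (intro F.comb_insert) auto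
    show ?case
      unfolding ins IH unfolding func_space_sel func_unit_def using insert(2) s by (auto simp: fun_eq_iff)
  qed
  from this[OF assms(1) subset_refl] show ?thesis
    using assms(2) by (auto simp: fun_eq_iff PiE_def extensional_def)
qed

lemma basis_family_func_space:
  fixes S :: "'s set"
  assumes "finite S"
  shows "basis_family S (ring.func_space \<complex>\<^sub>R S) (func_unit S)"
proof -
  let ?F = "ring.func_space \<complex>\<^sub>R S :: (complex, 's \<Rightarrow> complex) module"
  interpret F: complex_vs ?F by (rule complex_vs_func_space)
  have sub: "func_unit S ` S \<subseteq> carrier ?F"
    by (auto simp: func_unit_def func_space_sel)
  have inj: "inj_on (func_unit S) S"
  proof (rule inj_onI)
    fix s t assume "s \<in> S" "t \<in> S" "func_unit S s = func_unit S t"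
    then have "func_unit S s s = func_unit S t s" by simp
    then show "s = t" using \<open>s \<in> S\<close> by (simp add: func_unit_def split: if_splits)
  qed
  have "bij_betw (comb ?F (func_unit S) S) (S \<rightarrow>\<^sub>E UNIV) (S \<rightarrow>\<^sub>E UNIV)"
    using comb_func_unit[OF assms] by (intro bij_betw_byWitness[of _ "\<lambda>c. c"]) auto
  then have "F.basis (func_unit S ` S)"
    unfolding F.basis_iff_comb_bij[OF assms inj sub] by (simp add: func_space_sel)
  then show ?thesis
    using assms inj F.complex_vs_axioms by (simp add: basis_family_def)
qed

text \<open>Coordinates are read off in the first basis and reassembled in the second.\<close>

lemma basis_family_iso:
  fixes S :: "'s set"
  assumes \<alpha>: "basis_family S V \<alpha>" and \<alpha>': "basis_family S V' \<alpha>'"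
  obtains f where "f \<in> module_hom \<complex>\<^sub>R V V'" "bij_betw f (carrier V) (carrier V')"
    "\<And>s. s \<in> S \<Longrightarrow> f (\<alpha> s) = \<alpha>' s"
proof -
  note D = basis_familyD[OF \<alpha>] and D' = basis_familyD[OF \<alpha>']
  let ?F = "ring.func_space \<complex>\<^sub>R S :: (complex, 's \<Rightarrow> complex) module"
  have hom: "comb V \<alpha> S \<in> module_hom \<complex>\<^sub>R ?F V" "comb V' \<alpha>' S \<in> module_hom \<complex>\<^sub>R ?F V'"
    using complex_vs.comb_module_hom D D' by blast+
  have bij: "bij_betw (comb V \<alpha> S) (carrier ?F) (carrier V)" "bij_betw (comb V' \<alpha>' S) (carrier ?F) (carrier V')"
    using comb_bij_betw[OF \<alpha>] comb_bij_betw[OF \<alpha>'] by (simp_all add: func_space_sel)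
  let ?g = "inv_into (carrier ?F) (comb V \<alpha> S)"
  let ?f = "comb V' \<alpha>' S \<circ> ?g"
  have "?f \<in> module_hom \<complex>\<^sub>R V V'"
    using module_hom_inv_into[OF complex_vs_func_space hom(1) bij(1)] hom(2) by (rule module_hom_comp)
  moreover have "bij_betw ?f (carrier V) (carrier V')"
    using bij_betw_inv_into[OF bij(1)] bij(2) by (rule bij_betw_trans)
  moreover have "?f (\<alpha> s) = \<alpha>' s" if s: "s \<in> S" for s
  proof -
    let ?e = "\<lambda>t\<in>S. if t = s then 1 else (0 :: complex)"
    have e: "?e \<in> carrier ?F" by (simp add: func_space_sel)
    have unit: "comb X \<beta> S ?e = \<beta> s" if "complex_vs X" "\<beta> ` S \<subseteq> carrier X" for X and \<beta> :: "'s \<Rightarrow> 'x"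
    proof -
      interpret complex_vs X by (rule that)
      have "comb X \<beta> S ?e = comb X \<beta> S (\<lambda>t. if t = s then 1 else 0)"
        using that(2) by (rule comb_cong) simp
      also have "\<dots> = \<beta> s"
        using comb_unit[OF D(2) that(2) s, of 1] that(2) s by (simp add: csmult_one subset_iff)
      finally show ?thesis .
    qed
    have "?g (comb V \<alpha> S ?e) = ?e"
      using bij(1) e by (intro inv_into_f_f) (auto simp: bij_betw_def)
    then have "?g (\<alpha> s) = ?e"
      using unit[OF D(1,5)] by simp
    then show ?thesis
      using unit[OF D'(1,5)] by simp
  qed
  ultimately show ?thesis using that by blast
qed

lemma complex_vs_span:
  assumes "complex_vs V" "A \<subseteq> carrier V"
  shows "complex_vs (V\<lparr>carrier := module.span \<complex>\<^sub>R V A\<rparr>)"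
proof -
  interpret complex_vs V by (rule assms)
  show ?thesis
    using subspace_is_vs[OF span_is_subspace[OF assms(2)]] by (simp add: complex_vs_def)
qed

lemma basis_family_span:
  assumes \<alpha>: "basis_family S V \<alpha>" and T: "T \<subseteq> S"
  shows "basis_family T (V\<lparr>carrier := module.span \<complex>\<^sub>R V (\<alpha> ` T)\<rparr>) \<alpha>"
proof -
  note D = basis_familyD[OF \<alpha>]
  interpret complex_vs V by (rule D)
  have sub: "\<alpha> ` T \<subseteq> carrier V" using D(5) T by blast
  have sm: "submodule \<complex>\<^sub>R (span (\<alpha> ` T)) V" by (rule span_is_submodule[OF sub])
  have own: "\<alpha> ` T \<subseteq> span (\<alpha> ` T)" by (rule in_own_span[OF sub])
  interpret U: complex_vs "V\<lparr>carrier := span (\<alpha> ` T)\<rparr>"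
    by (rule complex_vs_span[OF D(1) sub])
  have "lin_indpt (\<alpha> ` S)"
    using D(4) unfolding basis_def by (elim conjE)
  then have "lin_indpt (\<alpha> ` T)"
    by (rule subset_li_is_li) (rule image_mono[OF T])
  then have "U.basis (\<alpha> ` T)"
    unfolding U.basis_def span_li_not_depend[OF own sm] using own by simp
  moreover have "finite T" "inj_on \<alpha> T"
    using D(2,3) T by (blast intro: finite_subset inj_on_subset)+
  ultimately show ?thesis
    unfolding basis_family_def using U.complex_vs_axioms by (intro conjI)
qed

section \<open>Reflections\<close>

context complex_vs
begin

lemma reflection_pair_step:
  assumes "a \<in> carrier V" "b \<in> carrier V"
  shows "p \<odot> (a \<oplus> (-2) \<odot> a) \<oplus> q \<odot> (b \<oplus> x \<odot> a) = (x * q - p) \<odot> a \<oplus> q \<odot> b"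
proof -
  have "x * q - p = p + (p * (-2) + q * x)" by simp
  then show ?thesis
    using assms
    by (simp only: csmult_add_left csmult_add_right csmult_csmult csmult_closed M.a_closed) (simp add: M.a_ac)
qed

text \<open>Independence and span of \<open>B\<close> are taken in \<open>V\<close> rather than in
  \<open>H\<close>, so that \<open>B\<close> can be completed to a basis of
  \<open>V\<close>.\<close>

lemma subspace_finite_basis:
  assumes fd: "fin_dim" and H: "VectorSpace.subspace \<complex>\<^sub>R H V"
  obtains B where "finite B" "B \<subseteq> H" "lin_indpt B" "span B = H"
    "vectorspace.dim \<complex>\<^sub>R (V\<lparr>carrier := H\<rparr>) = card B"
proof -
  interpret H: complex_vs "V\<lparr>carrier := H\<rparr>"
    using subspace_is_vs[OF H] by (simp add: complex_vs_def)
  have sm: "submodule \<complex>\<^sub>R H V" using H by simp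
  then have HV: "H \<subseteq> carrier V" by (simp add: submodule_def)
  let ?P = "\<lambda>A. A \<subseteq> H \<and> lin_indpt A"
  have "?P {}" by (simp add: lin_dep_def)
  moreover have "finite A \<and> card A \<le> dim" if "?P A" for A
    using li_le_dim[OF fd, of A] that HV by blast
  ultimately obtain B where B: "finite B" "maximal B ?P"
    using maximal_exists[of ?P dim "{}"] by blast
  have "?P = (\<lambda>A. A \<subseteq> carrier (V\<lparr>carrier := H\<rparr>) \<and> H.lin_indpt A)"
    using span_li_not_depend(2)[OF _ sm] by auto
  then have basis: "H.basis B"
    using B(2) H.max_li_is_basis by simp
  then have BH: "B \<subseteq> H" "lin_indpt B" "span B = H"
    using B(2) span_li_not_depend(1)[OF _ sm, of B] by (auto simp: H.basis_def maximal_def)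
  then show ?thesis
    using that B(1) H.dim_basis[OF B(1) basis] by blast
qed

text \<open>\<open>T\<close> fixes \<open>H\<close> and negates the nonzero vector
  \<open>\<alpha> s\<close>, which therefore lies outside \<open>H\<close>. Counting dimensions, a
  basis of \<open>H\<close> together with \<open>\<alpha> s\<close> is a basis of \<open>V\<close>;
  if \<open>v\<close> is \<open>h\<close> plus \<open>a\<close> times \<open>\<alpha> s\<close>,
  then \<open>T\<close> subtracts \<open>2 * a\<close> times \<open>\<alpha> s\<close> from
  it.\<close>

lemma reflection_columns:
  assumes \<alpha>: "basis_family S V \<alpha>" and s: "s \<in> S"
    and T: "T \<in> module_hom \<complex>\<^sub>R V V" "T (\<alpha> s) = \<ominus> \<alpha> s"
    and H: "VectorSpace.subspace \<complex>\<^sub>R H V" "vectorspace.dim \<complex>\<^sub>R (V\<lparr>carrier := H\<rparr>) + 1 = dim"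
      "\<And>v. v \<in> H \<Longrightarrow> T v = v"
    and v: "v \<in> carrier V"
  shows "\<exists>x. T v = v \<oplus> x \<odot> \<alpha> s"
proof -
  note D = basis_familyD[OF \<alpha>]
  have as: "\<alpha> s \<in> carrier V" using D(6) s .
  have fd: "fin_dim"
    using D(2,4) unfolding fin_dim_def basis_def by (intro exI[of _ "\<alpha> ` S"]) auto
  obtain B where B: "finite B" "B \<subseteq> H" "lin_indpt B" "span B = H"
    and dimH: "vectorspace.dim \<complex>\<^sub>R (V\<lparr>carrier := H\<rparr>) = card B"
    by (rule subspace_finite_basis[OF fd H(1)])
  have BV: "B \<subseteq> carrier V"
    using B(2) H(1) by (auto simp: VectorSpace.subspace_def submodule_def)
  have "\<alpha> s \<noteq> \<zero>"
    using D(4) s vs_zero_lin_dep[of "\<alpha> ` S"] by (metis basis_def imageI)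
  have nH: "\<alpha> s \<notin> H"
  proof
    assume "\<alpha> s \<in> H"
    then have "\<alpha> s = (-1) \<odot> \<alpha> s"
      using H(3) T(2) as csmult_minus_one by simp
    then have "\<alpha> s \<oplus> \<alpha> s = \<alpha> s \<oplus> (-1) \<odot> \<alpha> s"
      by simp
    also have "\<dots> = 0 \<odot> \<alpha> s"
      using as csmult_add_left[of "\<alpha> s" 1 "-1"] by (simp add: csmult_one)
    finally have "2 \<odot> \<alpha> s = \<zero>"
      using as csmult_add_left[of "\<alpha> s" 1 1] by (simp add: csmult_one csmult_zero_left)
    then show False
      using csmult_eq_zero[OF _ as \<open>\<alpha> s \<noteq> \<zero>\<close>] by fastforce
  qed
  have "\<not> lin_dep (B \<union> {\<alpha> s})"
    using lin_dep_iff_in_span[OF BV B(3) as] nH B(2,4) by blast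
  moreover have "card (B \<union> {\<alpha> s}) = dim"
  proof -
    have "\<alpha> s \<notin> B" using B(2) nH by blast
    then show ?thesis using B(1) H(2) dimH by simp
  qed
  ultimately have "basis (B \<union> {\<alpha> s})"
    using fd B(1) BV as by (intro dim_li_is_basis) auto
  then have "v \<in> span (B \<union> {\<alpha> s})"
    using v by (simp add: basis_def)
  then obtain a where a: "lincomb a (B \<union> {\<alpha> s}) = v"
    using finite_in_span[of "B \<union> {\<alpha> s}" v] B(1) BV as by auto
  define h where "h = lincomb a B"
  have "h \<in> span B"
    unfolding h_def finite_span[OF B(1) BV] by auto
  then have h: "h \<in> H" "h \<in> carrier V"
    using B(4) span_is_subset2[OF BV] by auto
  have v_eq: "v = a (\<alpha> s) \<odot> \<alpha> s \<oplus> h"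
    using lincomb_insert[OF B(1) BV, of a "\<alpha> s"] a nH B(2) as by (auto simp: h_def)
  have "T v = a (\<alpha> s) \<odot> T (\<alpha> s) \<oplus> T h"
    unfolding v_eq using as h by (simp add: module_homD[OF T(1)])
  also have "\<dots> = a (\<alpha> s) \<odot> ((-1) \<odot> \<alpha> s) \<oplus> h"
    using T(2) H(3)[OF h(1)] as by (simp add: csmult_minus_one)
  also have "\<dots> = (a (\<alpha> s) + (-2 * a (\<alpha> s))) \<odot> \<alpha> s \<oplus> h"
    using as by (simp add: csmult_csmult)
  also have "\<dots> = v \<oplus> (-2 * a (\<alpha> s)) \<odot> \<alpha> s"
    unfolding v_eq using as h by (simp only: csmult_add_left) (simp add: M.a_ac)
  finally show ?thesis by blast
qed

text \<open>By linearity \<open>T - 1\<close> maps all of \<open>V\<close>, and not only the basis,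
  into the line of \<open>\<alpha> s\<close>. Applied to a second basis, this is what makes the
  basis vectors unique up to scalars.\<close>

lemma reflection_displacement:
  assumes \<alpha>: "basis_family S V \<alpha>" and s: "s \<in> S"
    and T: "T \<in> module_hom \<complex>\<^sub>R V V" "\<And>t. t \<in> S \<Longrightarrow> T (\<alpha> t) = \<alpha> t \<oplus> x t \<odot> \<alpha> s"
    and v: "v \<in> carrier V"
  shows "\<exists>k. T v = v \<oplus> k \<odot> \<alpha> s"
proof -
  note D = basis_familyD[OF \<alpha>]
  have as: "\<alpha> s \<in> carrier V" using D(6) s .
  obtain c where c: "v = comb V \<alpha> S c"
    using comb_bij_betw[OF \<alpha>] v by (auto simp: bij_betw_def)
  have "\<exists>k. T (comb V \<alpha> R c) = comb V \<alpha> R c \<oplus> k \<odot> \<alpha> s" if "finite R" "R \<subseteq> S" for R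
    using that
  proof (induction R)
    case empty
    have "T \<zero> = T (0 \<odot> \<zero>)"
      by (simp only: csmult_zero_right)
    also have "\<dots> = 0 \<odot> T \<zero>"
      by (rule module_homD(3)[OF T(1) M.zero_closed])
    also have "\<dots> = \<zero>"
      by (rule csmult_zero_left[OF module_homD(1)[OF T(1) M.zero_closed]])
    finally show ?case
      using as by (intro exI[of _ 0]) (simp add: comb_empty csmult_zero_left)
  next
    case (insert r R)
    then obtain k where k: "T (comb V \<alpha> R c) = comb V \<alpha> R c \<oplus> k \<odot> \<alpha> s" by auto
    have sub: "\<alpha> ` R \<subseteq> carrier V" "\<alpha> r \<in> carrier V" "\<alpha> ` insert r R \<subseteq> carrier V"
      using insert D(5,6) by auto
    have cl: "comb V \<alpha> R c \<in> carrier V" using comb_closed[OF sub(1)] .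
    have "T (comb V \<alpha> (insert r R) c) = c r \<odot> (\<alpha> r \<oplus> x r \<odot> \<alpha> s) \<oplus> (comb V \<alpha> R c \<oplus> k \<odot> \<alpha> s)"
      unfolding comb_insert[OF insert(1,2) sub(3)]
      using sub(2) cl T(2)[of r] insert k by (simp add: module_homD[OF T(1)])
    also have "\<dots> = comb V \<alpha> (insert r R) c \<oplus> (c r * x r + k) \<odot> \<alpha> s"
      unfolding comb_insert[OF insert(1,2) sub(3)]
      using sub(2) cl as by (simp add: csmult_add_right csmult_add_left csmult_csmult M.a_ac)
    finally show ?case by blast
  qed
  from this[OF D(2) subset_refl] show ?thesis
    unfolding c .
qed

text \<open>The hyperplane is the kernel of \<open>N\<close>, that is \<open>T - 1\<close>, whose
  image is exactly the line of \<open>\<alpha> s\<close>; rank-nullity gives the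
  codimension.\<close>

lemma reflection_hyperplane:
  assumes \<alpha>: "basis_family S V \<alpha>" and s: "s \<in> S"
    and T: "T \<in> module_hom \<complex>\<^sub>R V V" "\<And>t. t \<in> S \<Longrightarrow> T (\<alpha> t) = \<alpha> t \<oplus> x t \<odot> \<alpha> s"
    and xs: "x s = -2"
  shows "\<exists>H. VectorSpace.subspace \<complex>\<^sub>R H V \<and>
    vectorspace.dim \<complex>\<^sub>R (V\<lparr>carrier := H\<rparr>) + 1 = dim \<and> (\<forall>v\<in>H. T v = v)"
proof -
  note D = basis_familyD[OF \<alpha>]
  have as: "\<alpha> s \<in> carrier V" using D(6) s .
  have as0: "\<alpha> s \<noteq> \<zero>"
    using D(4) s vs_zero_lin_dep[of "\<alpha> ` S"] by (metis basis_def imageI)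
  have fd: "fin_dim"
    using D(2,4) unfolding fin_dim_def basis_def by (intro exI[of _ "\<alpha> ` S"]) auto
  define N where "N = (\<lambda>v. T v \<ominus> v)"
  have TV: "T v \<in> carrier V" if "v \<in> carrier V" for v
    using module_homD(1)[OF T(1) that] .
  have N_k: "\<exists>k. N v = k \<odot> \<alpha> s" if v: "v \<in> carrier V" for v
  proof -
    obtain k where k: "T v = v \<oplus> k \<odot> \<alpha> s"
      using reflection_displacement[OF \<alpha> s T v] by blast
    have "N v = k \<odot> \<alpha> s"
      unfolding N_def k using v as by (simp add: M.minus_eq M.a_ac M.r_neg1 M.r_neg2)
    then show ?thesis by blast
  qed
  have Nmod: "N \<in> module_hom \<complex>\<^sub>R V V"
  proof (rule module_homI)
    show "N v \<in> carrier V" if "v \<in> carrier V" for v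
      using TV that by (simp add: N_def)
    show "N (v \<oplus> w) = N v \<oplus> N w" if "v \<in> carrier V" "w \<in> carrier V" for v w
      using that TV by (simp add: N_def module_homD[OF T(1)] M.minus_eq M.minus_add M.a_ac)
    show "N (a \<odot> v) = a \<odot> N v" if "v \<in> carrier V" for a v
      using that TV
      by (simp add: N_def module_homD[OF T(1)] M.minus_eq csmult_add_right csmult_minus_one csmult_csmult
          mult.commute)
  qed
  interpret N: linear_map cring_complex V V N
    by unfold_locales (rule Nmod)
  have N_as: "N (k \<odot> \<alpha> s) = (-2 * k) \<odot> \<alpha> s" for k
  proof -
    have "N (k \<odot> \<alpha> s) = k \<odot> N (\<alpha> s)"
      by (rule module_homD(3)[OF Nmod as])
    also have "N (\<alpha> s) = (-2) \<odot> \<alpha> s"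
      unfolding N_def T(2)[OF s] xs using as by (simp add: M.minus_eq M.a_ac M.r_neg1 M.r_neg2)
    finally show ?thesis using as by (simp add: csmult_csmult mult.commute)
  qed
  have im: "N.imT = {k \<odot> \<alpha> s | k. True}"
  proof (intro equalityI subsetI)
    fix w assume "w \<in> N.imT"
    then show "w \<in> {k \<odot> \<alpha> s | k. True}"
      using N_k by (auto simp: N.im_def)
  next
    fix w assume "w \<in> {k \<odot> \<alpha> s | k. True}"
    then obtain k where "w = k \<odot> \<alpha> s" by blast
    \<comment> \<open>\<open>N\<close> multiplies \<open>\<alpha> s\<close> by -2, which is
      invertible, so the whole line is attained.\<close>
    then have w: "w = N ((- k / 2) \<odot> \<alpha> s)"
      unfolding N_as by simp
    show "w \<in> N.imT"
      unfolding w N.im_def using as by (intro imageI csmult_closed)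
  qed
  have span: "span {\<alpha> s} = {k \<odot> \<alpha> s | k. True}"
  proof -
    have "lincomb a {\<alpha> s} = a (\<alpha> s) \<odot> \<alpha> s" for a
      using as by (simp add: lincomb_def)
    then show ?thesis
      using as finite_span[of "{\<alpha> s}"] by (auto intro: exI[of _ "\<lambda>_. _"])
  qed
  have sub: "\<alpha> s \<in> N.imT"
    unfolding im using as csmult_one[OF as] by (metis (mono_tags, lifting) mem_Collect_eq)
  interpret I: complex_vs "V\<lparr>carrier := N.imT\<rparr>"
    using subspace_is_vs[OF N.imT_is_subspace] by (simp add: complex_vs_def)
  have "I.dim = 1"
  proof (rule I.dim1I)
    have "submodule \<complex>\<^sub>R N.imT V"
      by (rule N.im_is_submodule)
    then show "I.span {\<alpha> s} = carrier (V\<lparr>carrier := N.imT\<rparr>)"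
      using span_li_not_depend(1)[of "{\<alpha> s}" N.imT] sub span im by simp
  qed (use sub as0 in auto)
  then have "vectorspace.dim \<complex>\<^sub>R (V\<lparr>carrier := N.kerT\<rparr>) + 1 = dim"
    using N.rank_nullity[OF fd] by simp
  moreover have "T v = v" if "v \<in> N.kerT" for v
  proof -
    have v: "v \<in> carrier V" "T v \<ominus> v = \<zero>"
      using that unfolding N.ker_def by (simp_all add: N_def)
    then show ?thesis using TV by simp
  qed
  ultimately show ?thesis
    using N.kerT_is_subspace by blast
qed

end

section \<open>Coxeter matrices of IR-representations\<close>

text \<open>With diagonal entry -2, the condition that \<open>s\<close> negates
  \<open>\<alpha> s\<close> takes the same shape as the other columns.\<close>

definition IR_matrix ::
    "'s set \<Rightarrow> ('s \<Rightarrow> 's \<Rightarrow> enat) \<Rightarrow> (complex, 'v) module \<Rightarrow> ('s word set \<Rightarrow> 'v \<Rightarrow> 'v) \<Rightarrow>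
     ('s \<Rightarrow> 'v) \<Rightarrow> ('s \<Rightarrow> 's \<Rightarrow> complex) \<Rightarrow> bool" where
  "IR_matrix S m V \<phi> \<alpha> X \<longleftrightarrow>
    representation (coxeter_group S m) V \<phi> \<and> basis_family S V \<alpha> \<and> (\<forall>s\<in>S. X s s = -2) \<and>
    (\<forall>s\<in>S. \<forall>t\<in>S. \<phi> (cox_gen S m s) (\<alpha> t) = \<alpha> t \<oplus>\<^bsub>V\<^esub> X s t \<odot>\<^bsub>V\<^esub> \<alpha> s)"

lemma IR_matrixD:
  fixes V (structure)
  assumes "IR_matrix S m V \<phi> \<alpha> X"
  shows "representation (coxeter_group S m) V \<phi>" "basis_family S V \<alpha>" "s \<in> S \<Longrightarrow> X s s = -2"
    "s \<in> S \<Longrightarrow> t \<in> S \<Longrightarrow> \<phi> (cox_gen S m s) (\<alpha> t) = \<alpha> t \<oplus> X s t \<odot> \<alpha> s"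
  using assms by (auto simp: IR_matrix_def)

lemma representationD:
  assumes "representation G V \<phi>"
  shows "complex_vs V" "group_action G (carrier V) \<phi>" "g \<in> carrier G \<Longrightarrow> \<phi> g \<in> module_hom \<complex>\<^sub>R V V"
    "g \<in> carrier G \<Longrightarrow> v \<in> carrier V \<Longrightarrow> \<phi> g v \<in> carrier V"
  using assms by (auto simp: representation_def complex_vs_iff intro: group_action_closed)

lemma IR_matrix_reflection:
  fixes V (structure)
  assumes "IR_matrix S m V \<phi> \<alpha> X" "s \<in> S"
  shows "\<phi> (cox_gen S m s) (\<alpha> s) = \<ominus> \<alpha> s"
proof -
  note D = IR_matrixD[OF assms(1)]
  interpret complex_vs V using D(2) by (rule basis_familyD)
  have as: "\<alpha> s \<in> carrier V" using basis_familyD(6)[OF D(2) assms(2)] .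
  have "\<alpha> s \<oplus> (-2) \<odot> \<alpha> s = (1 + (-2)) \<odot> \<alpha> s"
    unfolding csmult_add_left[OF as] csmult_one[OF as] ..
  then show ?thesis
    using D(3,4)[OF assms(2)] assms(2) as by (simp add: csmult_minus_one)
qed

text \<open>The hyperplane yields the columns by \<open>reflection_columns\<close>; conversely it is
  recovered from them as a fixed space by \<open>reflection_hyperplane\<close>.\<close>

lemma IR_basis_iff_matrix:
  fixes V (structure)
  assumes rep: "representation (coxeter_group S m) V \<phi>" and finS: "finite S"
  shows "IR_basis S m V \<phi> \<alpha> \<longleftrightarrow> (\<exists>X. IR_matrix S m V \<phi> \<alpha> X)"
proof
  interpret complex_vs V using rep by (rule representationD)
  assume IR: "IR_basis S m V \<phi> \<alpha>"
  then have \<alpha>: "basis_family S V \<alpha>"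
    using finS complex_vs_axioms by (simp add: IR_basis_def basis_family_def)
  have neg: "\<phi> (cox_gen S m s) (\<alpha> s) = \<ominus> \<alpha> s" if "s \<in> S" for s
    using IR that by (simp add: IR_basis_def)
  have "\<exists>x. \<phi> (cox_gen S m s) (\<alpha> t) = \<alpha> t \<oplus> x \<odot> \<alpha> s" if s: "s \<in> S" and t: "t \<in> S" for s t
  proof -
    obtain H where H: "VectorSpace.subspace \<complex>\<^sub>R H V"
      "vectorspace.dim \<complex>\<^sub>R (V\<lparr>carrier := H\<rparr>) + 1 = dim" "\<And>v. v \<in> H \<Longrightarrow> \<phi> (cox_gen S m s) v = v"
      using IR s by (auto simp: IR_basis_def)
    show ?thesis
      by (rule reflection_columns[OF \<alpha> s representationD(3)[OF rep cox_gen_closed[OF s]] neg[OF s] H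
            basis_familyD(6)[OF \<alpha> t]])
  qed
  then obtain Y where Y: "\<And>s t. s \<in> S \<Longrightarrow> t \<in> S \<Longrightarrow>
      \<phi> (cox_gen S m s) (\<alpha> t) = \<alpha> t \<oplus> Y s t \<odot> \<alpha> s"
    by metis
  define X where "X = (\<lambda>s t. if s = t then -2 else Y s t)"
  have "\<phi> (cox_gen S m s) (\<alpha> t) = \<alpha> t \<oplus> X s t \<odot> \<alpha> s" if s: "s \<in> S" and t: "t \<in> S" for s t
  proof (cases "s = t")
    case True
    have as: "\<alpha> s \<in> carrier V" using basis_familyD(6)[OF \<alpha> s] .
    have "\<alpha> s \<oplus> (-2) \<odot> \<alpha> s = (1 + (-2)) \<odot> \<alpha> s"
      unfolding csmult_add_left[OF as] csmult_one[OF as] ..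
    then show ?thesis
      using neg[OF s] True as by (simp add: X_def csmult_minus_one)
  next
    case False
    then show ?thesis using Y[OF s t] by (simp add: X_def)
  qed
  then have "IR_matrix S m V \<phi> \<alpha> X"
    using rep \<alpha> by (simp add: IR_matrix_def X_def)
  then show "\<exists>X. IR_matrix S m V \<phi> \<alpha> X"
    by (rule exI[of _ X])
next
  interpret complex_vs V using rep by (rule representationD)
  assume "\<exists>X. IR_matrix S m V \<phi> \<alpha> X"
  then obtain X where X: "IR_matrix S m V \<phi> \<alpha> X" ..
  note D = IR_matrixD[OF X] and B = basis_familyD[OF IR_matrixD(2)[OF X]]
  show "IR_basis S m V \<phi> \<alpha>"
    unfolding IR_basis_def
  proof (intro conjI ballI)
    fix s assume s: "s \<in> S"
    show "\<exists>H. VectorSpace.subspace \<complex>\<^sub>R H V \<and> vectorspace.dim \<complex>\<^sub>R (V\<lparr>carrier := H\<rparr>) + 1 = dim \<and>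
        (\<forall>v\<in>H. \<phi> (cox_gen S m s) v = v)"
      by (rule reflection_hyperplane[OF D(2) s representationD(3)[OF rep cox_gen_closed[OF s]], of "X s"])
        (use D(3,4) s in auto)
    show "\<phi> (cox_gen S m s) (\<alpha> s) = \<ominus> \<alpha> s"
      by (rule IR_matrix_reflection[OF X s])
  qed (use B in auto)
qed

lemma pair_comb:
  fixes V (structure)
  assumes \<alpha>: "basis_family S V \<alpha>" and rt: "r \<in> S" "t \<in> S" "r \<noteq> t"
  shows "module.span \<complex>\<^sub>R V {\<alpha> r, \<alpha> t} = {p \<odot> \<alpha> r \<oplus> q \<odot> \<alpha> t | p q. True}"
    "p \<odot> \<alpha> r \<oplus> q \<odot> \<alpha> t = p' \<odot> \<alpha> r \<oplus> q' \<odot> \<alpha> t \<longleftrightarrow> p = p' \<and> q = q'"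
proof -
  note D = basis_familyD[OF \<alpha>]
  interpret complex_vs V by (rule D)
  let ?U = "V\<lparr>carrier := span {\<alpha> r, \<alpha> t}\<rparr>"
  have fam: "basis_family {r, t} ?U \<alpha>"
    using basis_family_span[OF \<alpha>, of "{r, t}"] rt by simp
  interpret U: complex_vs ?U using fam by (rule basis_familyD)
  note DU = basis_familyD[OF fam]
  have cU: "comb ?U \<alpha> {r, t} c = c r \<odot> \<alpha> r \<oplus> c t \<odot> \<alpha> t" for c
  proof -
    have "comb ?U \<alpha> {r, t} c = c r \<odot> \<alpha> r \<oplus> comb ?U \<alpha> {t} c"
      using U.comb_insert[of "{t}" r \<alpha> c] DU(5) rt by simp
    also have "comb ?U \<alpha> {t} c = c t \<odot> \<alpha> t \<oplus> comb ?U \<alpha> {} c"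
      using U.comb_insert[of "{}" t \<alpha> c] DU(5) by simp
    also have "\<dots> = c t \<odot> \<alpha> t"
      using D(6)[OF rt(2)] by (simp add: U.comb_empty)
    finally show ?thesis .
  qed
  note bij = comb_bij_betw[OF fam]
  let ?c = "\<lambda>p q. \<lambda>x\<in>{r, t}. if x = r then p else (q :: complex)"
  have cpq: "comb ?U \<alpha> {r, t} (?c p q) = p \<odot> \<alpha> r \<oplus> q \<odot> \<alpha> t" for p q
    unfolding cU using rt by simp
  show "span {\<alpha> r, \<alpha> t} = {p \<odot> \<alpha> r \<oplus> q \<odot> \<alpha> t | p q. True}"
  proof (intro equalityI subsetI)
    fix v assume "v \<in> span {\<alpha> r, \<alpha> t}"
    then obtain c where "v = comb ?U \<alpha> {r, t} c"
      using bij by (auto simp: bij_betw_def)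
    then show "v \<in> {p \<odot> \<alpha> r \<oplus> q \<odot> \<alpha> t | p q. True}"
      unfolding cU by blast
  next
    fix v assume "v \<in> {p \<odot> \<alpha> r \<oplus> q \<odot> \<alpha> t | p q. True}"
    then obtain p q where v: "v = comb ?U \<alpha> {r, t} (?c p q)"
      unfolding cpq by blast
    have "comb ?U \<alpha> {r, t} (?c p q) \<in> carrier ?U"
      using DU(5) by (rule U.comb_closed)
    then show "v \<in> span {\<alpha> r, \<alpha> t}"
      unfolding v by simp
  qed
  show "p \<odot> \<alpha> r \<oplus> q \<odot> \<alpha> t = p' \<odot> \<alpha> r \<oplus> q' \<odot> \<alpha> t \<longleftrightarrow> p = p' \<and> q = q'"
  proof
    assume "p \<odot> \<alpha> r \<oplus> q \<odot> \<alpha> t = p' \<odot> \<alpha> r \<oplus> q' \<odot> \<alpha> t"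
    then have "?c p q = ?c p' q'"
      using bij unfolding cpq[symmetric] bij_betw_def by (auto dest!: inj_onD)
    then have "?c p q r = ?c p' q' r" "?c p q t = ?c p' q' t" by simp_all
    then show "p = p' \<and> q = q'" using rt by simp
  qed simp
qed

definition cox_matrix :: "'s set \<Rightarrow> ('s \<Rightarrow> 's \<Rightarrow> enat) \<Rightarrow> ('s \<Rightarrow> 's \<Rightarrow> complex) \<Rightarrow> bool" where
  "cox_matrix S m X \<longleftrightarrow> (\<forall>s\<in>S. X s s = -2) \<and>
    (\<forall>r\<in>S. \<forall>t\<in>S. r \<noteq> t \<longrightarrow> dihedral_valid (m r t) (X r t) (X t r))"

lemma IR_matrix_pair_left:
  fixes V (structure)
  assumes X: "IR_matrix S m V \<phi> \<alpha> X" and rt: "r \<in> S" "t \<in> S"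
  shows "\<phi> (cox_gen S m r) (p \<odot> \<alpha> r \<oplus> q \<odot> \<alpha> t) =
    (X r t * q - p) \<odot> \<alpha> r \<oplus> q \<odot> \<alpha> t"
proof -
  note D = IR_matrixD[OF X]
  interpret complex_vs V using D(2) by (rule basis_familyD)
  have a: "\<alpha> r \<in> carrier V" "\<alpha> t \<in> carrier V" using basis_familyD(6)[OF D(2)] rt by auto
  note hom = module_homD[OF representationD(3)[OF D(1) cox_gen_closed[OF rt(1)]]]
  have "\<phi> (cox_gen S m r) (p \<odot> \<alpha> r \<oplus> q \<odot> \<alpha> t) =
      p \<odot> (\<alpha> r \<oplus> (-2) \<odot> \<alpha> r) \<oplus> q \<odot> (\<alpha> t \<oplus> X r t \<odot> \<alpha> r)"
    using a D(3)[OF rt(1)] D(4)[OF rt(1) rt(1)] D(4)[OF rt] by (simp add: hom)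
  then show ?thesis
    using reflection_pair_step[OF a] by simp
qed

lemma IR_matrix_pair_right:
  fixes V (structure)
  assumes X: "IR_matrix S m V \<phi> \<alpha> X" and rt: "r \<in> S" "t \<in> S"
  shows "\<phi> (cox_gen S m t) (p \<odot> \<alpha> r \<oplus> q \<odot> \<alpha> t) =
    p \<odot> \<alpha> r \<oplus> (X t r * p - q) \<odot> \<alpha> t"
proof -
  note D = IR_matrixD[OF X]
  interpret complex_vs V using D(2) by (rule basis_familyD)
  have a: "\<alpha> r \<in> carrier V" "\<alpha> t \<in> carrier V" using basis_familyD(6)[OF D(2)] rt by auto
  show ?thesis
    using IR_matrix_pair_left[OF X rt(2,1), of q p] a by (simp add: M.a_comm)
qed

text \<open>In the coordinates of the plane of \<open>\<alpha> r\<close> and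
  \<open>\<alpha> t\<close> the product of the two generators is \<open>rotation\<close>, so the
  relator forces it to have period \<open>n\<close>.\<close>

lemma IR_matrix_valid:
  fixes V (structure)
  assumes X: "IR_matrix S m V \<phi> \<alpha> X"
    and m: "\<And>s t. s \<in> S \<Longrightarrow> t \<in> S \<Longrightarrow> s \<noteq> t \<Longrightarrow> 2 \<le> m s t"
  shows "cox_matrix S m X"
proof -
  note D = IR_matrixD[OF X]
  interpret complex_vs V using D(2) by (rule basis_familyD)
  have "dihedral_valid (m r t) (X r t) (X t r)" if rt: "r \<in> S" "t \<in> S" "r \<noteq> t" for r t
  proof (cases "m r t")
    case infinity
    then show ?thesis by (simp add: dihedral_valid_def)
  next
    case (enat n)
    have a: "\<alpha> r \<in> carrier V" "\<alpha> t \<in> carrier V" using basis_familyD(6)[OF D(2)] rt by auto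
    define P where "P = (\<lambda>(p, q). p \<odot> \<alpha> r \<oplus> q \<odot> \<alpha> t)"
    let ?f = "\<lambda>v. \<phi> (cox_gen S m r) (\<phi> (cox_gen S m t) v)"
    have step: "?f (P v) = P (rotation (X r t) (X t r) v)" for v
      unfolding P_def
      by (cases v) (simp add: IR_matrix_pair_left[OF X rt(1,2)] IR_matrix_pair_right[OF X rt(1,2)]
          rotation_def algebra_simps)
    have iter: "(?f ^^ j) (P v) = P ((rotation (X r t) (X t r) ^^ j) v)" for j v
      by (induction j) (simp_all add: step)
    have inj: "P v = P w \<Longrightarrow> v = w" for v w
      using pair_comb(2)[OF D(2) rt] by (cases v; cases w) (simp add: P_def)
    have "(rotation (X r t) (X t r) ^^ n) v = v" for v
    proof (rule inj)
      have "P v \<in> carrier V" using a by (cases v) (simp add: P_def)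
      then have "(?f ^^ n) (P v) = P v"
        by (rule cox_gen_pair_relation[OF rt enat representationD(2)[OF D(1)]])
      then show "P ((rotation (X r t) (X t r) ^^ n) v) = P v"
        by (simp only: iter)
    qed
    moreover have "2 \<le> n"
      using m[OF rt] enat by (simp add: numeral_eq_enat)
    ultimately show ?thesis
      unfolding enat by (intro valid_if_rotation_period)
  qed
  then show ?thesis using D(3) by (simp add: cox_matrix_def)
qed

section \<open>Isomorphisms and transport of representations\<close>

lemma (in complex_vs) add_left_cancel:
  assumes "x \<in> carrier V" "y \<in> carrier V" "z \<in> carrier V"
  shows "x \<oplus> y = x \<oplus> z \<longleftrightarrow> y = z"
proof
  assume "x \<oplus> y = x \<oplus> z"
  then have "\<ominus> x \<oplus> (x \<oplus> y) = \<ominus> x \<oplus> (x \<oplus> z)" by simp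
  then show "y = z" using assms by (simp add: M.r_neg1)
qed simp

text \<open>For one generator, linearity extends the relation from basis vectors to all vectors;
  \<open>generate_intertwine\<close> then extends it to the whole group.\<close>

lemma rep_iso_on_generators:
  assumes rep: "representation G V \<phi>" "representation G V' \<phi>'"
    and \<alpha>: "basis_family T V \<alpha>"
    and f: "f \<in> module_hom \<complex>\<^sub>R V V'" "bij_betw f (carrier V) (carrier V')"
    and B: "B \<subseteq> carrier G" "carrier G \<subseteq> generate G B"
    and eq: "\<And>b t. b \<in> B \<Longrightarrow> t \<in> T \<Longrightarrow> f (\<phi> b (\<alpha> t)) = \<phi>' b (f (\<alpha> t))"
  shows "rep_iso G V \<phi> V' \<phi>' f"
proof -
  note R = representationD[OF rep(1)] and R' = representationD[OF rep(2)]
  have "f (\<phi> b v) = \<phi>' b (f v)" if b: "b \<in> B" and v: "v \<in> carrier V" for b v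
  proof -
    have bG: "b \<in> carrier G" using b B(1) by blast
    have "(f \<circ> \<phi> b) v = (\<phi>' b \<circ> f) v"
      using \<alpha> R'(1) module_hom_comp[OF R(3)[OF bG] f(1)] module_hom_comp[OF f(1) R'(3)[OF bG]] _ v
      by (rule basis_family_hom_eqI) (simp add: eq b)
    then show ?thesis by simp
  qed
  then have "f (\<phi> g v) = \<phi>' g (f v)" if "g \<in> generate G B" "v \<in> carrier V" for g v
    using generate_intertwine[OF R(2) R'(2) B(1) _ _ that] module_homD(1)[OF f(1)] by blast
  then show ?thesis
    using f R(4) B(2) by (auto simp: rep_iso_def)
qed

lemma representation_transport:
  assumes rep: "representation G V \<phi>" and V': "complex_vs V'"
    and L: "L \<in> module_hom \<complex>\<^sub>R V' V" "inj_on L (carrier V')"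
    and invariant: "\<And>g u. g \<in> carrier G \<Longrightarrow> u \<in> carrier V' \<Longrightarrow> \<phi> g (L u) \<in> L ` carrier V'"
  obtains \<phi>' where "representation G V' \<phi>'"
    "\<And>g u. g \<in> carrier G \<Longrightarrow> u \<in> carrier V' \<Longrightarrow> L (\<phi>' g u) = \<phi> g (L u)"
proof -
  interpret V': complex_vs V' by (rule V')
  note R = representationD[OF rep]
  have "L ` carrier V' \<subseteq> carrier V"
    using module_homD(1)[OF L(1)] by auto
  then obtain \<phi>' where \<phi>': "group_action G (carrier V') \<phi>'"
    "\<And>g u. g \<in> carrier G \<Longrightarrow> u \<in> carrier V' \<Longrightarrow> L (\<phi>' g u) = \<phi> g (L u)"
    using group_action_transport[OF R(2) L(2) _ invariant] by metis
  have "\<phi>' g \<in> module_hom \<complex>\<^sub>R V' V'" if g: "g \<in> carrier G" for g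
  proof (rule module_homI)
    note hom = module_homD[OF R(3)[OF g]]
    have LV: "L u \<in> carrier V" if "u \<in> carrier V'" for u
      using module_homD(1)[OF L(1) that] .
    show cl: "\<phi>' g u \<in> carrier V'" if "u \<in> carrier V'" for u
      using group_action_closed[OF \<phi>'(1) g that] .
    show "\<phi>' g (u \<oplus>\<^bsub>V'\<^esub> w) = \<phi>' g u \<oplus>\<^bsub>V'\<^esub> \<phi>' g w" if "u \<in> carrier V'" "w \<in> carrier V'" for u w
      using that cl LV
      by (intro inj_onD[OF L(2)]) (simp_all add: \<phi>'(2)[OF g] module_homD[OF L(1)] hom)
    show "\<phi>' g (a \<odot>\<^bsub>V'\<^esub> u) = a \<odot>\<^bsub>V'\<^esub> \<phi>' g u" if "u \<in> carrier V'" for a u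
      using that cl LV
      by (intro inj_onD[OF L(2)]) (simp_all add: \<phi>'(2)[OF g] module_homD[OF L(1)] hom)
  qed
  then have "representation G V' \<phi>'"
    using V' \<phi>'(1) by (simp add: representation_def complex_vs_iff)
  then show ?thesis
    using that \<phi>'(2) by blast
qed

lemma rep_iso_sym:
  assumes rep: "representation G V \<phi>" "representation G V' \<phi>'" and f: "rep_iso G V \<phi> V' \<phi>' f"
  shows "rep_iso G V' \<phi>' V \<phi> (inv_into (carrier V) f)"
proof -
  note R = representationD[OF rep(1)] and R' = representationD[OF rep(2)]
  have f': "f \<in> module_hom \<complex>\<^sub>R V V'" "bij_betw f (carrier V) (carrier V')"
    "\<And>g v. g \<in> carrier G \<Longrightarrow> v \<in> carrier V \<Longrightarrow> f (\<phi> g v) = \<phi>' g (f v)"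
    using f by (auto simp: rep_iso_def)
  have "inv_into (carrier V) f (\<phi>' g w) = \<phi> g (inv_into (carrier V) f w)"
    if g: "g \<in> carrier G" and w: "w \<in> carrier V'" for g w
  proof -
    obtain v where v: "v \<in> carrier V" "w = f v"
      using f'(2) w by (auto simp: bij_betw_def)
    have inj: "inj_on f (carrier V)" using f'(2) by (simp add: bij_betw_def)
    show ?thesis
      unfolding v(2) f'(3)[OF g v(1), symmetric]
      by (simp add: inv_into_f_f[OF inj] v(1) R(4)[OF g])
  qed
  then show ?thesis
    using module_hom_inv_into[OF R(1) f'(1,2)] bij_betw_inv_into[OF f'(2)] R'(4)
    by (simp add: rep_iso_def)
qed

lemma rep_iso_trans:
  assumes "rep_iso G V \<phi> V' \<phi>' f" "rep_iso G V' \<phi>' V'' \<phi>'' g"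
  shows "rep_iso G V \<phi> V'' \<phi>'' (g \<circ> f)"
  using assms module_hom_comp bij_betw_trans module_homD(1)
  unfolding rep_iso_def by fastforce

lemma rep_iso_id:
  assumes "representation G V \<phi>"
  shows "rep_iso G V \<phi> V \<phi> (\<lambda>v. v)"
  using representationD(4)[OF assms] by (auto simp: rep_iso_def module_hom_complex bij_betw_def)

lemma IR_matrix_image:
  assumes X: "IR_matrix S m V \<phi> \<alpha> X" and rep: "representation (coxeter_group S m) V' \<phi>'"
    and f: "rep_iso (coxeter_group S m) V \<phi> V' \<phi>' f"
  shows "IR_matrix S m V' \<phi>' (f \<circ> \<alpha>) X"
proof -
  note D = IR_matrixD[OF X] and B = basis_familyD[OF IR_matrixD(2)[OF X]]
  interpret complex_vs V by (rule B)
  have f': "f \<in> module_hom \<complex>\<^sub>R V V'" "bij_betw f (carrier V) (carrier V')"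
    "\<And>g v. g \<in> carrier (coxeter_group S m) \<Longrightarrow> v \<in> carrier V \<Longrightarrow> f (\<phi> g v) = \<phi>' g (f v)"
    using f by (auto simp: rep_iso_def)
  have "\<phi>' (cox_gen S m s) (f (\<alpha> t)) = f (\<alpha> t) \<oplus>\<^bsub>V'\<^esub> X s t \<odot>\<^bsub>V'\<^esub> f (\<alpha> s)" if "s \<in> S" "t \<in> S" for s t
    using f'(3)[OF cox_gen_closed B(6), of s t] D(4)[OF that] that B(6)
    by (simp add: module_homD[OF f'(1)])
  then show ?thesis
    using rep basis_family_image[OF D(2) representationD(1)[OF rep] f'(1,2)] D(3)
    by (simp add: IR_matrix_def)
qed

lemma basis_family_rescale:
  fixes V (structure)
  assumes \<alpha>: "basis_family S V \<alpha>" and c: "\<And>s. s \<in> S \<Longrightarrow> c s \<noteq> 0"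
  shows "basis_family S V (\<lambda>s. c s \<odot> \<alpha> s)"
proof -
  note B = basis_familyD[OF \<alpha>]
  interpret complex_vs V by (rule B)
  let ?\<beta> = "\<lambda>s. c s \<odot> \<alpha> s"
  have sub: "?\<beta> ` S \<subseteq> carrier V" using B(6) by auto
  let ?M = "\<lambda>d. \<lambda>s\<in>S. d s * c s"
  have "bij_betw ?M (S \<rightarrow>\<^sub>E UNIV) (S \<rightarrow>\<^sub>E UNIV)"
  proof (rule bij_betw_byWitness[of _ "\<lambda>d. \<lambda>s\<in>S. d s / c s"])
    show "\<forall>d\<in>S \<rightarrow>\<^sub>E UNIV. (\<lambda>s\<in>S. ?M d s / c s) = d"
      using c by (intro ballI extensionalityI[of _ S]) (auto simp: PiE_def)
    show "\<forall>d\<in>S \<rightarrow>\<^sub>E UNIV. ?M (\<lambda>s\<in>S. d s / c s) = d"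
      using c by (intro ballI extensionalityI[of _ S]) (auto simp: PiE_def)
  qed auto
  from bij_betw_trans[OF this comb_bij_betw[OF \<alpha>]]
  have bij: "bij_betw (comb V \<alpha> S \<circ> ?M) (S \<rightarrow>\<^sub>E UNIV) (carrier V)" .
  have eq: "comb V \<alpha> S \<circ> ?M = comb V ?\<beta> S"
  proof
    fix d
    have "comb V \<alpha> S (?M d) = comb V ?\<beta> S d"
      unfolding comb_def using B(6) by (intro M.finsum_cong') (auto simp: csmult_csmult)
    then show "(comb V \<alpha> S \<circ> ?M) d = comb V ?\<beta> S d" by simp
  qed
  have inj: "inj_on ?\<beta> S"
  proof (rule inj_onI, rule ccontr)
    fix s t assume st: "s \<in> S" "t \<in> S" "?\<beta> s = ?\<beta> t" "s \<noteq> t"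
    then have "c s \<odot> \<alpha> s \<oplus> 0 \<odot> \<alpha> t = 0 \<odot> \<alpha> s \<oplus> c t \<odot> \<alpha> t"
      using B(6) by (simp add: csmult_zero_left)
    then have "c s = 0 \<and> 0 = c t"
      by (rule iffD1[OF pair_comb(2)[OF \<alpha> st(1,2,4)]])
    then show False
      using c st by simp
  qed
  show ?thesis
    using basis_iff_comb_bij[OF B(2) inj sub] bij eq inj B(1,2) by (simp add: basis_family_def)
qed

lemma IR_matrix_rescale:
  fixes V (structure)
  assumes X: "IR_matrix S m V \<phi> \<alpha> X" and c: "\<And>s. s \<in> S \<Longrightarrow> c s \<noteq> 0"
  shows "IR_matrix S m V \<phi> (\<lambda>s. c s \<odot> \<alpha> s) (\<lambda>s t. X s t * c t / c s)"
proof -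
  note D = IR_matrixD[OF X] and B = basis_familyD[OF IR_matrixD(2)[OF X]]
  interpret complex_vs V by (rule B)
  let ?\<beta> = "\<lambda>s. c s \<odot> \<alpha> s"
  have fam: "basis_family S V ?\<beta>"
    using D(2) c by (rule basis_family_rescale)
  have "\<phi> (cox_gen S m s) (?\<beta> t) = ?\<beta> t \<oplus> (X s t * c t / c s) \<odot> ?\<beta> s"
    if st: "s \<in> S" "t \<in> S" for s t
  proof -
    have "\<phi> (cox_gen S m s) (?\<beta> t) = c t \<odot> (\<alpha> t \<oplus> X s t \<odot> \<alpha> s)"
      using module_homD(3)[OF representationD(3)[OF D(1) cox_gen_closed[OF st(1)]] B(6)[OF st(2)]]
        D(4)[OF st] by simp
    then show ?thesis
      using B(6) st c by (simp add: csmult_add_right csmult_csmult mult.commute)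
  qed
  then show ?thesis
    using D fam c by (simp add: IR_matrix_def)
qed

text \<open>The vector \<open>\<alpha>' s\<close> lies in the -1 eigenspace of \<open>s\<close>,
  which is the line of \<open>\<alpha> s\<close>. Hence the bases differ by scalars, and comparing
  coefficients conjugates the matrices.\<close>

lemma IR_matrix_unique:
  fixes V (structure)
  assumes X: "IR_matrix S m V \<phi> \<alpha> X" and X': "IR_matrix S m V \<phi> \<alpha>' X'"
  obtains c where "\<And>s. s \<in> S \<Longrightarrow> c s \<noteq> 0" "\<And>s t. s \<in> S \<Longrightarrow> t \<in> S \<Longrightarrow> X' s t = X s t * c t / c s"
proof -
  note D = IR_matrixD[OF X] and B = basis_familyD[OF IR_matrixD(2)[OF X]]
  note D' = IR_matrixD[OF X'] and B' = basis_familyD[OF IR_matrixD(2)[OF X']]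
  interpret complex_vs V by (rule B)
  have nz: "\<beta> s \<noteq> \<zero>" if "basis_family S V \<beta>" "s \<in> S" for \<beta> s
    using basis_familyD(4)[OF that(1)] that(2) vs_zero_lin_dep[of "\<beta> ` S"] by (metis basis_def imageI)
  have "\<exists>c. c \<noteq> 0 \<and> \<alpha>' s = c \<odot> \<alpha> s" if s: "s \<in> S" for s
  proof -
    have a: "\<alpha> s \<in> carrier V" "\<alpha>' s \<in> carrier V" using B(6) B'(6) s by auto
    obtain k where k: "\<phi> (cox_gen S m s) (\<alpha>' s) = \<alpha>' s \<oplus> k \<odot> \<alpha> s"
      using reflection_displacement[OF D(2) s representationD(3)[OF D(1) cox_gen_closed[OF s]] D(4)[OF s] a(2)]
      by blast
    \<comment> \<open>The displacement of \<open>\<alpha>' s\<close> under \<open>s\<close> is a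
      multiple of \<open>\<alpha> s\<close> by the first matrix, and -2 times
      \<open>\<alpha>' s\<close> by the second.\<close>
    have "\<alpha>' s \<oplus> k \<odot> \<alpha> s = \<alpha>' s \<oplus> (-2) \<odot> \<alpha>' s"
      using k D'(3,4)[OF s] s by simp
    then have "k \<odot> \<alpha> s = (-2) \<odot> \<alpha>' s"
      using a by (simp add: add_left_cancel)
    then have "(-1/2) \<odot> (k \<odot> \<alpha> s) = (-1/2) \<odot> ((-2) \<odot> \<alpha>' s)"
      by simp
    then have eq: "\<alpha>' s = (- k / 2) \<odot> \<alpha> s"
      using a by (simp add: csmult_csmult csmult_one)
    then have "k \<noteq> 0"
      using nz[OF D'(2) s] a by (auto simp: csmult_zero_left)
    then show ?thesis
      using eq by (intro exI[of _ "- k / 2"]) simp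
  qed
  then obtain c where c: "\<And>s. s \<in> S \<Longrightarrow> c s \<noteq> 0" "\<And>s. s \<in> S \<Longrightarrow> \<alpha>' s = c s \<odot> \<alpha> s"
    by metis
  have "IR_matrix S m V \<phi> (\<lambda>s. c s \<odot> \<alpha> s) (\<lambda>s t. X s t * c t / c s)"
    using X c(1) by (rule IR_matrix_rescale)
  note E = IR_matrixD[OF this]
  have "X' s t = X s t * c t / c s" if st: "s \<in> S" "t \<in> S" for s t
  proof -
    have a: "\<alpha>' s \<in> carrier V" "\<alpha>' t \<in> carrier V" using B'(6) st by auto
    let ?d = "X s t * c t / c s - X' s t"
    have "\<alpha>' t \<oplus> X' s t \<odot> \<alpha>' s = \<alpha>' t \<oplus> (X s t * c t / c s) \<odot> \<alpha>' s"
      using D'(4)[OF st] E(4)[OF st] c(2) st by simp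
    also have "X s t * c t / c s = X' s t + ?d" by simp
    finally have "X' s t \<odot> \<alpha>' s = X' s t \<odot> \<alpha>' s \<oplus> ?d \<odot> \<alpha>' s"
      using a by (simp only: csmult_add_left add_left_cancel csmult_closed M.a_closed)
    then have "X' s t \<odot> \<alpha>' s \<oplus> \<zero> = X' s t \<odot> \<alpha>' s \<oplus> ?d \<odot> \<alpha>' s"
      using a by simp
    then have "?d \<odot> \<alpha>' s = \<zero>"
      using a by (simp only: add_left_cancel csmult_closed M.zero_closed)
    then have "?d = 0"
      using csmult_eq_zero a nz[OF D'(2) st(1)] by blast
    then show ?thesis by simp
  qed
  then show ?thesis
    using that c(1) by blast
qed

section \<open>Existence of representations with a given matrix\<close>

text \<open>The linear form by which \<open>s\<close> displaces a vector along the unit vector of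
  \<open>s\<close>.\<close>

definition row_form :: "'s set \<Rightarrow> ('s \<Rightarrow> 's \<Rightarrow> complex) \<Rightarrow> 's \<Rightarrow> ('s \<Rightarrow> complex) \<Rightarrow> complex" where
  "row_form S X s c = (\<Sum>t\<in>S. X s t * c t)"

definition matrix_reflection ::
    "'s set \<Rightarrow> ('s \<Rightarrow> 's \<Rightarrow> complex) \<Rightarrow> 's \<Rightarrow> ('s \<Rightarrow> complex) \<Rightarrow> 's \<Rightarrow> complex" where
  "matrix_reflection S X s c = c(s := c s + row_form S X s c)"

lemma row_form_upd:
  assumes "finite S" "r \<in> S"
  shows "row_form S X s (c(r := a)) = row_form S X s c + X s r * (a - c r)"
proof -
  have "(\<Sum>t\<in>S - {r}. X s t * (c(r := a)) t) = (\<Sum>t\<in>S - {r}. X s t * c t)"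
    by (intro sum.cong) auto
  then show ?thesis
    using assms by (simp add: row_form_def sum.remove[of S r] algebra_simps)
qed

lemma matrix_reflection_closed:
  "s \<in> S \<Longrightarrow> c \<in> S \<rightarrow>\<^sub>E UNIV \<Longrightarrow> matrix_reflection S X s c \<in> S \<rightarrow>\<^sub>E UNIV"
  by (auto simp: matrix_reflection_def PiE_def extensional_def)

lemma matrix_reflection_involution:
  assumes "finite S" "s \<in> S" "X s s = -2"
  shows "matrix_reflection S X s (matrix_reflection S X s c) = c"
  using assms by (simp add: matrix_reflection_def row_form_upd)

lemma matrix_reflection_hom:
  assumes "s \<in> S"
  shows "matrix_reflection S X s \<in> module_hom \<complex>\<^sub>R (ring.func_space \<complex>\<^sub>R S) (ring.func_space \<complex>\<^sub>R S)"
proof (rule module_homI)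
  show "matrix_reflection S X s c \<in> carrier (ring.func_space \<complex>\<^sub>R S)" if "c \<in> carrier (ring.func_space \<complex>\<^sub>R S)" for c
    using that matrix_reflection_closed[OF assms] by (simp add: func_space_sel)
  have "row_form S X s (\<lambda>v\<in>S. c v + d v) = row_form S X s c + row_form S X s d" for c d
    unfolding row_form_def sum.distrib[symmetric] by (intro sum.cong) (auto simp: distrib_left)
  then show "matrix_reflection S X s (c \<oplus>\<^bsub>ring.func_space \<complex>\<^sub>R S\<^esub> d) =
      matrix_reflection S X s c \<oplus>\<^bsub>ring.func_space \<complex>\<^sub>R S\<^esub> matrix_reflection S X s d" for c d
    using assms by (auto simp: func_space_sel matrix_reflection_def fun_eq_iff)
  have "row_form S X s (\<lambda>v\<in>S. a * c v) = a * row_form S X s c" for a c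
    unfolding row_form_def sum_distrib_left by (intro sum.cong) auto
  then show "matrix_reflection S X s (a \<odot>\<^bsub>ring.func_space \<complex>\<^sub>R S\<^esub> c) =
      a \<odot>\<^bsub>ring.func_space \<complex>\<^sub>R S\<^esub> matrix_reflection S X s c" for a c
    using assms by (auto simp: func_space_sel matrix_reflection_def fun_eq_iff distrib_left)
qed

text \<open>
  Since \<open>x y \<noteq> 4\<close>, the space is the sum of the plane spanned by \<open>e\<^sub>r\<close> and \<open>e\<^sub>t\<close> and the common
  kernel of the two linear forms; on the latter both reflections are trivial.
\<close>

lemma matrix_reflection_period:
  assumes S: "finite S" "r \<in> S" "t \<in> S" "r \<noteq> t" and X: "X r r = -2" "X t t = -2"
    and valid: "dihedral_valid (enat n) (X r t) (X t r)"
  shows "((\<lambda>c. matrix_reflection S X r (matrix_reflection S X t c)) ^^ n) c = c"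
proof -
  define x y where "x = X r t" and "y = X t r"
  define D where "D = 4 - x * y"
  have D: "D \<noteq> 0"
    using valid_prod_ne_4[OF valid] by (simp add: D_def x_def y_def)
  \<comment> \<open>Cramer's rule with determinant \<open>D\<close>: the component of
    \<open>c\<close> in the plane is chosen so that both forms vanish on the remainder
    \<open>c0\<close>.\<close>
  define p q where "p = - (2 * row_form S X r c + x * row_form S X t c) / D"
    and "q = - (2 * row_form S X t c + y * row_form S X r c) / D"
  define c0 where "c0 = c(r := c r - p, t := c t - q)"
  have form_c0: "row_form S X s c0 = row_form S X s c - X s r * p - X s t * q" for s
    using S by (simp add: c0_def row_form_upd)
  have Dp: "D * p = - (2 * row_form S X r c + x * row_form S X t c)"
    and Dq: "D * q = - (2 * row_form S X t c + y * row_form S X r c)"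
    using D by (simp_all add: p_def q_def)
  have "D * row_form S X r c0 = D * row_form S X r c + 2 * (D * p) - x * (D * q)"
    unfolding form_c0 X x_def[symmetric] by (simp add: algebra_simps)
  also have "\<dots> = 0"
    unfolding Dp Dq by (simp add: D_def algebra_simps)
  finally have "D * row_form S X r c0 = 0" .
  moreover have "D * row_form S X t c0 = D * row_form S X t c - y * (D * p) + 2 * (D * q)"
    unfolding form_c0 X y_def[symmetric] by (simp add: algebra_simps)
  then have "D * row_form S X t c0 = 0"
    unfolding Dp Dq by (simp add: D_def algebra_simps)
  ultimately have c0: "row_form S X r c0 = 0" "row_form S X t c0 = 0"
    using D by simp_all
  \<comment> \<open>Parametrises the translate of the plane through \<open>c0\<close>. Both forms
    vanish at \<open>c0\<close>, so the reflections act on the parameters as they do on the plane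
    itself.\<close>
  define P where "P = (\<lambda>(p, q). c0(r := c0 r + p, t := c0 t + q))"
  have form_P: "row_form S X s (P v) = row_form S X s c0 + X s r * fst v + X s t * snd v" for s v
    using S by (cases v) (simp add: P_def row_form_upd)
  have upd: "(P v)(r := P v r + z) = P (fst v + z, snd v)" "(P v)(t := P v t + z) = P (fst v, snd v + z)" for v z
    using S(4) by (cases v; auto simp: P_def fun_eq_iff)+
  have "matrix_reflection S X r (matrix_reflection S X t (P v)) = P (rotation x y v)" for v
    unfolding matrix_reflection_def upd form_P c0 X x_def[symmetric] y_def[symmetric]
    by (cases v) (simp add: rotation_def algebra_simps)
  then have "((\<lambda>c. matrix_reflection S X r (matrix_reflection S X t c)) ^^ j) (P v) =
      P ((rotation x y ^^ j) v)" for j v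
    by (induction j) simp_all
  moreover have "c = P (p, q)"
    using S(4) by (auto simp: P_def c0_def)
  ultimately show ?thesis
    using rotation_period_if_valid[of n x y "(p, q)"] valid by (simp add: x_def y_def)
qed

lemma involution_act_replicate:
  "involution_act f (concat (replicate j [(s, True), (t, True)])) c = ((\<lambda>c. f s (f t c)) ^^ j) c"
  by (induction j) simp_all

text \<open>In coordinates the generators act by \<open>matrix_reflection\<close>; the two kinds of
  relators are respected by \<open>matrix_reflection_involution\<close> and
  \<open>matrix_reflection_period\<close>.\<close>

lemma matrix_representation:
  assumes finS: "finite S" and X: "cox_matrix S m X"
  shows "\<exists>\<phi>. IR_matrix S m (ring.func_space \<complex>\<^sub>R S) \<phi> (func_unit S) X"
proof -
  let ?F = "ring.func_space \<complex>\<^sub>R S :: (complex, 'a \<Rightarrow> complex) module"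
  let ?f = "matrix_reflection S X"
  have X': "X s s = -2" if "s \<in> S" for s using X that by (simp add: cox_matrix_def)
  obtain \<phi> where \<phi>: "group_action (presented_group S (coxeter_relators S m)) (S \<rightarrow>\<^sub>E UNIV) \<phi>"
    "\<And>w c. w \<in> words S \<Longrightarrow> c \<in> S \<rightarrow>\<^sub>E UNIV \<Longrightarrow>
      \<phi> (pres_rel S (coxeter_relators S m) `` {w}) c = involution_act ?f w c"
  proof (rule presented_group_acts[of S "S \<rightarrow>\<^sub>E UNIV" ?f "coxeter_relators S m"])
    show "?f s c \<in> S \<rightarrow>\<^sub>E UNIV" if "s \<in> S" "c \<in> S \<rightarrow>\<^sub>E UNIV" for s c
      by (rule matrix_reflection_closed[OF that])
    show "?f s (?f s c) = c" if "s \<in> S" for s c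
      by (rule matrix_reflection_involution[where X = X, OF finS that X'[OF that]])
    show "involution_act ?f w c = c" if w: "w \<in> coxeter_relators S m" for w c
    proof -
      consider s where "s \<in> S" "w = [(s, True), (s, True)]"
        | s t n where "s \<in> S" "t \<in> S" "s \<noteq> t" "m s t = enat n"
          "w = concat (replicate n [(s, True), (t, True)])"
        using w unfolding coxeter_relators_def by blast
      then show ?thesis
      proof cases
        case 1
        then show ?thesis
          using matrix_reflection_involution[where X = X, OF finS 1(1) X'[OF 1(1)]] by simp
      next
        case 2
        have "dihedral_valid (enat n) (X s t) (X t s)"
          using X 2 unfolding cox_matrix_def by (metis)
        then show ?thesis
          unfolding 2(5) involution_act_replicate
          by (intro matrix_reflection_period finS 2 X')
      qed
    qed
  qed (rule that; assumption)
  interpret F: complex_vs ?F by (rule complex_vs_func_space)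
  have act_hom: "involution_act ?f w \<in> module_hom \<complex>\<^sub>R ?F ?F" if "w \<in> words S" for w
    using that
  proof (induction w)
    case Nil
    then show ?case by (simp add: module_hom_complex)
  next
    case (Cons l w)
    then have "?f (fst l) \<circ> involution_act ?f w \<in> module_hom \<complex>\<^sub>R ?F ?F"
      by (intro module_hom_comp[OF _ matrix_reflection_hom]) auto
    then show ?case by (simp add: comp_def)
  qed
  have "\<phi> g \<in> module_hom \<complex>\<^sub>R ?F ?F" if "g \<in> carrier (coxeter_group S m)" for g
  proof -
    have "g \<in> words S // pres_rel S (coxeter_relators S m)"
      using that by (simp add: coxeter_group_def presented_group_def)
    then obtain w where w: "w \<in> words S" "g = pres_rel S (coxeter_relators S m) `` {w}"
      by (rule quotientE)
    note hom = module_homD[OF act_hom[OF w(1)]]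
    show ?thesis
      unfolding w(2)
    proof (rule module_homI)
      show "\<phi> (pres_rel S (coxeter_relators S m) `` {w}) c \<in> carrier ?F" if "c \<in> carrier ?F" for c
        using hom(1)[OF that] \<phi>(2)[OF w(1), of c] that by (simp add: func_space_sel)
      show "\<phi> (pres_rel S (coxeter_relators S m) `` {w}) (c \<oplus>\<^bsub>?F\<^esub> d) =
          \<phi> (pres_rel S (coxeter_relators S m) `` {w}) c \<oplus>\<^bsub>?F\<^esub> \<phi> (pres_rel S (coxeter_relators S m) `` {w}) d"
        if cd: "c \<in> carrier ?F" "d \<in> carrier ?F" for c d
        using hom(2)[OF cd] \<phi>(2)[OF w(1)] cd F.M.a_closed[OF cd] by (simp add: func_space_sel(1))
      show "\<phi> (pres_rel S (coxeter_relators S m) `` {w}) (a \<odot>\<^bsub>?F\<^esub> c) =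
          a \<odot>\<^bsub>?F\<^esub> \<phi> (pres_rel S (coxeter_relators S m) `` {w}) c" if c: "c \<in> carrier ?F" for a c
        using hom(3)[OF c] \<phi>(2)[OF w(1)] c F.csmult_closed[OF c] by (simp add: func_space_sel(1))
    qed
  qed
  then have rep: "representation (coxeter_group S m) ?F \<phi>"
    using \<phi>(1) F.vectorspace_axioms by (simp add: representation_def func_space_sel(1) coxeter_group_def)
  have "\<phi> (cox_gen S m s) (func_unit S t) = func_unit S t \<oplus>\<^bsub>?F\<^esub> X s t \<odot>\<^bsub>?F\<^esub> func_unit S s"
    if st: "s \<in> S" "t \<in> S" for s t
  proof -
    have "func_unit S t \<in> S \<rightarrow>\<^sub>E UNIV" by (simp add: func_unit_def)
    then have "\<phi> (cox_gen S m s) (func_unit S t) = ?f s (func_unit S t)"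
      using \<phi>(2)[of "[(s, True)]" "func_unit S t"] st by (simp add: cox_gen_def)
    moreover have "row_form S X s (func_unit S t) = X s t"
    proof -
      have "row_form S X s (func_unit S t) = (\<Sum>v\<in>S. if v = t then X s t else 0)"
        unfolding row_form_def func_unit_def by (intro sum.cong) auto
      then show ?thesis using finS st by simp
    qed
    ultimately show ?thesis
      using st by (auto simp: matrix_reflection_def func_space_sel func_unit_def fun_eq_iff)
  qed
  then have "IR_matrix S m ?F \<phi> (func_unit S) X"
    using rep basis_family_func_space[OF finS] X' by (simp add: IR_matrix_def)
  then show ?thesis by (rule exI[of _ \<phi>])
qed

section \<open>Copies of a representation on a prescribed type\<close>

text \<open>The vector space structure is carried over along \<open>h\<close>; the ring fields
  \<open>mult\<close> and \<open>one\<close> of the record get the image of zero as a default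
  value.\<close>

definition transported_module :: "('v \<Rightarrow> 'w) \<Rightarrow> (complex, 'v) module \<Rightarrow> (complex, 'w) module" where
  "transported_module h V =
    (let g = inv_into (carrier V) h in
      \<lparr> carrier = h ` carrier V, mult = (\<lambda>x y. h \<zero>\<^bsub>V\<^esub>), one = h \<zero>\<^bsub>V\<^esub>, zero = h \<zero>\<^bsub>V\<^esub>,
        add = (\<lambda>x y. h (g x \<oplus>\<^bsub>V\<^esub> g y)), smult = (\<lambda>a x. h (a \<odot>\<^bsub>V\<^esub> g x)) \<rparr>)"

lemma transported_module:
  fixes V (structure)
  assumes V: "complex_vs V" and h: "inj_on h (carrier V)"
  shows "complex_vs (transported_module h V)" "h \<in> module_hom \<complex>\<^sub>R V (transported_module h V)"
    "bij_betw h (carrier V) (carrier (transported_module h V))"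
proof -
  interpret complex_vs V by (rule V)
  have sel: "carrier (transported_module h V) = h ` carrier V" "\<zero>\<^bsub>transported_module h V\<^esub> = h \<zero>"
    "\<And>x y. x \<in> carrier V \<Longrightarrow> y \<in> carrier V \<Longrightarrow> h x \<oplus>\<^bsub>transported_module h V\<^esub> h y = h (x \<oplus> y)"
    "\<And>a x. x \<in> carrier V \<Longrightarrow> a \<odot>\<^bsub>transported_module h V\<^esub> h x = h (a \<odot> x)"
    by (simp_all add: transported_module_def Let_def inv_into_f_f[OF h])
  show "complex_vs (transported_module h V)"
    unfolding complex_vs_iff
  proof (rule vs_criteria)
    show "\<forall>v\<in>carrier (transported_module h V). \<exists>neg_v\<in>carrier (transported_module h V).
        v \<oplus>\<^bsub>transported_module h V\<^esub> neg_v = \<zero>\<^bsub>transported_module h V\<^esub>"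
    proof
      fix v assume "v \<in> carrier (transported_module h V)"
      then obtain x where x: "x \<in> carrier V" "v = h x" by (auto simp: sel)
      then show "\<exists>neg_v\<in>carrier (transported_module h V).
          v \<oplus>\<^bsub>transported_module h V\<^esub> neg_v = \<zero>\<^bsub>transported_module h V\<^esub>"
        by (intro bexI[of _ "h (\<ominus> x)"]) (simp_all add: sel M.r_neg)
    qed
  qed (auto simp: sel class_field csmult_add_left csmult_add_right csmult_csmult csmult_one M.a_ac)
  show "h \<in> module_hom \<complex>\<^sub>R V (transported_module h V)"
    by (rule module_homI) (auto simp: sel)
  show "bij_betw h (carrier V) (carrier (transported_module h V))"
    using h by (simp add: bij_betw_def sel)
qed

text \<open>The complex numbers and their square have the same cardinality, so a bijection between
  them absorbs one more coordinate at each step.\<close>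

lemma complex_functions_inject:
  assumes "finite S"
  shows "\<exists>h :: ('s \<Rightarrow> complex) \<Rightarrow> complex. inj_on h (S \<rightarrow>\<^sub>E UNIV)"
  using assms
proof (induction S)
  case empty
  show ?case by simp
next
  case (insert s S)
  then obtain h :: "('s \<Rightarrow> complex) \<Rightarrow> complex" where h: "inj_on h (S \<rightarrow>\<^sub>E UNIV)" by blast
  have "infinite (UNIV :: complex set)"
    by (rule infinite_UNIV_char_0)
  then have "(card_of ((UNIV :: complex set) \<times> (UNIV :: complex set)), card_of (UNIV :: complex set)) \<in> ordIso"
    by (rule card_of_Times_same_infinite)
  then obtain j :: "complex \<times> complex \<Rightarrow> complex" where "bij_betw j (UNIV \<times> UNIV) UNIV"
    unfolding card_of_ordIso[symmetric] by blast
  then have j: "inj j" by (simp add: bij_betw_def)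
  have "inj_on (\<lambda>f. j (f s, h (restrict f S))) (insert s S \<rightarrow>\<^sub>E UNIV)"
  proof (rule inj_onI)
    fix f g :: "'s \<Rightarrow> complex"
    assume fg: "f \<in> insert s S \<rightarrow>\<^sub>E UNIV" "g \<in> insert s S \<rightarrow>\<^sub>E UNIV"
      and "j (f s, h (restrict f S)) = j (g s, h (restrict g S))"
    then have "f s = g s" "h (restrict f S) = h (restrict g S)"
      using injD[OF j] by blast+
    moreover from this have "restrict f S = restrict g S"
      by (intro inj_onD[OF h]) auto
    ultimately have "f x = g x" if "x \<in> insert s S" for x
      using that by (metis insertE restrict_apply')
    then show "f = g"
      using fg by (intro extensionalityI[of _ "insert s S"]) (auto simp: PiE_def)
  qed
  then show ?case by blast
qed

text \<open>The coordinate model lives on functions, whereas the representations sought live on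
  \<open>'v\<close>. Its carrier embeds through \<open>\<iota> \<circ> h\<close>, and the action is
  moved along this embedding.\<close>

lemma IR_matrix_exists:
  fixes \<iota> :: "complex \<Rightarrow> 'v"
  assumes finS: "finite S" and X: "cox_matrix S m X" and \<iota>: "inj \<iota>"
  shows "\<exists>(V :: (complex, 'v) module) \<phi> \<alpha>. IR_matrix S m V \<phi> \<alpha> X"
proof -
  let ?F = "ring.func_space \<complex>\<^sub>R S :: (complex, 'a \<Rightarrow> complex) module"
  obtain \<phi> where \<phi>: "IR_matrix S m ?F \<phi> (func_unit S) X"
    using matrix_representation[OF finS X] by blast
  note D = IR_matrixD[OF \<phi>]
  obtain h :: "('a \<Rightarrow> complex) \<Rightarrow> complex" where h: "inj_on h (S \<rightarrow>\<^sub>E UNIV)"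
    using complex_functions_inject[OF finS] by blast
  have inj: "inj_on (\<iota> \<circ> h) (carrier ?F)"
    using h \<iota> by (simp add: func_space_sel comp_inj_on inj_on_subset)
  let ?V = "transported_module (\<iota> \<circ> h) ?F"
  note T = transported_module[OF complex_vs_func_space inj]
  let ?L = "inv_into (carrier ?F) (\<iota> \<circ> h)"
  have L: "?L \<in> module_hom \<complex>\<^sub>R ?V ?F" "bij_betw ?L (carrier ?V) (carrier ?F)"
    using module_hom_inv_into[OF complex_vs_func_space T(2,3)] bij_betw_inv_into[OF T(3)] by auto
  obtain \<phi>' where \<phi>': "representation (coxeter_group S m) ?V \<phi>'"
    "\<And>g u. g \<in> carrier (coxeter_group S m) \<Longrightarrow> u \<in> carrier ?V \<Longrightarrow> ?L (\<phi>' g u) = \<phi> g (?L u)"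
  proof (rule representation_transport[OF D(1) T(1) L(1)])
    show "inj_on ?L (carrier ?V)" using L(2) by (simp add: bij_betw_def)
    show "\<phi> g (?L u) \<in> ?L ` carrier ?V" if "g \<in> carrier (coxeter_group S m)" "u \<in> carrier ?V" for g u
      using L(2) representationD(4)[OF D(1) that(1)] module_homD(1)[OF L(1) that(2)]
      by (simp add: bij_betw_def)
  qed (rule that; assumption)
  have "rep_iso (coxeter_group S m) ?V \<phi>' ?F \<phi> ?L"
    using L \<phi>' representationD(4)[OF \<phi>'(1)] by (simp add: rep_iso_def)
  from IR_matrix_image[OF \<phi> \<phi>'(1) rep_iso_sym[OF \<phi>'(1) D(1) this]]
  show ?thesis by blast
qed

section \<open>Representations of dihedral subgroups\<close>

lemma (in complex_vs) csmult_cancel_right: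
  assumes "a \<odot> v = b \<odot> v" "v \<in> carrier V" "v \<noteq> \<zero>"
  shows "a = b"
proof -
  have "(a - b) \<odot> v \<oplus> b \<odot> v = \<zero> \<oplus> b \<odot> v"
    using assms csmult_add_left[of v "a - b" b] by simp
  then have "(a - b) \<odot> v = \<zero>"
    using assms(2) by (simp add: M.a_comm[of _ "b \<odot> v"] add_left_cancel del: M.l_zero M.r_zero)
  then show ?thesis
    using csmult_eq_zero assms by fastforce
qed

lemma basis_family_nonzero:
  fixes V (structure)
  assumes "basis_family S V \<alpha>" "s \<in> S"
  shows "\<alpha> s \<noteq> \<zero>"
proof -
  note D = basis_familyD[OF assms(1)]
  interpret complex_vs V by (rule D)
  have "\<not> lin_dep (\<alpha> ` S)" using D(4) unfolding basis_def by (elim conjE)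
  then have "\<zero> \<notin> \<alpha> ` S" using vs_zero_lin_dep D(5) by blast
  then show ?thesis using assms(2) by (metis imageI)
qed

text \<open>The prescribed values determine \<open>f\<close>, so all that remains is to match the
  coefficients of the generators in the two bases. Used with all scalars 1 for W itself, and with
  arbitrary scalars for a dihedral subgroup on its plane.\<close>

lemma rep_iso_scaled_iff:
  fixes V (structure)
  assumes rep: "representation G V \<phi>" "representation G V' \<phi>'"
    and \<alpha>: "basis_family T V \<alpha>" and \<alpha>': "basis_family T V' \<alpha>'"
    and gen: "gen ` T \<subseteq> carrier G" "carrier G \<subseteq> generate G (gen ` T)"
    and X: "\<And>s t. s \<in> T \<Longrightarrow> t \<in> T \<Longrightarrow> \<phi> (gen s) (\<alpha> t) = \<alpha> t \<oplus> X s t \<odot> \<alpha> s"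
    and Y: "\<And>s t. s \<in> T \<Longrightarrow> t \<in> T \<Longrightarrow> \<phi>' (gen s) (\<alpha>' t) = \<alpha>' t \<oplus>\<^bsub>V'\<^esub> Y s t \<odot>\<^bsub>V'\<^esub> \<alpha>' s"
    and c: "\<And>s. s \<in> T \<Longrightarrow> c s \<noteq> 0"
  shows "(\<exists>f. rep_iso G V \<phi> V' \<phi>' f \<and> (\<forall>s\<in>T. f (c s \<odot> \<alpha> s) = \<alpha>' s)) \<longleftrightarrow>
    (\<forall>s\<in>T. \<forall>t\<in>T. X s t * c t = Y s t * c s)"
proof
  note B = basis_familyD[OF \<alpha>] and B' = basis_familyD[OF \<alpha>']
  interpret V: complex_vs V by (rule B)
  interpret V': complex_vs V' by (rule B')
  assume "\<exists>f. rep_iso G V \<phi> V' \<phi>' f \<and> (\<forall>s\<in>T. f (c s \<odot> \<alpha> s) = \<alpha>' s)"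
  then obtain f where f: "rep_iso G V \<phi> V' \<phi>' f" "\<And>s. s \<in> T \<Longrightarrow> f (c s \<odot> \<alpha> s) = \<alpha>' s"
    by blast
  have hom: "f \<in> module_hom \<complex>\<^sub>R V V'" using f(1) by (simp add: rep_iso_def)
  have "X s t * c t = Y s t * c s" if st: "s \<in> T" "t \<in> T" for s t
  proof -
    have g: "gen s \<in> carrier G" using gen(1) st by blast
    \<comment> \<open>The action rewritten in the rescaled vectors, whose images under
      \<open>f\<close> are known.\<close>
    have "\<phi> (gen s) (c t \<odot> \<alpha> t) = c t \<odot> \<alpha> t \<oplus> (X s t * c t / c s) \<odot> (c s \<odot> \<alpha> s)"
      using module_homD(3)[OF representationD(3)[OF rep(1) g] B(6)[OF st(2)]] X[OF st] B(6) st c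
      by (simp add: V.csmult_add_right V.csmult_csmult mult.commute)
    then have "f (\<phi> (gen s) (c t \<odot> \<alpha> t)) = \<alpha>' t \<oplus>\<^bsub>V'\<^esub> (X s t * c t / c s) \<odot>\<^bsub>V'\<^esub> \<alpha>' s"
      using B(6) st by (simp add: module_homD[OF hom] flip: f(2))
    moreover have "f (\<phi> (gen s) (c t \<odot> \<alpha> t)) = \<phi>' (gen s) (\<alpha>' t)"
      using f g B(6) st by (simp add: rep_iso_def)
    ultimately have "(X s t * c t / c s) \<odot>\<^bsub>V'\<^esub> \<alpha>' s = Y s t \<odot>\<^bsub>V'\<^esub> \<alpha>' s"
      using Y[OF st] B'(6) st by (simp add: V'.add_left_cancel)
    then have "X s t * c t / c s = Y s t"
      using B'(6) basis_family_nonzero[OF \<alpha>'] st by (intro V'.csmult_cancel_right)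
    then show ?thesis using c[OF st(1)] by (simp add: field_simps)
  qed
  then show "\<forall>s\<in>T. \<forall>t\<in>T. X s t * c t = Y s t * c s" by blast
next
  note B = basis_familyD[OF \<alpha>] and B' = basis_familyD[OF \<alpha>']
  interpret V: complex_vs V by (rule B)
  interpret V': complex_vs V' by (rule B')
  assume XY: "\<forall>s\<in>T. \<forall>t\<in>T. X s t * c t = Y s t * c s"
  \<comment> \<open>By linearity \<open>f\<close> has to send \<open>\<alpha> s\<close> to
    \<open>\<alpha>' s\<close> divided by \<open>c s\<close>, so these quotients serve as the target
    basis.\<close>
  have "basis_family T V' (\<lambda>s. inverse (c s) \<odot>\<^bsub>V'\<^esub> \<alpha>' s)"
    using \<alpha>' by (rule basis_family_rescale) (simp add: c)
  then obtain f where f: "f \<in> module_hom \<complex>\<^sub>R V V'" "bij_betw f (carrier V) (carrier V')"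
    "\<And>s. s \<in> T \<Longrightarrow> f (\<alpha> s) = inverse (c s) \<odot>\<^bsub>V'\<^esub> \<alpha>' s"
    using basis_family_iso[OF \<alpha>] by blast
  have "rep_iso G V \<phi> V' \<phi>' f"
  proof (rule rep_iso_on_generators[OF rep \<alpha> f(1,2) gen])
    fix b t assume "b \<in> gen ` T" and t: "t \<in> T"
    then obtain s where s: "s \<in> T" "b = gen s" by blast
    have g: "gen s \<in> carrier G" using gen(1) s by blast
    have "f (\<phi> (gen s) (\<alpha> t)) = inverse (c t) \<odot>\<^bsub>V'\<^esub> \<alpha>' t \<oplus>\<^bsub>V'\<^esub> (X s t * inverse (c s)) \<odot>\<^bsub>V'\<^esub> \<alpha>' s"
      using X s t B(6) B'(6) by (simp add: module_homD[OF f(1)] f(3) V'.csmult_csmult)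
    also have "X s t * inverse (c s) = inverse (c t) * Y s t"
      using XY s t c by (simp add: field_simps)
    also have "inverse (c t) \<odot>\<^bsub>V'\<^esub> \<alpha>' t \<oplus>\<^bsub>V'\<^esub> (inverse (c t) * Y s t) \<odot>\<^bsub>V'\<^esub> \<alpha>' s =
        inverse (c t) \<odot>\<^bsub>V'\<^esub> \<phi>' (gen s) (\<alpha>' t)"
      using Y[OF s(1) t] B'(6) s t by (simp add: V'.csmult_add_right V'.csmult_csmult)
    also have "\<dots> = \<phi>' (gen s) (f (\<alpha> t))"
      unfolding f(3)[OF t] by (rule module_homD(3)[OF representationD(3)[OF rep(2) g] B'(6)[OF t], symmetric])
    finally show "f (\<phi> b (\<alpha> t)) = \<phi>' b (f (\<alpha> t))"
      using s by simp
  qed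
  moreover have "f (c s \<odot> \<alpha> s) = \<alpha>' s" if "s \<in> T" for s
    using that B(6) B'(6) c by (simp add: module_homD[OF f(1)] f(3) V'.csmult_csmult V'.csmult_one)
  ultimately show "\<exists>f. rep_iso G V \<phi> V' \<phi>' f \<and> (\<forall>s\<in>T. f (c s \<odot> \<alpha> s) = \<alpha>' s)"
    by blast
qed

lemma IR_matrix_iso:
  fixes V (structure)
  assumes X: "IR_matrix S m V \<phi> \<alpha> X" and X': "IR_matrix S m V' \<phi>' \<alpha>' X"
  shows "\<exists>f. rep_iso (coxeter_group S m) V \<phi> V' \<phi>' f"
proof -
  note D = IR_matrixD[OF X] and D' = IR_matrixD[OF X']
  have gen: "cox_gen S m ` S \<subseteq> carrier (coxeter_group S m)"
    by (auto simp: cox_gen_closed)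
  have "\<exists>f. rep_iso (coxeter_group S m) V \<phi> V' \<phi>' f \<and> (\<forall>s\<in>S. f (1 \<odot> \<alpha> s) = \<alpha>' s)"
    by (rule iffD2[OF rep_iso_scaled_iff[where X = X and Y = X, OF D(1) D'(1) D(2) D'(2) gen _ D(4) D'(4)]])
      (simp_all add: generate_cox_gen)
  then show ?thesis by blast
qed

lemma IR_matrix_span_invariant:
  fixes V (structure)
  assumes X: "IR_matrix S m V \<phi> \<alpha> X" and rt: "r \<in> S" "t \<in> S" "r \<noteq> t"
    and g: "g \<in> carrier (dihedral_subgroup S m r t)" and v: "v \<in> module.span \<complex>\<^sub>R V {\<alpha> r, \<alpha> t}"
  shows "\<phi> g v \<in> module.span \<complex>\<^sub>R V {\<alpha> r, \<alpha> t}"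
proof -
  note D = IR_matrixD[OF X]
  interpret complex_vs V using D(2) by (rule basis_familyD)
  show ?thesis
  proof (rule generate_invariant[OF representationD(2)[OF D(1)], of "cox_gen S m ` {r, t}"])
    show "cox_gen S m ` {r, t} \<subseteq> carrier (coxeter_group S m)"
      using rt by (auto intro: cox_gen_closed)
    show "b \<otimes>\<^bsub>coxeter_group S m\<^esub> b = \<one>\<^bsub>coxeter_group S m\<^esub>" if b: "b \<in> cox_gen S m ` {r, t}" for b
    proof -
      obtain s where "s \<in> S" "b = cox_gen S m s"
        using b rt by blast
      then show ?thesis by (simp only: cox_gen_square)
    qed
    show "span {\<alpha> r, \<alpha> t} \<subseteq> carrier V"
      using span_is_subset2[of "{\<alpha> r, \<alpha> t}"] basis_familyD(6)[OF D(2)] rt by simp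
    show "\<phi> b v \<in> span {\<alpha> r, \<alpha> t}" if b: "b \<in> cox_gen S m ` {r, t}" and v: "v \<in> span {\<alpha> r, \<alpha> t}" for b v
    proof -
      obtain p q where pq: "v = p \<odot> \<alpha> r \<oplus> q \<odot> \<alpha> t"
        using v pair_comb(1)[OF D(2) rt] by auto
      have "\<phi> b v = (X r t * q - p) \<odot> \<alpha> r \<oplus> q \<odot> \<alpha> t \<or>
          \<phi> b v = p \<odot> \<alpha> r \<oplus> (X t r * p - q) \<odot> \<alpha> t"
        using b unfolding pq
        by (auto simp: IR_matrix_pair_left[OF X rt(1,2)] IR_matrix_pair_right[OF X rt(1,2)])
      then show ?thesis
        using pair_comb(1)[OF D(2) rt] by auto
    qed
    show "g \<in> generate (coxeter_group S m) (cox_gen S m ` {r, t})"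
      using g by (simp add: carrier_dihedral_subgroup[OF rt(1,2)])
  qed (rule v)
qed

lemma representation_subgroup_generated:
  assumes "representation G V \<phi>"
  shows "representation (subgroup_generated G B) V \<phi>"
proof -
  interpret group G using representationD(2)[OF assms] by (rule group_action_group)
  have "carrier (subgroup_generated G B) \<subseteq> carrier G"
    by (rule carrier_subgroup_generated_subset)
  then show ?thesis
    using assms group_action_subgroup_generated by (auto simp: representation_def)
qed

lemma representation_cong:
  assumes rep: "representation G V \<phi>" and eq: "\<And>g. g \<in> carrier G \<Longrightarrow> \<phi>' g = \<phi> g"
  shows "representation G V \<phi>'"
proof -
  note R = representationD[OF rep]
  interpret group G using R(2) by (rule group_action_group)
  have "group_action G (carrier V) \<phi>'"
    using group_action_extensional[OF R(2)] group_action_one[OF R(2)] R(4)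
    by (intro group_actionI) (simp_all add: eq group_action.composition_rule[OF R(2)])
  then show ?thesis
    using R(1,3) by (simp add: representation_def complex_vs_iff eq)
qed

lemma rep_iso_cong:
  assumes "\<And>g v. g \<in> carrier G \<Longrightarrow> v \<in> carrier V \<Longrightarrow> \<phi> g v = \<psi> g v"
  shows "rep_iso G V \<phi> V' \<phi>' f \<longleftrightarrow> rep_iso G V \<psi> V' \<phi>' f"
  using assms by (auto simp: rep_iso_def)

lemma dihedral_generators:
  assumes "r \<in> S" "t \<in> S"
  shows "cox_gen S m ` {r, t} \<subseteq> carrier (dihedral_subgroup S m r t)"
    "carrier (dihedral_subgroup S m r t) \<subseteq> generate (dihedral_subgroup S m r t) (cox_gen S m ` {r, t})"
proof -
  interpret group "coxeter_group S m" by (rule group_coxeter_group)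
  show sub: "cox_gen S m ` {r, t} \<subseteq> carrier (dihedral_subgroup S m r t)"
    unfolding carrier_dihedral_subgroup[OF assms] by (auto intro: generate.incl)
  have "carrier (dihedral_subgroup S m r t) =
      generate (dihedral_subgroup S m r t) (carrier (dihedral_subgroup S m r t) \<inter> cox_gen S m ` {r, t})"
    unfolding dihedral_subgroup_def
    by (simp flip: carrier_subgroup_generated)
  then show "carrier (dihedral_subgroup S m r t) \<subseteq> generate (dihedral_subgroup S m r t) (cox_gen S m ` {r, t})"
    using sub by (simp add: Int_absorb1)
qed

section \<open>Model representations of the dihedral subgroups\<close>

definition pair_matrix :: "'s \<Rightarrow> complex \<Rightarrow> complex \<Rightarrow> 's \<Rightarrow> 's \<Rightarrow> complex" where
  "pair_matrix r x y = (\<lambda>s s'. if s = s' then -2 else if s = r then x else y)"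

text \<open>The four equations of \<open>varrho2\<close> in one shape, with negation written as
  adding -2 times the vector. Extensionality in the group argument makes the representation unique
  as a function.\<close>

definition dihedral_spec ::
    "'s set \<Rightarrow> ('s \<Rightarrow> 's \<Rightarrow> enat) \<Rightarrow> 's \<Rightarrow> 's \<Rightarrow> complex \<Rightarrow> complex \<Rightarrow> 's dihedral_rep \<Rightarrow> bool" where
  "dihedral_spec S m r t x y \<phi> \<longleftrightarrow>
    \<phi> \<in> extensional (carrier (dihedral_subgroup S m r t)) \<and>
    representation (dihedral_subgroup S m r t) (pair_space r t) \<phi> \<and>
    (\<forall>s\<in>{r, t}. \<forall>s'\<in>{r, t}. \<phi> (cox_gen S m s) (func_unit {r, t} s') =
      func_unit {r, t} s' \<oplus>\<^bsub>pair_space r t\<^esub> pair_matrix r x y s s' \<odot>\<^bsub>pair_space r t\<^esub> func_unit {r, t} s)"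

lemma varrho2_eq_dihedral_spec:
  assumes "r \<noteq> t"
  shows "varrho2 S m r t x y = The (dihedral_spec S m r t x y)"
proof -
  interpret complex_vs "pair_space r t" by (rule complex_vs_func_space)
  have unit: "func_unit {r, t} s \<in> carrier (pair_space r t)" for s
    by (simp add: func_unit_def func_space_sel)
  have neg: "\<ominus>\<^bsub>pair_space r t\<^esub> func_unit {r, t} s =
      func_unit {r, t} s \<oplus>\<^bsub>pair_space r t\<^esub> (-2) \<odot>\<^bsub>pair_space r t\<^esub> func_unit {r, t} s" for s
    unfolding csmult_minus_one[OF unit] by (auto simp: func_space_sel func_unit_def fun_eq_iff)
  show ?thesis
    unfolding varrho2_def Let_def pair_basis_eq_func_unit neg
    using assms by (intro arg_cong[of _ _ The]) (auto simp: dihedral_spec_def pair_matrix_def fun_eq_iff)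
qed

text \<open>Both functions agree for generators on basis vectors, so the identity intertwines them;
  extensionality turns this into equality.\<close>

lemma dihedral_spec_unique:
  assumes rt: "r \<in> S" "t \<in> S" and spec: "dihedral_spec S m r t x y \<phi>" "dihedral_spec S m r t x y \<phi>'"
  shows "\<phi> = \<phi>'"
proof -
  let ?D = "dihedral_subgroup S m r t" and ?U = "pair_space r t"
  have rep: "representation ?D ?U \<phi>" "representation ?D ?U \<phi>'"
    using spec by (auto simp: dihedral_spec_def)
  have iso: "rep_iso ?D ?U \<phi> ?U \<phi>' (\<lambda>v. v)"
  proof (rule rep_iso_on_generators[OF rep _ _ _ dihedral_generators[OF rt]])
    show "basis_family {r, t} ?U (func_unit {r, t})"
      by (rule basis_family_func_space) simp
    show "(\<lambda>v. v) \<in> module_hom \<complex>\<^sub>R ?U ?U" by (simp add: module_hom_complex)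
    show "bij_betw (\<lambda>v. v) (carrier ?U) (carrier ?U)" by (simp add: bij_betw_def)
    show "\<phi> b (func_unit {r, t} s) = \<phi>' b (func_unit {r, t} s)"
      if "b \<in> cox_gen S m ` {r, t}" "s \<in> {r, t}" for b s
      using that spec unfolding dihedral_spec_def by fastforce
  qed
  show ?thesis
  proof (rule extensionalityI[of _ "carrier ?D"])
    show "\<phi> \<in> extensional (carrier ?D)" "\<phi>' \<in> extensional (carrier ?D)"
      using spec by (auto simp: dihedral_spec_def)
    fix g assume g: "g \<in> carrier ?D"
    show "\<phi> g = \<phi>' g"
      using group_action_extensional[OF representationD(2)[OF rep(1)] g]
        group_action_extensional[OF representationD(2)[OF rep(2)] g] iso g
      by (intro extensionalityI[of _ "carrier ?U"]) (auto simp: rep_iso_def)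
  qed
qed

lemma dihedral_valid_commute: "dihedral_valid n x y \<longleftrightarrow> dihedral_valid n y x"
  by (auto simp: dihedral_valid_def mult.commute)

text \<open>Supplies admissible entries where none are prescribed: \<open>k = 1\<close> for a finite
  bond, zero for an infinite one.\<close>

lemma dihedral_valid_exists:
  assumes "2 \<le> m"
  obtains x where "dihedral_valid m x x"
proof (cases m)
  case (enat n)
  then have "dihedral_valid m (complex_of_real (2 * cos (real 1 * pi / real n)))
      (complex_of_real (2 * cos (real 1 * pi / real n)))"
    using assms unfolding dihedral_valid_def
    by (auto simp: numeral_eq_enat power2_eq_square intro!: exI[of _ 1])
  then show ?thesis using that by blast
qed (use that[of 0] in \<open>simp add: dihedral_valid_def\<close>)

definition coxeter_type :: "'s set \<Rightarrow> ('s \<Rightarrow> 's \<Rightarrow> enat) \<Rightarrow> bool" where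
  "coxeter_type S m \<longleftrightarrow> finite S \<and> (\<forall>s\<in>S. \<forall>t\<in>S. s \<noteq> t \<longrightarrow> 2 \<le> m s t \<and> m s t = m t s)"

lemma coxeter_typeD:
  assumes "coxeter_type S m"
  shows "finite S" "s \<in> S \<Longrightarrow> t \<in> S \<Longrightarrow> s \<noteq> t \<Longrightarrow> 2 \<le> m s t"
    "s \<in> S \<Longrightarrow> t \<in> S \<Longrightarrow> s \<noteq> t \<Longrightarrow> m s t = m t s"
  using assms unfolding coxeter_type_def by blast+

text \<open>A representation of W with the given entries at \<open>r\<close> and \<open>t\<close> is
  restricted to the plane of these two generators and pulled back to functions on
  \<open>{r, t}\<close>.\<close>

lemma dihedral_spec_exists:
  assumes S: "coxeter_type S m"
    and rt: "r \<in> S" "t \<in> S" "r \<noteq> t" and valid: "dihedral_valid (m r t) x y"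
  shows "\<exists>\<phi>. dihedral_spec S m r t x y \<phi>"
proof -
  note finS = coxeter_typeD(1)[OF S]
  have m: "2 \<le> m s t \<and> m s t = m t s" if "s \<in> S" "t \<in> S" "s \<noteq> t" for s t
    using coxeter_typeD(2,3)[OF S that] by (rule conjI)
  have "\<forall>p. \<exists>z. 2 \<le> p \<longrightarrow> dihedral_valid p z z"
    using dihedral_valid_exists by metis
  then obtain z where z: "\<And>p. 2 \<le> p \<Longrightarrow> dihedral_valid p (z p) (z p)"
    by metis
  \<comment> \<open>The filler depends on the bond \<open>m s s'\<close> alone, so the entries at
    \<open>(s, s')\<close> and \<open>(s', s)\<close> coincide by symmetry of
    \<open>m\<close>.\<close>
  define X where "X = (\<lambda>s s'. if s = s' then -2 else if (s, s') = (r, t) then x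
    else if (s, s') = (t, r) then y else z (m s s'))"
  have "cox_matrix S m X"
    unfolding cox_matrix_def
  proof (intro conjI ballI impI)
    fix s s' assume s: "s \<in> S" "s' \<in> S" "s \<noteq> s'"
    consider "s = r" "s' = t" | "s = t" "s' = r" | "(s, s') \<noteq> (r, t)" "(s, s') \<noteq> (t, r)" by blast
    then show "dihedral_valid (m s s') (X s s') (X s' s)"
    proof cases
      case 1
      then show ?thesis using valid rt by (simp add: X_def)
    next
      case 2
      then have "X s s' = y" "X s' s = x" "m s s' = m r t"
        using rt m[OF rt] by (auto simp: X_def)
      then show ?thesis
        using valid dihedral_valid_commute by (simp only:)
    next
      case 3
      then have "(s', s) \<noteq> (r, t)" "(s', s) \<noteq> (t, r)"
        by blast+
      with 3 have X: "X s s' = z (m s s')" "X s' s = z (m s' s)"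
        using s(3) unfolding X_def by presburger+
      have "m s' s = m s s'"
        using m[OF s] by (rule conjunct2[THEN sym])
      moreover have "2 \<le> m s s'"
        using m[OF s] by (rule conjunct1)
      ultimately show ?thesis
        unfolding X using z by (simp only:)
    qed
  qed (simp add: X_def)
  then obtain \<Phi> where \<Phi>: "IR_matrix S m (ring.func_space \<complex>\<^sub>R S) \<Phi> (func_unit S) X"
    using matrix_representation[OF finS] by blast
  let ?F = "ring.func_space \<complex>\<^sub>R S :: (complex, 'a \<Rightarrow> complex) module"
  let ?D = "dihedral_subgroup S m r t" and ?U = "pair_space r t" and ?W = "coxeter_group S m"
  interpret F: complex_vs ?F by (rule complex_vs_func_space)
  interpret U: complex_vs ?U by (rule complex_vs_func_space)
  note D = IR_matrixD[OF \<Phi>]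
  \<comment> \<open>Extension by zero identifies the functions on \<open>{r, t}\<close> with the
    plane spanned by the unit vectors of \<open>r\<close> and \<open>t\<close>.\<close>
  define L where "L = (\<lambda>f :: 'a \<Rightarrow> complex. \<lambda>s\<in>S. if s \<in> {r, t} then f s else 0)"
  have L_hom: "L \<in> module_hom \<complex>\<^sub>R ?U ?F"
    by (rule module_homI) (auto simp: L_def func_space_sel fun_eq_iff)
  have L_val: "L f s = f s" if "s \<in> {r, t}" for f s
    using that rt by (auto simp: L_def)
  have L_inj: "inj_on L (carrier ?U)"
  proof (rule inj_onI)
    fix f g assume fg: "f \<in> carrier ?U" "g \<in> carrier ?U" "L f = L g"
    show "f = g"
    proof (rule extensionalityI[of _ "{r, t}"])
      show "f \<in> extensional {r, t}" "g \<in> extensional {r, t}"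
        using fg(1,2) by (simp_all add: func_space_sel PiE_def)
      show "f s = g s" if "s \<in> {r, t}" for s
        using L_val[OF that, of f] L_val[OF that, of g] fg(3) by simp
    qed
  qed
  have L_pair: "L f = f r \<odot>\<^bsub>?F\<^esub> func_unit S r \<oplus>\<^bsub>?F\<^esub> f t \<odot>\<^bsub>?F\<^esub> func_unit S t" for f
    using rt by (auto simp: L_def func_space_sel func_unit_def fun_eq_iff)
  have L_image: "L ` carrier ?U = module.span \<complex>\<^sub>R ?F {func_unit S r, func_unit S t}"
    unfolding pair_comb(1)[OF D(2) rt]
  proof (intro equalityI subsetI)
    fix v assume "v \<in> {p \<odot>\<^bsub>?F\<^esub> func_unit S r \<oplus>\<^bsub>?F\<^esub> q \<odot>\<^bsub>?F\<^esub> func_unit S t | p q. True}"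
    then obtain p q where "v = p \<odot>\<^bsub>?F\<^esub> func_unit S r \<oplus>\<^bsub>?F\<^esub> q \<odot>\<^bsub>?F\<^esub> func_unit S t"
      by blast
    then have v: "v = L (\<lambda>s\<in>{r, t}. if s = r then p else q)"
      unfolding L_pair using rt by simp
    show "v \<in> L ` carrier ?U"
      unfolding v by (rule imageI) (auto simp: func_space_sel PiE_def extensional_def)
  qed (use L_pair in blast)
  have inv: "\<Phi> g (L f) \<in> L ` carrier ?U" if "g \<in> carrier ?D" "f \<in> carrier ?U" for g f
    using IR_matrix_span_invariant[OF \<Phi> rt that(1), of "L f"] imageI[OF that(2), of L]
    unfolding L_image by blast
  have repD: "representation ?D ?F \<Phi>"
    unfolding dihedral_subgroup_def using D(1) by (rule representation_subgroup_generated)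
  obtain \<phi> where \<phi>: "representation ?D ?U \<phi>"
    "\<And>g f. g \<in> carrier ?D \<Longrightarrow> f \<in> carrier ?U \<Longrightarrow> L (\<phi> g f) = \<Phi> g (L f)"
    by (rule representation_transport[where \<phi> = \<Phi>, OF repD U.complex_vs_axioms L_hom L_inj inv])
      (assumption | rule that)+
  have unit: "func_unit {r, t} s \<in> carrier ?U" for s
    by (simp add: func_unit_def func_space_sel)
  have L_unit: "L (func_unit {r, t} s) = func_unit S s" if "s \<in> {r, t}" for s
    using that rt by (auto simp: L_def func_unit_def fun_eq_iff)
  have gens: "cox_gen S m s \<in> carrier ?D" if "s \<in> {r, t}" for s
    using that dihedral_generators(1)[OF rt(1,2), of m] by blast
  have "\<phi> (cox_gen S m s) (func_unit {r, t} s') =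
      func_unit {r, t} s' \<oplus>\<^bsub>?U\<^esub> pair_matrix r x y s s' \<odot>\<^bsub>?U\<^esub> func_unit {r, t} s"
    if s: "s \<in> {r, t}" "s' \<in> {r, t}" for s s'
  proof (rule inj_onD[OF L_inj])
    have "X s s' = pair_matrix r x y s s'"
      using s rt by (auto simp: X_def pair_matrix_def)
    moreover have "\<Phi> (cox_gen S m s) (func_unit S s') =
        func_unit S s' \<oplus>\<^bsub>?F\<^esub> X s s' \<odot>\<^bsub>?F\<^esub> func_unit S s"
      using s rt by (intro D(4)) auto
    ultimately show "L (\<phi> (cox_gen S m s) (func_unit {r, t} s')) =
        L (func_unit {r, t} s' \<oplus>\<^bsub>?U\<^esub> pair_matrix r x y s s' \<odot>\<^bsub>?U\<^esub> func_unit {r, t} s)"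
      using unit s gens by (simp add: \<phi>(2) module_homD[OF L_hom] L_unit)
    show "\<phi> (cox_gen S m s) (func_unit {r, t} s') \<in> carrier ?U"
      using representationD(4)[OF \<phi>(1) gens[OF s(1)] unit] .
  qed (use unit in simp)
  \<comment> \<open>Restricting to the subgroup supplies extensionality without changing any value
    that matters.\<close>
  then have "dihedral_spec S m r t x y (restrict \<phi> (carrier ?D))"
    using \<phi>(1) gens by (auto simp: dihedral_spec_def intro: representation_cong)
  then show ?thesis
    by (rule exI[of _ "restrict \<phi> (carrier ?D)"])
qed

lemma varrho2_spec:
  assumes "coxeter_type S m" "r \<in> S" "t \<in> S" "r \<noteq> t" "dihedral_valid (m r t) x y"
  shows "dihedral_spec S m r t x y (varrho2 S m r t x y)"
proof -
  obtain \<phi> where \<phi>: "dihedral_spec S m r t x y \<phi>"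
    using dihedral_spec_exists[OF assms] by (rule exE)
  show ?thesis
    unfolding varrho2_eq_dihedral_spec[OF assms(4)]
    by (rule theI[of "dihedral_spec S m r t x y", OF \<phi>]) (rule dihedral_spec_unique[OF assms(2,3) _ \<phi>])
qed

text \<open>Model representations are compared as functions and not up to isomorphism, so the
  coefficients can be read off from the action of each generator on the other basis vector.\<close>

lemma varrho2_inject:
  assumes S: "coxeter_type S m" and rt: "r \<in> S" "t \<in> S" "r \<noteq> t"
    and valid: "dihedral_valid (m r t) x y" "dihedral_valid (m r t) x' y'"
  shows "varrho2 S m r t x y = varrho2 S m r t x' y' \<longleftrightarrow> x = x' \<and> y = y'"
proof
  assume eq: "varrho2 S m r t x y = varrho2 S m r t x' y'"
  let ?U = "pair_space r t"
  have spec: "dihedral_spec S m r t x y (varrho2 S m r t x y)" "dihedral_spec S m r t x' y' (varrho2 S m r t x y)"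
    using varrho2_spec[OF S rt valid(1)] varrho2_spec[OF S rt valid(2)] unfolding eq by (simp_all only:)
  have "func_unit {r, t} s' \<oplus>\<^bsub>?U\<^esub> pair_matrix r x y s s' \<odot>\<^bsub>?U\<^esub> func_unit {r, t} s =
      func_unit {r, t} s' \<oplus>\<^bsub>?U\<^esub> pair_matrix r x' y' s s' \<odot>\<^bsub>?U\<^esub> func_unit {r, t} s"
    if "s \<in> {r, t}" "s' \<in> {r, t}" for s s'
    using spec[unfolded dihedral_spec_def, THEN conjunct2, THEN conjunct2, THEN bspec, OF that(1),
        THEN bspec, OF that(2)] by (simp only:)
  from fun_cong[OF this[of r t], of r] fun_cong[OF this[of t r], of t] show "x = x' \<and> y = y'"
    using rt by (simp add: func_space_sel func_unit_def pair_matrix_def)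
qed simp

text \<open>An equality of functions, possible because both sides act on functions on the same
  unordered pair.\<close>

lemma varrho2_commute: "varrho2 S m r t x y = varrho2 S m t r y x"
  unfolding varrho2_def Let_def pair_basis_eq_func_unit
  by (intro arg_cong[of _ _ The])
    (auto simp: fun_eq_iff dihedral_subgroup_commute[of S m t r] insert_commute[of t r])

section \<open>Normal forms of the coefficients\<close>

text \<open>Replaces the members of \<open>dihedral_params\<close> by their pairs of coefficients,
  turning statements about representations into statements about numbers.\<close>

definition dihedral_coeffs :: "(complex \<Rightarrow> complex) \<Rightarrow> enat \<Rightarrow> (complex \<times> complex) set" where
  "dihedral_coeffs u m =
    (case m of
       enat n \<Rightarrow> {(c, c) | c k. 1 \<le> k \<and> 2 * k \<le> n \<and> c = complex_of_real (2 * cos (real k * pi / real n))}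
     | \<infinity> \<Rightarrow> {(1, 0), (0, 1)} \<union> range (\<lambda>z. (u z, u z)))"

lemma dihedral_params_eq:
  "dihedral_params S m u r t = (\<lambda>(x, y). varrho2 S m r t x y) ` dihedral_coeffs u (m r t)"
proof (cases "m r t")
  case (enat n)
  let ?c = "\<lambda>k. complex_of_real (2 * cos (real k * pi / real n))"
  have "dihedral_coeffs u (m r t) = (\<lambda>k. (?c k, ?c k)) ` {k. 1 \<le> k \<and> 2 * k \<le> n}"
    unfolding dihedral_coeffs_def enat enat.case by blast
  moreover have "dihedral_params S m u r t = (\<lambda>k. varrho2 S m r t (?c k) (?c k)) ` {k. 1 \<le> k \<and> 2 * k \<le> n}"
    unfolding dihedral_params_def rho_def enat enat.case the_enat.simps Let_def by (simp only: image_Collect)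
  ultimately show ?thesis
    by (simp only: image_image prod.case)
next
  case infinity
  show ?thesis
    unfolding dihedral_params_def dihedral_coeffs_def infinity
    by (simp add: image_Un image_image varrho_def)
qed

lemma dihedral_coeffs_enatE:
  assumes "(x, y) \<in> dihedral_coeffs u (enat n)"
  obtains k where "1 \<le> k" "2 * k \<le> n" "x = complex_of_real (2 * cos (real k * pi / real n))" "y = x"
  using assms unfolding dihedral_coeffs_def by auto

lemma dihedral_coeffs_infinityE:
  assumes "(x, y) \<in> dihedral_coeffs u \<infinity>"
  obtains "x = 1" "y = 0" | "x = 0" "y = 1" | z where "x = u z" "y = u z"
  using assms unfolding dihedral_coeffs_def by auto

lemma dihedral_coeffs_valid:
  assumes "(x, y) \<in> dihedral_coeffs u m"
  shows "dihedral_valid m x y"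
proof (cases m)
  case (enat n)
  from assms[unfolded enat] show ?thesis
  proof (rule dihedral_coeffs_enatE)
    fix k assume k: "1 \<le> k" "2 * k \<le> n" and x: "x = complex_of_real (2 * cos (real k * pi / real n))" "y = x"
    have "x * y = complex_of_real ((2 * cos (real k * pi / real n))\<^sup>2)"
      unfolding x by (simp add: power2_eq_square)
    then show ?thesis
      unfolding dihedral_valid_def enat using k x(2) by blast
  qed
qed (simp add: dihedral_valid_def)

lemma dihedral_coeffs_swap: "(x, y) \<in> dihedral_coeffs u m \<Longrightarrow> (y, x) \<in> dihedral_coeffs u m"
  unfolding dihedral_coeffs_def by (cases m) auto

lemma square_root_zero:
  assumes "\<And>z. (u z)\<^sup>2 = (z :: complex)"
  shows "u z = 0 \<longleftrightarrow> z = 0"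
  using assms[of z] by auto

text \<open>The scalars \<open>a\<close> and \<open>b\<close> rescale the two basis vectors, which
  preserves the product and the vanishing of each entry. With both entries nonzero, \<open>c\<close>
  is a square root of the product, and \<open>a = x\<close>, \<open>b = c\<close> solve both
  equations.\<close>

lemma dihedral_normal_form:
  assumes u: "\<And>z. (u z)\<^sup>2 = z" and valid: "dihedral_valid m x y"
  shows "\<exists>x' y' a b. (x', y') \<in> dihedral_coeffs u m \<and> a \<noteq> 0 \<and> b \<noteq> 0 \<and> x * b = x' * a \<and> y * a = y' * b"
proof (cases m)
  case (enat n)
  then obtain k where k: "1 \<le> k" "2 * k \<le> n" and zero: "x = 0 \<longleftrightarrow> y = 0"
    and xy: "x * y = complex_of_real ((2 * cos (real k * pi / real n))\<^sup>2)"
    using valid unfolding dihedral_valid_def by blast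
  define c where "c = complex_of_real (2 * cos (real k * pi / real n))"
  have c: "(c, c) \<in> dihedral_coeffs u m"
    unfolding dihedral_coeffs_def enat c_def using k by auto
  have xy': "x * y = c * c"
    unfolding xy c_def by (simp add: power2_eq_square)
  show ?thesis
  proof (cases "x = 0")
    case True
    then have "y = 0" "c = 0" using zero xy' by auto
    then show ?thesis
      using c True by (intro exI[of _ c] exI[of _ c] exI[of _ 1] exI[of _ 1]) simp
  next
    case False
    then have "c \<noteq> 0" using zero xy' by auto
    then show ?thesis
      using c False xy' by (intro exI[of _ c] exI[of _ c] exI[of _ x] exI[of _ c]) (simp add: mult.commute)
  qed
next
  case infinity
  have mem: "(u z, u z) \<in> dihedral_coeffs u m" "(1, 0) \<in> dihedral_coeffs u m" "(0, 1) \<in> dihedral_coeffs u m" for z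
    by (simp_all add: dihedral_coeffs_def infinity)
  \<comment> \<open>The four vanishing patterns correspond to \<open>u 0\<close>, to the two
    one-sided representations, and to \<open>u z\<close> with \<open>z \<noteq> 0\<close>.\<close>
  consider "x = 0" "y = 0" | "x \<noteq> 0" "y = 0" | "x = 0" "y \<noteq> 0" | "x \<noteq> 0" "y \<noteq> 0" by blast
  then show ?thesis
  proof cases
    case 1
    then show ?thesis
      using mem(1)[of 0] square_root_zero[OF u, of 0]
      by (intro exI[of _ "u 0"] exI[of _ "u 0"] exI[of _ 1] exI[of _ 1]) simp
  next
    case 2
    then show ?thesis
      using mem(2) by (intro exI[of _ 1] exI[of _ 0] exI[of _ x] exI[of _ 1]) simp
  next
    case 3
    then show ?thesis
      using mem(3) by (intro exI[of _ 0] exI[of _ 1] exI[of _ 1] exI[of _ y]) simp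
  next
    case 4
    define c where "c = u (x * y)"
    have "c * c = x * y" using u[of "x * y"] by (simp add: c_def power2_eq_square)
    moreover have "c \<noteq> 0" using square_root_zero[OF u] 4 by (simp add: c_def)
    ultimately show ?thesis
      using mem(1)[of "x * y"] 4
      by (intro exI[of _ c] exI[of _ c] exI[of _ x] exI[of _ c]) (simp add: mult.commute c_def)
  qed
qed

text \<open>The product and the vanishing pattern are invariants of rescaling, and they determine
  the normal form: a nonnegative cosine is determined by its square, and so is \<open>u z\<close>,
  whose square is \<open>z\<close>.\<close>

lemma dihedral_normal_form_unique:
  assumes u: "\<And>z. (u z)\<^sup>2 = z"
    and c: "(x, y) \<in> dihedral_coeffs u m" "(x', y') \<in> dihedral_coeffs u m"
    and nz: "a \<noteq> 0" "b \<noteq> 0" "a' \<noteq> 0" "b' \<noteq> 0"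
    and eq: "X * b = x * a" "Y * a = y * b" "X * b' = x' * a'" "Y * a' = y' * b'"
  shows "x = x' \<and> y = y'"
proof -
  have zero: "x = 0 \<longleftrightarrow> x' = 0" "y = 0 \<longleftrightarrow> y' = 0"
    using eq nz by (metis mult_eq_0_iff)+
  have "(X * Y) * (a * b) = (x * y) * (a * b)" "(X * Y) * (a' * b') = (x' * y') * (a' * b')"
    using eq by (metis mult.assoc mult.commute)+
  then have prod: "x * y = x' * y'"
    using nz by simp
  show ?thesis
  proof (cases m)
    case (enat n)
    obtain k where k: "1 \<le> k" "2 * k \<le> n" "x = complex_of_real (2 * cos (real k * pi / real n))" "y = x"
      using c(1)[unfolded enat] by (rule dihedral_coeffs_enatE)
    obtain k' where k': "1 \<le> k'" "2 * k' \<le> n" "x' = complex_of_real (2 * cos (real k' * pi / real n))" "y' = x'"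
      using c(2)[unfolded enat] by (rule dihedral_coeffs_enatE)
    have "complex_of_real ((2 * cos (real k * pi / real n))\<^sup>2) = complex_of_real ((2 * cos (real k' * pi / real n))\<^sup>2)"
      using prod unfolding k(3,4) k'(3,4) by (simp add: power2_eq_square)
    then have "(2 * cos (real k * pi / real n))\<^sup>2 = (2 * cos (real k' * pi / real n))\<^sup>2"
      by (simp only: of_real_eq_iff)
    then have "2 * cos (real k * pi / real n) = 2 * cos (real k' * pi / real n)"
      by (rule power2_eq_imp_eq) (use cos_param_bounds(4)[OF k(1,2)] cos_param_bounds(4)[OF k'(1,2)] in simp_all)
    then show ?thesis
      unfolding k(3,4) k'(3,4) by simp
  next
    case infinity
    have inj: "u z = u z'" if "u z * u z = u z' * u z'" for z z'
      using that u[of z] u[of z'] by (simp add: power2_eq_square)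
    show ?thesis
      using c[unfolded infinity]
      by (elim dihedral_coeffs_infinityE) (use zero prod inj in auto)
  qed
qed

lemma cos_param_inject:
  assumes "1 \<le> k" "2 * k \<le> n" "1 \<le> k'" "2 * k' \<le> n'" "cos (real k * pi / real n) = cos (real k' * pi / real n')"
  shows "k * n' = k' * n"
proof -
  note b = cos_param_bounds[OF assms(1,2)] cos_param_bounds[OF assms(3,4)]
  have "real k * pi / real n = real k' * pi / real n'"
    by (rule cos_inj_pi) (use b pi_gt_zero assms(5) in linarith)+
  moreover have "0 < n" "0 < n'" using assms by linarith+
  ultimately have "real k * real n' = real k' * real n"
    by (simp add: field_simps)
  then show ?thesis
    by (simp only: of_nat_mult[symmetric] of_nat_eq_iff)
qed

text \<open>The label 2 is exactly the case of vanishing coefficients. For a finite bond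
  \<open>n div gcd n k = 2\<close> means \<open>2 * k = n\<close>, the zero of the cosine; for an
  infinite bond every cosine parameter has \<open>n > 2 * k\<close> and a nonzero cosine.\<close>

lemma mtilde_edge:
  assumes S: "coxeter_type S m" and u: "\<And>z. (u z)\<^sup>2 = z"
    and rt: "r \<in> S" "t \<in> S" "r \<noteq> t"
    and c: "(x, y) \<in> dihedral_coeffs u (m r t)" and \<delta>: "\<delta> (r, t) = varrho2 S m r t x y"
  shows "3 \<le> mtilde S m u \<delta> r t \<longleftrightarrow> x \<noteq> 0 \<or> y \<noteq> 0"
proof (cases "m r t")
  case (enat n)
  let ?c = "\<lambda>k. complex_of_real (2 * cos (real k * pi / real n))"
  obtain k where k: "1 \<le> k" "2 * k \<le> n" "x = ?c k" "y = x"
    using c[unfolded enat] by (rule dihedral_coeffs_enatE)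
  have mem: "(?c j, ?c j) \<in> dihedral_coeffs u (m r t)" if "1 \<le> j" "2 * j \<le> n" for j
    using that by (auto simp: dihedral_coeffs_def enat)
  have rho: "rho S m r t j = varrho2 S m r t (?c j) (?c j)" for j
    by (simp add: rho_def enat Let_def)
  \<comment> \<open>The index \<open>k\<close> is recovered from \<delta>, so the description
    operator in \<open>mtilde\<close> has a unique witness.\<close>
  have uniq: "j = k" if j: "1 \<le> j" "2 * j \<le> n" and "\<delta> (r, t) = rho S m r t j" for j
  proof -
    have "?c k = ?c j"
      using that(3) varrho2_inject[OF S rt dihedral_coeffs_valid[OF mem[OF k(1,2)]]
          dihedral_coeffs_valid[OF mem[OF j]]]
      unfolding \<delta> rho k(3,4) by blast
    then have "cos (real k * pi / real n) = cos (real j * pi / real n)"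
      unfolding of_real_eq_iff by simp
    from cos_param_inject[OF k(1,2) j this] show "j = k"
      using k by simp
  qed
  have "(THE j. 1 \<le> j \<and> 2 * j \<le> n \<and> \<delta> (r, t) = rho S m r t j) = k"
  proof (rule the_equality)
    have "\<delta> (r, t) = rho S m r t k"
      unfolding \<delta> rho k(4) k(3) ..
    then show "1 \<le> k \<and> 2 * k \<le> n \<and> \<delta> (r, t) = rho S m r t k"
      using k(1,2) by (intro conjI)
    show "j = k" if "1 \<le> j \<and> 2 * j \<le> n \<and> \<delta> (r, t) = rho S m r t j" for j
      using that by (elim conjE) (rule uniq)
  qed
  then have mt: "mtilde S m u \<delta> r t = enat (n div gcd n k)"
    by (simp add: mtilde_def enat)
  have "3 \<le> n div gcd n k \<longleftrightarrow> 2 * k \<noteq> n"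
  proof
    assume "3 \<le> n div gcd n k"
    moreover have "(2 * k) div gcd (2 * k) k = 2" using k(1) by simp
    ultimately show "2 * k \<noteq> n" by auto
  next
    assume ne: "2 * k \<noteq> n"
    define g where "g = gcd n k"
    have g: "0 < g" "g dvd n" "g dvd k" using k(1) by (auto simp: g_def)
    obtain n' k' where nk: "n = g * n'" "k = g * k'" using g by (auto elim!: dvdE)
    have "g * (2 * k') < g * n'" "0 < g * k'"
      using ne k nk by auto
    then have "2 * k' < n'" "0 < k'" by auto
    moreover have "n div g = n'"
      unfolding nk(1) using g(1) by simp
    ultimately show "3 \<le> n div gcd n k"
      unfolding g_def[symmetric] by simp
  qed
  moreover have "x \<noteq> 0 \<or> y \<noteq> 0 \<longleftrightarrow> 2 * k \<noteq> n"
    unfolding k(3,4) using cos_param_bounds(5)[OF k(1,2)] by simp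
  ultimately show ?thesis
    unfolding mt by (simp add: numeral_eq_enat)
next
  case infinity
  have inj: "varrho2 S m r t x y = varrho2 S m r t x' y' \<longleftrightarrow> x = x' \<and> y = y'" for x' y'
    by (rule varrho2_inject[OF S rt]) (simp_all add: dihedral_valid_def infinity)
  let ?z = "\<lambda>k n. complex_of_real (4 * (cos (real k * pi / real n))\<^sup>2)"
  have cosp: "is_cos_param S m u \<delta> r t n \<longleftrightarrow>
      (\<exists>k. coprime k n \<and> 1 \<le> k \<and> 2 * k < n \<and> x = u (?z k n) \<and> y = u (?z k n))" for n
    unfolding is_cos_param_def \<delta> varrho_def inj ..
  have \<delta>0: "\<delta> (r, t) = varrho S m u r t 0 \<longleftrightarrow> x = 0 \<and> y = 0"
    unfolding \<delta> varrho_def inj using square_root_zero[OF u, of 0] by simp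
  show ?thesis
  proof (cases "\<exists>n. is_cos_param S m u \<delta> r t n")
    case True
    then obtain n k where n: "is_cos_param S m u \<delta> r t n"
      and k: "coprime k n" "1 \<le> k" "2 * k < n" "x = u (?z k n)"
      unfolding cosp by blast
    \<comment> \<open>Equal cosines mean equal fractions \<open>k / n\<close> and
      \<open>k' / n'\<close>; both are in lowest terms, so their denominators agree.\<close>
    have "n' = n" if n': "is_cos_param S m u \<delta> r t n'" for n'
    proof -
      obtain k' where k': "coprime k' n'" "1 \<le> k'" "2 * k' < n'" "x = u (?z k' n')"
        using n' unfolding cosp by blast
      have "?z k n = ?z k' n'"
        using k(4) k'(4) u by metis
      then have "(cos (real k * pi / real n))\<^sup>2 = (cos (real k' * pi / real n'))\<^sup>2"
        unfolding of_real_eq_iff by simp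
      then have "cos (real k * pi / real n) = cos (real k' * pi / real n')"
        by (rule power2_eq_imp_eq)
          (use cos_param_bounds(4)[of k n] cos_param_bounds(4)[of k' n'] k k' in simp_all)
      then have "k * n' = k' * n"
        using k k' by (intro cos_param_inject) simp_all
      then have "n dvd k * n'" "n' dvd k' * n"
        by (metis dvd_triv_right)+
      then have "n dvd n'" "n' dvd n"
        using k(1) k'(1) by (simp_all add: coprime_dvd_mult_right_iff coprime_commute)
      then show ?thesis by (rule dvd_antisym[rotated])
    qed
    then have "(THE n. is_cos_param S m u \<delta> r t n) = n"
      using n by (intro the_equality)
    then have "mtilde S m u \<delta> r t = enat n"
      using True by (simp add: mtilde_def infinity)
    moreover have "x \<noteq> 0"
      unfolding k(4) square_root_zero[OF u] using cos_param_bounds(5)[of k n] k by simp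
    ultimately show ?thesis
      using k by (simp add: numeral_eq_enat)
  next
    case False
    then have "mtilde S m u \<delta> r t = (if x = 0 \<and> y = 0 then 2 else \<infinity>)"
      unfolding mtilde_def infinity enat.case \<delta>0 by (rule if_not_P)
    then show ?thesis by (simp add: numeral_eq_enat)
  qed
qed

section \<open>Data attached to a matrix\<close>

text \<open>Either entry may be the nonzero one: the one-sided representations of an infinite bond
  also give edges.\<close>

definition coeff_edges :: "'s set \<Rightarrow> ('s \<Rightarrow> 's \<Rightarrow> complex) \<Rightarrow> ('s \<times> 's) set" where
  "coeff_edges S x = {(r, t). r \<in> S \<and> t \<in> S \<and> r \<noteq> t \<and> (x r t \<noteq> 0 \<or> x t r \<noteq> 0)}"

definition normal_coeffs ::
    "'s set \<Rightarrow> ('s \<Rightarrow> 's \<Rightarrow> enat) \<Rightarrow> (complex \<Rightarrow> complex) \<Rightarrow> ('s \<Rightarrow> 's \<Rightarrow> complex) \<Rightarrow> bool" where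
  "normal_coeffs S m u x \<longleftrightarrow>
    (\<forall>r\<in>S. \<forall>t\<in>S. r \<noteq> t \<longrightarrow> (x r t, x t r) \<in> dihedral_coeffs u (m r t))"

definition coeff_delta ::
    "'s set \<Rightarrow> ('s \<Rightarrow> 's \<Rightarrow> enat) \<Rightarrow> ('s \<Rightarrow> 's \<Rightarrow> complex) \<Rightarrow> 's \<times> 's \<Rightarrow> 's dihedral_rep" where
  "coeff_delta S m x = (\<lambda>(r, t)\<in>off_diagonal S. varrho2 S m r t (x r t) (x t r))"

text \<open>The numerical content of \<open>is_attached\<close>. The equations for
  \<open>(r, t)\<close> and \<open>(t, r)\<close> together say that the rescaled vectors have
  coefficients \<open>x r t\<close> and \<open>x t r\<close>.\<close>

definition matrix_attached ::
    "'s set \<Rightarrow> ('s \<Rightarrow> 's \<Rightarrow> complex) \<Rightarrow> ('s \<Rightarrow> 's \<Rightarrow> complex) \<Rightarrow> (('s \<times> 's \<Rightarrow> int) \<Rightarrow> complex) \<Rightarrow>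
     ('s \<Rightarrow> 's \<Rightarrow> complex) \<Rightarrow> (('s \<times> 's \<Rightarrow> int) \<Rightarrow> complex) \<Rightarrow> bool" where
  "matrix_attached S X x \<chi> a \<psi> \<longleftrightarrow>
    (\<forall>r\<in>S. \<forall>t\<in>S. r \<noteq> t \<longrightarrow> a r t \<noteq> 0 \<and> X r t * a t r = x r t * a r t) \<and>
    \<psi> \<in> hom (chain_group (coeff_edges S x)) (units_of \<complex>\<^sub>R) \<and>
    (\<forall>(r, t)\<in>coeff_edges S x. \<psi> (oriented_edge r t) = a t r / a r t) \<and>
    \<chi> = restrict \<psi> (carrier (H1_group S (coeff_edges S x)))"

lemma normal_coeffsD:
  "normal_coeffs S m u x \<Longrightarrow> r \<in> S \<Longrightarrow> t \<in> S \<Longrightarrow> r \<noteq> t \<Longrightarrow> (x r t, x t r) \<in> dihedral_coeffs u (m r t)"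
  unfolding normal_coeffs_def by blast

lemma matrix_attachedD:
  assumes "matrix_attached S X x \<chi> a \<psi>"
  shows "r \<in> S \<Longrightarrow> t \<in> S \<Longrightarrow> r \<noteq> t \<Longrightarrow> a r t \<noteq> 0"
    "r \<in> S \<Longrightarrow> t \<in> S \<Longrightarrow> r \<noteq> t \<Longrightarrow> X r t * a t r = x r t * a r t"
    "\<psi> \<in> hom (chain_group (coeff_edges S x)) (units_of \<complex>\<^sub>R)"
    "(r, t) \<in> coeff_edges S x \<Longrightarrow> \<psi> (oriented_edge r t) = a t r / a r t"
    "\<chi> = restrict \<psi> (carrier (H1_group S (coeff_edges S x)))"
  using assms unfolding matrix_attached_def by blast+

lemma coeff_edgesD:
  assumes "(r, t) \<in> coeff_edges S x"
  shows "r \<in> S" "t \<in> S" "r \<noteq> t" "x r t \<noteq> 0 \<or> x t r \<noteq> 0"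
  using assms unfolding coeff_edges_def by blast+

lemma chain_graph_coeff_edges: "finite S \<Longrightarrow> chain_graph S (coeff_edges S x)"
  unfolding chain_graph_def coeff_edges_def sym_def irrefl_def by blast

lemma coeff_edges_cong:
  assumes "\<And>r t. r \<in> S \<Longrightarrow> t \<in> S \<Longrightarrow> r \<noteq> t \<Longrightarrow> x r t = x' r t"
  shows "coeff_edges S x = coeff_edges S x'"
proof -
  have "(r \<in> S \<and> t \<in> S \<and> r \<noteq> t \<and> (x r t \<noteq> 0 \<or> x t r \<noteq> 0)) =
      (r \<in> S \<and> t \<in> S \<and> r \<noteq> t \<and> (x' r t \<noteq> 0 \<or> x' t r \<noteq> 0))" for r t
    using assms[of r t] assms[of t r] by metis
  then show ?thesis unfolding coeff_edges_def by blast
qed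

text \<open>One normal form is chosen for every unordered pair, sorted through \<open>idx\<close>,
  because the values of \<open>x\<close> and \<open>a\<close> at \<open>(r, t)\<close> and
  \<open>(t, r)\<close> must come from the same choice.\<close>

lemma matrix_attached_exists:
  assumes S: "coxeter_type S m" and u: "\<And>z. (u z)\<^sup>2 = z" and X: "cox_matrix S m X"
  obtains x \<chi> a \<psi> where "normal_coeffs S m u x" "matrix_attached S X x \<chi> a \<psi>"
proof -
  note finS = coxeter_typeD(1)[OF S]
  obtain idx :: "'a \<Rightarrow> nat" where idx: "inj_on idx S"
    using finite_imp_inj_to_nat_seg[OF finS] by auto
  define Q where "Q = (\<lambda>r t (x', y', a, b). (x', y') \<in> dihedral_coeffs u (m r t) \<and>
      a \<noteq> 0 \<and> b \<noteq> 0 \<and> X r t * b = x' * a \<and> X t r * a = y' * b)"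
  define P where "P = (\<lambda>r t. SOME p. Q r t p)"
  have P: "Q r t (P r t)" if "r \<in> S" "t \<in> S" "r \<noteq> t" for r t
  proof -
    have "dihedral_valid (m r t) (X r t) (X t r)"
      using X that unfolding cox_matrix_def by blast
    from dihedral_normal_form[OF u this] obtain x' y' a b where
      "(x', y') \<in> dihedral_coeffs u (m r t) \<and> a \<noteq> 0 \<and> b \<noteq> 0 \<and> X r t * b = x' * a \<and> X t r * a = y' * b"
      by (elim exE) (rule that)
    then have "Q r t (x', y', a, b)"
      unfolding Q_def prod.case .
    then show ?thesis
      unfolding P_def by (rule someI)
  qed
  \<comment> \<open>For a pair in descending order, the second coefficient of the sorted pair is
    taken, and likewise the second scalar for \<open>a\<close>.\<close>
  define x where "x = (\<lambda>r t. if idx r < idx t then fst (P r t) else fst (snd (P t r)))"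
  define a where "a = (\<lambda>r t. if idx r < idx t then fst (snd (snd (P r t))) else snd (snd (snd (P t r))))"
  have sorted: "(x r t, x t r) \<in> dihedral_coeffs u (m r t) \<and> a r t \<noteq> 0 \<and> a t r \<noteq> 0 \<and>
      X r t * a t r = x r t * a r t \<and> X t r * a r t = x t r * a t r"
    if "r \<in> S" "t \<in> S" "idx r < idx t" for r t
  proof -
    have "r \<noteq> t" using that by blast
    from P[OF that(1,2) this] that(3) show ?thesis
      by (simp add: x_def a_def Q_def case_prod_beta)
  qed
  have all: "(x r t, x t r) \<in> dihedral_coeffs u (m r t) \<and> a r t \<noteq> 0 \<and> X r t * a t r = x r t * a r t"
    if rt: "r \<in> S" "t \<in> S" "r \<noteq> t" for r t
  proof (cases "idx r < idx t")
    case True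
    then show ?thesis using sorted[OF rt(1,2)] by blast
  next
    case False
    have "idx r \<noteq> idx t"
      using inj_onD[OF idx _ rt(1,2)] rt(3) by blast
    then have "idx t < idx r" using False by simp
    from sorted[OF rt(2,1) this] show ?thesis
      using dihedral_coeffs_swap[of "x t r" "x r t" u "m t r"] coxeter_typeD(3)[OF S rt(2,1) rt(3)[symmetric]]
      by simp
  qed
  have E: "chain_graph S (coeff_edges S x)" by (rule chain_graph_coeff_edges[OF finS])
  obtain \<psi> where \<psi>: "\<psi> \<in> hom (chain_group (coeff_edges S x)) (units_of \<complex>\<^sub>R)"
    "\<forall>(r, t)\<in>coeff_edges S x. \<psi> (oriented_edge r t) = a t r / a r t"
  proof -
    have "\<exists>\<psi>\<in>hom (chain_group (coeff_edges S x)) (units_of \<complex>\<^sub>R).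
        \<forall>(r, t)\<in>coeff_edges S x. \<psi> (oriented_edge r t) = a t r / a r t"
    proof (rule hom_chain_group_exists[OF E])
      fix r t assume "(r, t) \<in> coeff_edges S x"
      note rt = coeff_edgesD[OF this]
      show "a t r / a r t \<noteq> 0"
        using all[OF rt(1-3)] all[OF rt(2,1) rt(3)[symmetric]] by simp
      show "a r t / a t r = inverse (a t r / a r t)" by simp
    qed
    then show ?thesis using that by blast
  qed
  have "normal_coeffs S m u x"
    unfolding normal_coeffs_def using all by blast
  moreover have "matrix_attached S X x (restrict \<psi> (carrier (H1_group S (coeff_edges S x)))) a \<psi>"
    unfolding matrix_attached_def using all \<psi> by blast
  ultimately show ?thesis by (rule that)
qed

text \<open>Absorbing \<open>c\<close> turns the scalars for \<open>X'\<close> into scalars for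
  \<open>X\<close>, so uniqueness of the normal form applies. On edges the two ratios then differ by
  the coboundary of \<open>inverse (c t)\<close>, which is invisible on cycles.\<close>

lemma matrix_attached_unique:
  assumes S: "coxeter_type S m" and u: "\<And>z. (u z)\<^sup>2 = z"
    and x: "normal_coeffs S m u x" "normal_coeffs S m u x'"
    and att: "matrix_attached S X x \<chi> a \<psi>" "matrix_attached S X' x' \<chi>' a' \<psi>'"
    and c: "\<And>s. s \<in> S \<Longrightarrow> c s \<noteq> 0"
    and conj: "\<And>r t. r \<in> S \<Longrightarrow> t \<in> S \<Longrightarrow> r \<noteq> t \<Longrightarrow> X' r t = X r t * c t / c r"
  shows "\<chi> = \<chi>' \<and> (\<forall>r\<in>S. \<forall>t\<in>S. r \<noteq> t \<longrightarrow> x r t = x' r t)"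
proof -
  note A = matrix_attachedD[OF att(1)] and A' = matrix_attachedD[OF att(2)]
  have eq': "X r t * (c t * a' t r) = x' r t * (c r * a' r t)" if "r \<in> S" "t \<in> S" "r \<noteq> t" for r t
    using A'(2)[OF that] conj[OF that] c that(1,2) by (simp add: field_simps)
  have xx: "x r t = x' r t" if rt: "r \<in> S" "t \<in> S" "r \<noteq> t" for r t
  proof -
    note tr = rt(2,1) rt(3)[symmetric]
    have "x r t = x' r t \<and> x t r = x' t r"
      by (rule dihedral_normal_form_unique[OF u normal_coeffsD[OF x(1) rt] normal_coeffsD[OF x(2) rt]
            A(1)[OF rt] A(1)[OF tr] _ _ A(2)[OF rt] A(2)[OF tr] eq'[OF rt] eq'[OF tr]])
        (use A'(1)[OF rt] A'(1)[OF tr] c rt in simp_all)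
    then show ?thesis by blast
  qed
  have edges: "coeff_edges S x' = coeff_edges S x"
    by (rule coeff_edges_cong) (simp add: xx)
  have E: "chain_graph S (coeff_edges S x)"
    by (rule chain_graph_coeff_edges[OF coxeter_typeD(1)[OF S]])
  have cob: "\<psi>' (oriented_edge r t) = \<psi> (oriented_edge r t) * inverse (c t) / inverse (c r)"
    if e: "(r, t) \<in> coeff_edges S x" for r t
  proof -
    note D = coeff_edgesD[OF e]
    note tr = D(2,1) D(3)[symmetric]
    note nz = A(1)[OF D(1-3)] A(1)[OF tr] A'(1)[OF D(1-3)] A'(1)[OF tr] c[OF D(1)] c[OF D(2)]
    have "a t r * (c r * a' r t) = a r t * (c t * a' t r)"
    \<comment> \<open>At least one direction of an edge has a nonzero entry, and the equation for
      that direction determines the ratio of the scalars.\<close>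
    proof (cases "x r t = 0")
      case False
      have "X r t \<noteq> 0" using A(2)[OF D(1-3)] False nz by auto
      have "X r t * x r t * (a t r * (c r * a' r t)) = (X r t * a t r) * (x r t * (c r * a' r t))"
        by (simp add: algebra_simps)
      also have "\<dots> = (x r t * a r t) * (X r t * (c t * a' t r))"
        using A(2)[OF D(1-3)] eq'[OF D(1-3)] xx[OF D(1-3)] by simp
      finally have "(X r t * x r t) * (a t r * (c r * a' r t)) = (X r t * x r t) * (a r t * (c t * a' t r))"
        by (simp add: algebra_simps)
      then show ?thesis using False \<open>X r t \<noteq> 0\<close> by simp
    next
      case True
      then have x0: "x t r \<noteq> 0" using D(4) by simp
      have X0: "X t r \<noteq> 0" using A(2)[OF tr] x0 nz by auto
      have "X t r * x t r * (a r t * (c t * a' t r)) = (X t r * a r t) * (x t r * (c t * a' t r))"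
        by (simp add: algebra_simps)
      also have "\<dots> = (x t r * a t r) * (X t r * (c r * a' r t))"
        using A(2)[OF tr] eq'[OF tr] xx[OF tr] by simp
      finally have "(X t r * x t r) * (a r t * (c t * a' t r)) = (X t r * x t r) * (a t r * (c r * a' r t))"
        by (simp add: algebra_simps)
      then show ?thesis using x0 X0 by simp
    qed
    then show ?thesis
      unfolding A(4)[OF e] A'(4)[unfolded edges, OF e] using nz by (simp add: field_simps)
  qed
  have "\<psi> d = \<psi>' d" if "d \<in> carrier (H1_group S (coeff_edges S x))" for d
    by (rule eq_on_H1_of_coboundary[OF E A(3) A'(3)[unfolded edges] _ cob that]) (simp add: c)
  then have "\<chi> = \<chi>'"
    unfolding A(5) A'(5) edges by (intro restrict_ext) simp
  then show ?thesis using xx by blast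
qed

text \<open>Characters of chains that agree on cycles differ by the coboundary of some
  \<open>f\<close>. Rescaling by the inverse of \<open>f\<close> carries \<open>X\<close> to
  \<open>X'\<close> on the edges, and off the edges both matrices vanish.\<close>

lemma matrix_attached_conjugate:
  assumes S: "coxeter_type S m"
    and x: "\<And>r t. r \<in> S \<Longrightarrow> t \<in> S \<Longrightarrow> r \<noteq> t \<Longrightarrow> x r t = x' r t"
    and att: "matrix_attached S X x \<chi> a \<psi>" "matrix_attached S X' x' \<chi> a' \<psi>'"
  obtains c where "\<And>s. s \<in> S \<Longrightarrow> c s \<noteq> 0"
    "\<And>r t. r \<in> S \<Longrightarrow> t \<in> S \<Longrightarrow> r \<noteq> t \<Longrightarrow> X' r t = X r t * c t / c r"
proof -
  note A = matrix_attachedD[OF att(1)] and A' = matrix_attachedD[OF att(2)]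
  have edges: "coeff_edges S x' = coeff_edges S x"
    by (rule coeff_edges_cong) (simp add: x)
  have E: "chain_graph S (coeff_edges S x)"
    by (rule chain_graph_coeff_edges[OF coxeter_typeD(1)[OF S]])
  have H1: "\<psi> d = \<psi>' d" if "d \<in> carrier (H1_group S (coeff_edges S x))" for d
    using fun_cong[OF A(5)[unfolded A'(5) edges], of d] that by simp
  obtain f where f: "\<And>t. t \<in> S \<Longrightarrow> f t \<noteq> 0"
    "\<And>r t. (r, t) \<in> coeff_edges S x \<Longrightarrow> \<psi>' (oriented_edge r t) = \<psi> (oriented_edge r t) * f t / f r"
    by (rule coboundary_of_eq_on_H1[OF E A(3) A'(3)[unfolded edges] H1]) (assumption | rule that)+
  have "X' r t = X r t * inverse (f t) / inverse (f r)" if rt: "r \<in> S" "t \<in> S" "r \<noteq> t" for r t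
  proof -
    note tr = rt(2,1) rt(3)[symmetric]
    note nz = A(1)[OF rt] A(1)[OF tr] A'(1)[OF rt] A'(1)[OF tr] f(1)[OF rt(1)] f(1)[OF rt(2)]
    show ?thesis
    proof (cases "(r, t) \<in> coeff_edges S x")
      case True
      have "a' t r / a' r t = a t r / a r t * f t / f r"
        using f(2)[OF True] A(4)[OF True] A'(4)[unfolded edges, OF True] by simp
      then have a': "a' t r = a' r t * a t r * f t / (a r t * f r)"
        using nz by (simp add: field_simps)
      have X: "X' r t = x r t * a' r t / a' t r" "X r t = x r t * a r t / a t r"
        using A(2)[OF rt] A'(2)[OF rt] x[OF rt] nz by (simp_all add: field_simps)
      show ?thesis
        unfolding X a' using nz by (simp add: field_simps)
    next
      case False
      then have "x r t = 0" "x' r t = 0"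
        using rt x[OF rt] unfolding coeff_edges_def by simp_all
      then show ?thesis
        using A(2)[OF rt] A'(2)[OF rt] nz by simp
    qed
  qed
  then show ?thesis
    using f(1) by (intro that[of "\<lambda>s. inverse (f s)"]) simp_all
qed

text \<open>After extending \<chi> to chains, its value on each edge is split as
  \<open>a t r / a r t\<close> and the rescaling is undone. Products and vanishing patterns of the
  normal form are kept, and with them validity.\<close>

lemma matrix_attached_surj:
  assumes S: "coxeter_type S m"
    and x: "normal_coeffs S m u x" and \<chi>: "\<chi> \<in> H1_characters S (coeff_edges S x)"
  obtains X a \<psi> where "cox_matrix S m X" "matrix_attached S X x \<chi> a \<psi>"
proof -
  note finS = coxeter_typeD(1)[OF S]
  have E: "chain_graph S (coeff_edges S x)"
    by (rule chain_graph_coeff_edges[OF finS])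
  obtain \<psi> where \<psi>: "\<psi> \<in> hom (chain_group (coeff_edges S x)) (units_of \<complex>\<^sub>R)"
    "\<chi> = restrict \<psi> (carrier (H1_group S (coeff_edges S x)))"
    by (rule H1_character_extends[OF E \<chi>])
  obtain idx :: "'a \<Rightarrow> nat" where idx: "inj_on idx S"
    using finite_imp_inj_to_nat_seg[OF finS] by auto
  \<comment> \<open>The whole value on an edge is assigned to the scalar of its later end in the
    order of \<open>idx\<close>; the other scalar is 1.\<close>
  define a where "a = (\<lambda>r t. if idx t < idx r \<and> (r, t) \<in> coeff_edges S x then \<psi> (oriented_edge t r) else 1)"
  have sym: "(t, r) \<in> coeff_edges S x" if "(r, t) \<in> coeff_edges S x" for r t
    using chain_graphD(3)[OF E that] .
  have nz: "\<psi> (oriented_edge r t) \<noteq> 0" if "(r, t) \<in> coeff_edges S x" for r t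
    by (rule hom_chain_group_nonzero[OF \<psi>(1) oriented_edge_closed[OF E that]])
  have a_nz: "a r t \<noteq> 0" for r t
    using nz[OF sym] by (simp add: a_def)
  have edge: "\<psi> (oriented_edge r t) = a t r / a r t" if e: "(r, t) \<in> coeff_edges S x" for r t
  proof (cases "idx r < idx t")
    case True
    then show ?thesis using e sym[OF e] by (simp add: a_def)
  next
    case False
    have "idx r \<noteq> idx t"
      using inj_onD[OF idx _ coeff_edgesD(1,2)[OF e]] coeff_edgesD(3)[OF e] by blast
    then show ?thesis
      using False e nz[OF sym[OF e]] hom_chain_group_reverse[OF E \<psi>(1) e] by (simp add: a_def field_simps)
  qed
  define X where "X = (\<lambda>r t. if r = t then -2 else x r t * a r t / a t r)"
  have "dihedral_valid (m r t) (X r t) (X t r)" if rt: "r \<in> S" "t \<in> S" "r \<noteq> t" for r t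
  proof -
    have "X r t * X t r = x r t * x t r" "X r t = 0 \<longleftrightarrow> x r t = 0" "X t r = 0 \<longleftrightarrow> x t r = 0"
      using a_nz rt(3) by (auto simp: X_def)
    then show ?thesis
      using dihedral_coeffs_valid[OF normal_coeffsD[OF x rt]] by (simp only: dihedral_valid_def)
  qed
  then have "cox_matrix S m X"
    by (simp add: cox_matrix_def X_def)
  moreover have "X r t * a t r = x r t * a r t" if "r \<noteq> t" for r t
    using that a_nz by (simp add: X_def)
  then have "matrix_attached S X x \<chi> a \<psi>"
    unfolding matrix_attached_def using a_nz \<psi> edge by blast
  ultimately show ?thesis by (rule that)
qed

section \<open>Attached data in terms of matrices\<close>

text \<open>\<open>rep_iso_scaled_iff\<close> for a two-element index set: the diagonal equations
  hold because both diagonals are -2, and one equation remains for each order of the pair.\<close>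

lemma dihedral_iso_iff:
  fixes V (structure)
  assumes S: "coxeter_type S m" and X: "IR_matrix S m V \<phi> \<alpha> X"
    and rt: "r \<in> S" "t \<in> S" "r \<noteq> t" and valid: "dihedral_valid (m r t) x y"
    and ab: "a \<noteq> 0" "b \<noteq> 0"
  shows "(\<exists>f. rep_iso (dihedral_subgroup S m r t) (V\<lparr>carrier := module.span \<complex>\<^sub>R V {\<alpha> r, \<alpha> t}\<rparr>) \<phi>
        (pair_space r t) (varrho2 S m r t x y) f \<and>
      f (a \<odot> \<alpha> r) = pair_basis r t r \<and> f (b \<odot> \<alpha> t) = pair_basis r t t) \<longleftrightarrow>
    X r t * b = x * a \<and> X t r * a = y * b"
proof -
  note D = IR_matrixD[OF X]
  let ?D = "dihedral_subgroup S m r t" and ?W = "coxeter_group S m"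
  let ?U = "V\<lparr>carrier := module.span \<complex>\<^sub>R V {\<alpha> r, \<alpha> t}\<rparr>"
  interpret complex_vs V using D(2) by (rule basis_familyD)
  have fam: "basis_family {r, t} ?U \<alpha>"
    using basis_family_span[OF D(2), of "{r, t}"] rt by simp
  have UV: "carrier ?U \<subseteq> carrier V"
    using span_is_subset2[of "{\<alpha> r, \<alpha> t}"] basis_familyD(6)[OF D(2)] rt by simp
  have repD: "representation ?D V \<phi>"
    unfolding dihedral_subgroup_def using D(1) by (rule representation_subgroup_generated)
  have inv: "\<phi> g v \<in> (\<lambda>v. v) ` carrier ?U" if "g \<in> carrier ?D" "v \<in> carrier ?U" for g v
    using IR_matrix_span_invariant[OF X rt] that by simp
  \<comment> \<open>\<open>\<phi> g\<close> is extensional on all of \<open>V\<close>, so it is not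
    literally an action on the plane. \<theta> is the restricted action; \<open>rep_iso\<close> sees
    only values on the plane, where the two agree.\<close>
  obtain \<theta> where \<theta>: "representation ?D ?U \<theta>"
    "\<And>g v. g \<in> carrier ?D \<Longrightarrow> v \<in> carrier ?U \<Longrightarrow> \<theta> g v = \<phi> g v"
  proof (rule representation_transport[where L = "\<lambda>v. v" and \<phi> = \<phi>, OF repD _ _ _ inv])
    show "complex_vs ?U" using fam by (rule basis_familyD)
    show "(\<lambda>v. v) \<in> module_hom \<complex>\<^sub>R ?U V"
      using UV by (intro module_homI) auto
  qed (simp_all add: that)
  have spec: "dihedral_spec S m r t x y (varrho2 S m r t x y)"
    by (rule varrho2_spec[OF S rt valid])
  let ?c = "\<lambda>s. if s = r then a else b"
  have "(\<exists>f. rep_iso ?D ?U \<theta> (pair_space r t) (varrho2 S m r t x y) f \<and>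
        (\<forall>s\<in>{r, t}. f (?c s \<odot>\<^bsub>?U\<^esub> \<alpha> s) = func_unit {r, t} s)) \<longleftrightarrow>
      (\<forall>s\<in>{r, t}. \<forall>s'\<in>{r, t}. X s s' * ?c s' = pair_matrix r x y s s' * ?c s)"
  proof (rule rep_iso_scaled_iff[OF \<theta>(1) _ fam _ dihedral_generators[OF rt(1,2)]])
    show "representation ?D (pair_space r t) (varrho2 S m r t x y)"
      using spec by (simp add: dihedral_spec_def)
    show "basis_family {r, t} (pair_space r t) (func_unit {r, t})"
      by (rule basis_family_func_space) simp
    show "\<theta> (cox_gen S m s) (\<alpha> s') = \<alpha> s' \<oplus>\<^bsub>?U\<^esub> X s s' \<odot>\<^bsub>?U\<^esub> \<alpha> s"
      if s: "s \<in> {r, t}" "s' \<in> {r, t}" for s s'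
    proof -
      have "\<theta> (cox_gen S m s) (\<alpha> s') = \<phi> (cox_gen S m s) (\<alpha> s')"
        using s dihedral_generators(1)[OF rt(1,2), of m] basis_familyD(6)[OF fam s(2)]
        by (intro \<theta>(2)) blast+
      moreover have "s \<in> S" "s' \<in> S" using s rt by blast+
      ultimately show ?thesis using D(4) by simp
    qed
    show "varrho2 S m r t x y (cox_gen S m s) (func_unit {r, t} s') =
        func_unit {r, t} s' \<oplus>\<^bsub>pair_space r t\<^esub> pair_matrix r x y s s' \<odot>\<^bsub>pair_space r t\<^esub> func_unit {r, t} s"
      if s: "s \<in> {r, t}" "s' \<in> {r, t}" for s s'
      using spec[unfolded dihedral_spec_def, THEN conjunct2, THEN conjunct2, THEN bspec, OF s(1),
          THEN bspec, OF s(2)] .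
  qed (use ab in simp)
  also have "(\<forall>s\<in>{r, t}. \<forall>s'\<in>{r, t}. X s s' * ?c s' = pair_matrix r x y s s' * ?c s) \<longleftrightarrow>
      X r t * b = x * a \<and> X t r * a = y * b"
    using rt D(3)[OF rt(1)] D(3)[OF rt(2)] by (auto simp: pair_matrix_def)
  also have "(\<exists>f. rep_iso ?D ?U \<theta> (pair_space r t) (varrho2 S m r t x y) f \<and>
        (\<forall>s\<in>{r, t}. f (?c s \<odot>\<^bsub>?U\<^esub> \<alpha> s) = func_unit {r, t} s)) \<longleftrightarrow>
      (\<exists>f. rep_iso ?D ?U \<phi> (pair_space r t) (varrho2 S m r t x y) f \<and>
        f (a \<odot> \<alpha> r) = pair_basis r t r \<and> f (b \<odot> \<alpha> t) = pair_basis r t t)"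
    using rt(3) rep_iso_cong[of ?D ?U \<theta> \<phi> "pair_space r t" "varrho2 S m r t x y", OF \<theta>(2)]
    by (simp add: pair_basis_eq_func_unit)
  finally show ?thesis .
qed

lemma coeff_delta_offdiag:
  assumes "r \<in> S" "t \<in> S" "r \<noteq> t"
  shows "coeff_delta S m x (r, t) = varrho2 S m r t (x r t) (x t r)"
  using assms by (simp add: coeff_delta_def off_diagonal_def)

lemma graph_edges_coeff_delta:
  assumes S: "coxeter_type S m" and u: "\<And>z. (u z)\<^sup>2 = z" and x: "normal_coeffs S m u x"
  shows "graph_edges S m u (coeff_delta S m x) = coeff_edges S x"
proof -
  have "3 \<le> mtilde S m u (coeff_delta S m x) r t \<longleftrightarrow> x r t \<noteq> 0 \<or> x t r \<noteq> 0"
    if rt: "r \<in> S" "t \<in> S" "r \<noteq> t" for r t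
    by (rule mtilde_edge[where \<delta> = "coeff_delta S m x" and u = u, OF S u rt normal_coeffsD[OF x rt] coeff_delta_offdiag[OF rt]])
  then show ?thesis
    unfolding graph_edges_def coeff_edges_def by blast
qed

lemma off_diagonal_iff: "(r, t) \<in> off_diagonal S \<longleftrightarrow> r \<in> S \<and> t \<in> S \<and> r \<noteq> t"
  by (simp add: off_diagonal_def)

lemma coeff_delta_params:
  assumes "normal_coeffs S m u x"
  shows "coeff_delta S m x \<in> (\<Pi>\<^sub>E (r, t)\<in>off_diagonal S. dihedral_params S m u r t)"
proof (rule PiE_I)
  fix e assume "e \<in> off_diagonal S"
  then obtain r t where e: "e = (r, t)" and rt: "r \<in> S" "t \<in> S" "r \<noteq> t"
    by (cases e) (auto simp: off_diagonal_iff)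
  show "coeff_delta S m x e \<in> (case e of (r, t) \<Rightarrow> dihedral_params S m u r t)"
    unfolding e prod.case coeff_delta_offdiag[OF rt] dihedral_params_eq
    by (rule image_eqI[OF _ normal_coeffsD[OF assms rt]]) simp
qed (simp add: coeff_delta_def)

text \<open>The coefficient \<open>y r t\<close> is kept apart from \<open>x t r\<close>: the
  choices for the two orders of a pair are independent, and their agreement has to be proved from
  further information on \<delta>.\<close>

lemma params_coeffs:
  assumes "\<delta> \<in> (\<Pi>\<^sub>E (r, t)\<in>off_diagonal S. dihedral_params S m u r t)"
  obtains x y where "\<And>r t. r \<in> S \<Longrightarrow> t \<in> S \<Longrightarrow> r \<noteq> t \<Longrightarrow> (x r t, y r t) \<in> dihedral_coeffs u (m r t)"
    "\<And>r t. r \<in> S \<Longrightarrow> t \<in> S \<Longrightarrow> r \<noteq> t \<Longrightarrow> \<delta> (r, t) = varrho2 S m r t (x r t) (y r t)"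
proof -
  define P where "P = (\<lambda>r t. SOME p. p \<in> dihedral_coeffs u (m r t) \<and>
    \<delta> (r, t) = varrho2 S m r t (fst p) (snd p))"
  have P: "P r t \<in> dihedral_coeffs u (m r t) \<and> \<delta> (r, t) = varrho2 S m r t (fst (P r t)) (snd (P r t))"
    if "r \<in> S" "t \<in> S" "r \<noteq> t" for r t
  proof -
    have "\<delta> (r, t) \<in> dihedral_params S m u r t"
      using PiE_mem[OF assms, of "(r, t)"] that by (simp add: off_diagonal_iff)
    then obtain p where "p \<in> dihedral_coeffs u (m r t) \<and> \<delta> (r, t) = varrho2 S m r t (fst p) (snd p)"
      unfolding dihedral_params_eq by (auto simp: case_prod_beta)
    then show ?thesis
      unfolding P_def by (rule someI)
  qed
  show ?thesis
    by (rule that[of "\<lambda>r t. fst (P r t)" "\<lambda>r t. snd (P r t)"]) (simp_all add: P)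
qed

lemma delta_eq_coeff_delta:
  assumes \<delta>: "\<delta> \<in> (\<Pi>\<^sub>E (r, t)\<in>off_diagonal S. dihedral_params S m u r t)"
    and eq: "\<And>r t. r \<in> S \<Longrightarrow> t \<in> S \<Longrightarrow> r \<noteq> t \<Longrightarrow> \<delta> (r, t) = varrho2 S m r t (x r t) (x t r)"
  shows "\<delta> = coeff_delta S m x"
proof (rule extensionalityI[of _ "off_diagonal S"])
  show "\<delta> \<in> extensional (off_diagonal S)" using \<delta> by (simp add: PiE_def)
  show "coeff_delta S m x \<in> extensional (off_diagonal S)" by (simp add: coeff_delta_def)
  fix e assume "e \<in> off_diagonal S"
  then obtain r t where e: "e = (r, t)" and rt: "r \<in> S" "t \<in> S" "r \<noteq> t"
    by (cases e) (auto simp: off_diagonal_iff)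
  show "\<delta> e = coeff_delta S m x e"
    unfolding e eq[OF rt] coeff_delta_offdiag[OF rt] ..
qed

lemma coeffs_normal:
  assumes \<delta>: "\<delta> \<in> (\<Pi>\<^sub>E (r, t)\<in>off_diagonal S. dihedral_params S m u r t)"
    and xy: "\<And>r t. r \<in> S \<Longrightarrow> t \<in> S \<Longrightarrow> r \<noteq> t \<Longrightarrow> (x r t, y r t) \<in> dihedral_coeffs u (m r t)"
      "\<And>r t. r \<in> S \<Longrightarrow> t \<in> S \<Longrightarrow> r \<noteq> t \<Longrightarrow> \<delta> (r, t) = varrho2 S m r t (x r t) (y r t)"
    and yx: "\<And>r t. r \<in> S \<Longrightarrow> t \<in> S \<Longrightarrow> r \<noteq> t \<Longrightarrow> y r t = x t r"
  shows "normal_coeffs S m u x" "\<delta> = coeff_delta S m x"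
proof -
  show "normal_coeffs S m u x"
    unfolding normal_coeffs_def
  proof (intro ballI impI)
    fix r t assume rt: "r \<in> S" "t \<in> S" "r \<noteq> t"
    show "(x r t, x t r) \<in> dihedral_coeffs u (m r t)"
      using xy(1)[OF rt] unfolding yx[OF rt] .
  qed
  show "\<delta> = coeff_delta S m x"
  proof (rule delta_eq_coeff_delta[OF \<delta>])
    show "\<delta> (r, t) = varrho2 S m r t (x r t) (x t r)" if rt: "r \<in> S" "t \<in> S" "r \<noteq> t" for r t
      unfolding xy(2)[OF rt] yx[OF rt] ..
  qed
qed

text \<open>Reduces the attached datum to numbers, where uniqueness and surjectivity are already
  settled. Symmetry of \<delta> is built into \<open>coeff_delta\<close>, but on the left it has to
  be extracted from the isomorphisms.\<close>

lemma is_attached_iff: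
  fixes V (structure)
  assumes S: "coxeter_type S m" and u: "\<And>z. (u z)\<^sup>2 = z"
    and rep: "representation (coxeter_group S m) V \<phi>"
  shows "is_attached S m u (V, \<phi>) (\<delta>, \<chi>) \<longleftrightarrow>
    (\<exists>\<alpha> X x a \<psi>. IR_matrix S m V \<phi> \<alpha> X \<and> normal_coeffs S m u x \<and> \<delta> = coeff_delta S m x \<and>
      matrix_attached S X x \<chi> a \<psi>)"
proof
  note finS = coxeter_typeD(1)[OF S]
  assume "is_attached S m u (V, \<phi>) (\<delta>, \<chi>)"
  then obtain \<alpha> a \<psi> where IR: "IR_basis S m V \<phi> \<alpha>"
    and \<delta>: "\<delta> \<in> (\<Pi>\<^sub>E (r, t)\<in>off_diagonal S. dihedral_params S m u r t)"
    and iso: "\<forall>(r, t)\<in>off_diagonal S.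
        a r t \<noteq> 0 \<and>
        (\<exists>f. rep_iso (dihedral_subgroup S m r t)
               (V\<lparr>carrier := module.span \<complex>\<^sub>R V {\<alpha> r, \<alpha> t}\<rparr>) \<phi> (pair_space r t) (\<delta> (r, t)) f \<and>
             f (a r t \<odot> \<alpha> r) = pair_basis r t r \<and>
             f (a t r \<odot> \<alpha> t) = pair_basis r t t)"
    and \<psi>: "\<psi> \<in> hom (chain_group (graph_edges S m u \<delta>)) (units_of \<complex>\<^sub>R)"
      "\<forall>(r, t)\<in>graph_edges S m u \<delta>. \<psi> (oriented_edge r t) = a t r / a r t"
      "\<chi> = restrict \<psi> (carrier (H1_group S (graph_edges S m u \<delta>)))"
    unfolding is_attached_def by (simp only: prod.case) blast
  obtain X where X: "IR_matrix S m V \<phi> \<alpha> X"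
    using IR IR_basis_iff_matrix[OF rep finS] by blast
  obtain x y where xy: "\<And>r t. r \<in> S \<Longrightarrow> t \<in> S \<Longrightarrow> r \<noteq> t \<Longrightarrow> (x r t, y r t) \<in> dihedral_coeffs u (m r t)"
    "\<And>r t. r \<in> S \<Longrightarrow> t \<in> S \<Longrightarrow> r \<noteq> t \<Longrightarrow> \<delta> (r, t) = varrho2 S m r t (x r t) (y r t)"
    by (rule params_coeffs[OF \<delta>]) (rule that; assumption)
  have a: "a r t \<noteq> 0" if "r \<in> S" "t \<in> S" "r \<noteq> t" for r t
    using iso that by (auto simp: off_diagonal_iff)
  have eq: "X r t * a t r = x r t * a r t \<and> X t r * a r t = y r t * a t r"
    if rt: "r \<in> S" "t \<in> S" "r \<noteq> t" for r t
  proof -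
    have "(r, t) \<in> off_diagonal S" using rt by (simp add: off_diagonal_iff)
    from bspec[OF iso this, unfolded prod.case, THEN conjunct2, unfolded xy(2)[OF rt]]
    show ?thesis
      by (rule iffD1[OF dihedral_iso_iff[OF S X rt dihedral_coeffs_valid[OF xy(1)[OF rt]] a[OF rt]
              a[OF rt(2,1) rt(3)[symmetric]]]])
  qed
  \<comment> \<open>The second equation for \<open>(r, t)\<close> and the first one for
    \<open>(t, r)\<close> involve the same entry of \<open>X\<close> and the same scalars; comparing
    them shows that the two choices of coefficients agree.\<close>
  have yx: "y r t = x t r" if rt: "r \<in> S" "t \<in> S" "r \<noteq> t" for r t
  proof -
    note tr = rt(2,1) rt(3)[symmetric]
    have "y r t * a t r = x t r * a t r"
      using trans[OF sym[OF conjunct2[OF eq[OF rt]]] conjunct1[OF eq[OF tr]]] .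
    then show ?thesis using a[OF tr] by simp
  qed
  have norm: "normal_coeffs S m u x" and \<delta>x: "\<delta> = coeff_delta S m x"
    using coeffs_normal[where x = x and y = y, OF \<delta> xy yx] by blast+
  have E: "graph_edges S m u \<delta> = coeff_edges S x"
    unfolding \<delta>x by (rule graph_edges_coeff_delta[OF S u norm])
  have "matrix_attached S X x \<chi> a \<psi>"
    unfolding matrix_attached_def using a eq \<psi>[unfolded E] by blast
  then show "\<exists>\<alpha> X x a \<psi>. IR_matrix S m V \<phi> \<alpha> X \<and> normal_coeffs S m u x \<and> \<delta> = coeff_delta S m x \<and>
      matrix_attached S X x \<chi> a \<psi>"
    using X norm \<delta>x by blast
next
  note finS = coxeter_typeD(1)[OF S]
  assume "\<exists>\<alpha> X x a \<psi>. IR_matrix S m V \<phi> \<alpha> X \<and> normal_coeffs S m u x \<and> \<delta> = coeff_delta S m x \<and>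
      matrix_attached S X x \<chi> a \<psi>"
  then obtain \<alpha> X x a \<psi> where X: "IR_matrix S m V \<phi> \<alpha> X" and norm: "normal_coeffs S m u x"
    and \<delta>: "\<delta> = coeff_delta S m x" and att: "matrix_attached S X x \<chi> a \<psi>"
    by (elim exE conjE) (rule that)
  note A = matrix_attachedD[OF att]
  have E: "graph_edges S m u \<delta> = coeff_edges S x"
    unfolding \<delta> by (rule graph_edges_coeff_delta[OF S u norm])
  have iso: "\<forall>(r, t)\<in>off_diagonal S.
        a r t \<noteq> 0 \<and>
        (\<exists>f. rep_iso (dihedral_subgroup S m r t)
               (V\<lparr>carrier := module.span \<complex>\<^sub>R V {\<alpha> r, \<alpha> t}\<rparr>) \<phi> (pair_space r t) (\<delta> (r, t)) f \<and>
             f (a r t \<odot> \<alpha> r) = pair_basis r t r \<and>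
             f (a t r \<odot> \<alpha> t) = pair_basis r t t)"
  proof (rule ballI, unfold split_paired_all prod.case, intro conjI)
    fix r t assume "(r, t) \<in> off_diagonal S"
    then have rt: "r \<in> S" "t \<in> S" "r \<noteq> t" by (simp_all add: off_diagonal_iff)
    note tr = rt(2,1) rt(3)[symmetric]
    show "a r t \<noteq> 0" by (rule A(1)[OF rt])
    show "\<exists>f. rep_iso (dihedral_subgroup S m r t)
               (V\<lparr>carrier := module.span \<complex>\<^sub>R V {\<alpha> r, \<alpha> t}\<rparr>) \<phi> (pair_space r t) (\<delta> (r, t)) f \<and>
             f (a r t \<odot> \<alpha> r) = pair_basis r t r \<and>
             f (a t r \<odot> \<alpha> t) = pair_basis r t t"
      unfolding \<delta> coeff_delta_offdiag[OF rt]
      by (rule iffD2[OF dihedral_iso_iff[OF S X rt dihedral_coeffs_valid[OF normal_coeffsD[OF norm rt]]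
              A(1)[OF rt] A(1)[OF tr]]])
        (rule conjI[OF A(2)[OF rt] A(2)[OF tr]])
  qed
  have "\<delta> \<in> (\<Pi>\<^sub>E (r, t)\<in>off_diagonal S. dihedral_params S m u r t)"
    unfolding \<delta> by (rule coeff_delta_params[OF norm])
  moreover have "IR_basis S m V \<phi> \<alpha>"
    using X IR_basis_iff_matrix[OF rep finS] by blast
  moreover have "\<psi> \<in> hom (chain_group (graph_edges S m u \<delta>)) (units_of \<complex>\<^sub>R)"
    "\<forall>(r, t)\<in>graph_edges S m u \<delta>. \<psi> (oriented_edge r t) = a t r / a r t"
    "\<chi> = restrict \<psi> (carrier (H1_group S (graph_edges S m u \<delta>)))"
    unfolding E using A(3-5) by blast+
  ultimately show "is_attached S m u (V, \<phi>) (\<delta>, \<chi>)"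
    unfolding is_attached_def prod.case using iso by (intro exI[of _ \<alpha>] exI[of _ a] exI[of _ \<psi>] conjI)
qed

lemma coeff_delta_inject:
  assumes S: "coxeter_type S m" and x: "normal_coeffs S m u x" "normal_coeffs S m u x'"
    and eq: "coeff_delta S m x = coeff_delta S m x'" and rt: "r \<in> S" "t \<in> S" "r \<noteq> t"
  shows "x r t = x' r t"
proof -
  have "varrho2 S m r t (x r t) (x t r) = varrho2 S m r t (x' r t) (x' t r)"
    using fun_cong[OF eq, of "(r, t)"] unfolding coeff_delta_offdiag[OF rt] .
  then show ?thesis
    using varrho2_inject[OF S rt dihedral_coeffs_valid[OF normal_coeffsD[OF x(1) rt]]
        dihedral_coeffs_valid[OF normal_coeffsD[OF x(2) rt]]] by blast
qed

lemma IR_data_iff: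
  assumes S: "coxeter_type S m" and u: "\<And>z. (u z)\<^sup>2 = z"
  shows "(\<delta>, \<chi>) \<in> IR_data S m u \<longleftrightarrow>
    (\<exists>x. normal_coeffs S m u x \<and> \<delta> = coeff_delta S m x \<and> \<chi> \<in> H1_characters S (coeff_edges S x))"
proof
  assume "(\<delta>, \<chi>) \<in> IR_data S m u"
  then have D: "\<delta> \<in> (\<Pi>\<^sub>E (r, t)\<in>off_diagonal S. dihedral_params S m u r t) \<and>
      (\<forall>(r, t)\<in>off_diagonal S. \<delta> (r, t) = \<delta> (t, r)) \<and> \<chi> \<in> H1_characters S (graph_edges S m u \<delta>)"
    unfolding IR_data_def mem_Collect_eq prod.case .
  note \<delta> = D[THEN conjunct1] and sym = D[THEN conjunct2, THEN conjunct1]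
    and \<chi> = D[THEN conjunct2, THEN conjunct2]
  obtain x y where xy: "\<And>r t. r \<in> S \<Longrightarrow> t \<in> S \<Longrightarrow> r \<noteq> t \<Longrightarrow> (x r t, y r t) \<in> dihedral_coeffs u (m r t)"
    "\<And>r t. r \<in> S \<Longrightarrow> t \<in> S \<Longrightarrow> r \<noteq> t \<Longrightarrow> \<delta> (r, t) = varrho2 S m r t (x r t) (y r t)"
    by (rule params_coeffs[OF \<delta>]) (rule that; assumption)
  \<comment> \<open>Here the agreement comes from symmetry of \<delta>: exchanging \<open>r\<close>
    and \<open>t\<close> swaps the coefficients, and \<open>varrho2_inject\<close> compares
    them.\<close>
  have yx: "y r t = x t r" if rt: "r \<in> S" "t \<in> S" "r \<noteq> t" for r t
  proof -
    note tr = rt(2,1) rt(3)[symmetric]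
    have "\<delta> (r, t) = \<delta> (t, r)"
      using sym rt by (auto simp: off_diagonal_iff)
    then have "varrho2 S m r t (x r t) (y r t) = varrho2 S m r t (y t r) (x t r)"
      unfolding xy(2)[OF rt] xy(2)[OF tr] varrho2_commute[of S m t r] .
    moreover have "dihedral_valid (m r t) (y t r) (x t r)"
      using dihedral_coeffs_valid[OF xy(1)[OF tr]] coxeter_typeD(3)[OF S rt] dihedral_valid_commute
      by simp
    ultimately show ?thesis
      using varrho2_inject[OF S rt dihedral_coeffs_valid[OF xy(1)[OF rt]]] by blast
  qed
  have norm: "normal_coeffs S m u x" and \<delta>x: "\<delta> = coeff_delta S m x"
    using coeffs_normal[where x = x and y = y, OF \<delta> xy yx] by blast+
  have "graph_edges S m u \<delta> = coeff_edges S x"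
    unfolding \<delta>x by (rule graph_edges_coeff_delta[OF S u norm])
  then show "\<exists>x. normal_coeffs S m u x \<and> \<delta> = coeff_delta S m x \<and> \<chi> \<in> H1_characters S (coeff_edges S x)"
    using norm \<delta>x \<chi> by (intro exI[of _ x]) simp
next
  assume "\<exists>x. normal_coeffs S m u x \<and> \<delta> = coeff_delta S m x \<and> \<chi> \<in> H1_characters S (coeff_edges S x)"
  then obtain x where norm: "normal_coeffs S m u x" and \<delta>: "\<delta> = coeff_delta S m x"
    and \<chi>: "\<chi> \<in> H1_characters S (coeff_edges S x)"
    by blast
  have "\<delta> (r, t) = \<delta> (t, r)" if rt: "r \<in> S" "t \<in> S" "r \<noteq> t" for r t
    unfolding \<delta> coeff_delta_offdiag[OF rt] coeff_delta_offdiag[OF rt(2,1) rt(3)[symmetric]]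
    by (rule varrho2_commute)
  then have "\<forall>(r, t)\<in>off_diagonal S. \<delta> (r, t) = \<delta> (t, r)"
    unfolding off_diagonal_def by blast
  moreover have "\<delta> \<in> (\<Pi>\<^sub>E (r, t)\<in>off_diagonal S. dihedral_params S m u r t)"
    unfolding \<delta> by (rule coeff_delta_params[OF norm])
  moreover have "\<chi> \<in> H1_characters S (graph_edges S m u \<delta>)"
    unfolding \<delta> graph_edges_coeff_delta[OF S u norm] by (rule \<chi>)
  ultimately show "(\<delta>, \<chi>) \<in> IR_data S m u"
    unfolding IR_data_def mem_Collect_eq prod.case by (intro conjI)
qed

lemma IR_reps_matrix:
  assumes "(V, \<phi>) \<in> IR_reps S m" "finite S"
  obtains \<alpha> X where "IR_matrix S m V \<phi> \<alpha> X"
  using assms IR_basis_iff_matrix unfolding IR_reps_def by blast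

lemma IR_matrix_IR_reps:
  assumes "IR_matrix S m V \<phi> \<alpha> X" "finite S"
  shows "(V, \<phi>) \<in> IR_reps S m"
proof -
  have "representation (coxeter_group S m) V \<phi>" using assms(1) by (rule IR_matrixD)
  then show ?thesis
    using assms IR_basis_iff_matrix[of S m V \<phi> \<alpha>] unfolding IR_reps_def by blast
qed

lemma IR_reps_representation: "(V, \<phi>) \<in> IR_reps S m \<Longrightarrow> representation (coxeter_group S m) V \<phi>"
  by (simp add: IR_reps_def)

section \<open>Well-definedness, injectivity and surjectivity of the attached datum\<close>

lemma is_attached_exists:
  assumes S: "coxeter_type S m" and u: "\<And>z. (u z)\<^sup>2 = z" and V: "(V, \<phi>) \<in> IR_reps S m"
  obtains \<delta> \<chi> where "is_attached S m u (V, \<phi>) (\<delta>, \<chi>)"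
proof -
  note rep = IR_reps_representation[OF V]
  obtain \<alpha> X where X: "IR_matrix S m V \<phi> \<alpha> X"
    by (rule IR_reps_matrix[OF V coxeter_typeD(1)[OF S]])
  have "cox_matrix S m X"
    by (rule IR_matrix_valid[OF X]) (rule coxeter_typeD(2)[OF S])
  then obtain x \<chi> a \<psi> where "normal_coeffs S m u x" "matrix_attached S X x \<chi> a \<psi>"
    by (rule matrix_attached_exists[OF S u])
  then have "is_attached S m u (V, \<phi>) (coeff_delta S m x, \<chi>)"
    unfolding is_attached_iff[OF S u rep] using X by blast
  then show ?thesis by (rule that)
qed

text \<open>Applied to the identity, this is independence of the chosen basis and scalars; in
  general it is invariance under isomorphism.\<close>

lemma is_attached_iso_unique:
  assumes S: "coxeter_type S m" and u: "\<And>z. (u z)\<^sup>2 = z"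
    and iso: "((V, \<phi>), (V', \<phi>')) \<in> IR_iso S m"
    and att: "is_attached S m u (V, \<phi>) (\<delta>, \<chi>)" "is_attached S m u (V', \<phi>') (\<delta>', \<chi>')"
  shows "\<delta> = \<delta>' \<and> \<chi> = \<chi>'"
proof -
  obtain f where V: "(V, \<phi>) \<in> IR_reps S m" and V': "(V', \<phi>') \<in> IR_reps S m"
    and f: "rep_iso (coxeter_group S m) V \<phi> V' \<phi>' f"
    using iso unfolding IR_iso_def by blast
  note rep = IR_reps_representation[OF V] and rep' = IR_reps_representation[OF V']
  obtain \<alpha> X x a \<psi> where X: "IR_matrix S m V \<phi> \<alpha> X" and x: "normal_coeffs S m u x" "\<delta> = coeff_delta S m x"
    and A: "matrix_attached S X x \<chi> a \<psi>"
    using att(1) unfolding is_attached_iff[OF S u rep] by (elim exE conjE) (rule that)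
  obtain \<alpha>' X' x' a' \<psi>' where X': "IR_matrix S m V' \<phi>' \<alpha>' X'"
    and x': "normal_coeffs S m u x'" "\<delta>' = coeff_delta S m x'"
    and A': "matrix_attached S X' x' \<chi>' a' \<psi>'"
    using att(2) unfolding is_attached_iff[OF S u rep'] by (elim exE conjE) (rule that)
  \<comment> \<open>The basis of \<open>V\<close> is moved to \<open>V'\<close>, so that both
    matrices belong to one representation and are conjugate by a diagonal matrix.\<close>
  obtain c where c: "\<And>s. s \<in> S \<Longrightarrow> c s \<noteq> 0" "\<And>s t. s \<in> S \<Longrightarrow> t \<in> S \<Longrightarrow> X' s t = X s t * c t / c s"
    by (rule IR_matrix_unique[OF IR_matrix_image[OF X rep' f] X']) (rule that; assumption)
  have "\<chi> = \<chi>' \<and> (\<forall>r\<in>S. \<forall>t\<in>S. r \<noteq> t \<longrightarrow> x r t = x' r t)"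
    by (rule matrix_attached_unique[OF S u x(1) x'(1) A A' c(1) c(2)])
  then have \<chi>: "\<chi> = \<chi>'" and xx: "x r t = x' r t" if "r \<in> S" "t \<in> S" "r \<noteq> t" for r t
    using that by blast+
  have "coeff_delta S m x = coeff_delta S m x'"
  proof (rule delta_eq_coeff_delta[OF coeff_delta_params[OF x(1)]])
    fix r t assume rt: "r \<in> S" "t \<in> S" "r \<noteq> t"
    show "coeff_delta S m x (r, t) = varrho2 S m r t (x' r t) (x' t r)"
      unfolding coeff_delta_offdiag[OF rt] xx[OF rt] xx[OF rt(2,1) rt(3)[symmetric]] ..
  qed
  then show ?thesis
    using x(2) x'(2) \<open>\<chi> = \<chi>' \<and> _\<close> by blast
qed

lemma IR_matrix_cong:
  assumes "IR_matrix S m V \<phi> \<alpha> X" "\<And>s t. s \<in> S \<Longrightarrow> t \<in> S \<Longrightarrow> X s t = X' s t"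
  shows "IR_matrix S m V \<phi> \<alpha> X'"
  using assms by (simp add: IR_matrix_def)

text \<open>After a rescaling of its basis, \<open>V\<close> has the same matrix as
  \<open>V'\<close>, and matching the basis vectors is then an isomorphism.\<close>

lemma is_attached_imp_iso:
  fixes V (structure)
  assumes S: "coxeter_type S m" and u: "\<And>z. (u z)\<^sup>2 = z"
    and V: "(V, \<phi>) \<in> IR_reps S m" "(V', \<phi>') \<in> IR_reps S m"
    and att: "is_attached S m u (V, \<phi>) (\<delta>, \<chi>)" "is_attached S m u (V', \<phi>') (\<delta>, \<chi>)"
  shows "((V, \<phi>), (V', \<phi>')) \<in> IR_iso S m"
proof -
  note rep = IR_reps_representation[OF V(1)] and rep' = IR_reps_representation[OF V(2)]
  obtain \<alpha> X x a \<psi> where X: "IR_matrix S m V \<phi> \<alpha> X" and x: "normal_coeffs S m u x" "\<delta> = coeff_delta S m x"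
    and A: "matrix_attached S X x \<chi> a \<psi>"
    using att(1) unfolding is_attached_iff[OF S u rep] by (elim exE conjE) (rule that)
  obtain \<alpha>' X' x' a' \<psi>' where X': "IR_matrix S m V' \<phi>' \<alpha>' X'"
    and x': "normal_coeffs S m u x'" "\<delta> = coeff_delta S m x'"
    and A': "matrix_attached S X' x' \<chi> a' \<psi>'"
    using att(2) unfolding is_attached_iff[OF S u rep'] by (elim exE conjE) (rule that)
  have xx: "x r t = x' r t" if "r \<in> S" "t \<in> S" "r \<noteq> t" for r t
    using coeff_delta_inject[OF S x(1) x'(1) _ that] x(2) x'(2) by simp
  obtain c where c: "\<And>s. s \<in> S \<Longrightarrow> c s \<noteq> 0"
    "\<And>r t. r \<in> S \<Longrightarrow> t \<in> S \<Longrightarrow> r \<noteq> t \<Longrightarrow> X' r t = X r t * c t / c r"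
    by (rule matrix_attached_conjugate[OF S xx A A']) (assumption | rule that)+
  have "IR_matrix S m V \<phi> (\<lambda>s. c s \<odot> \<alpha> s) X'"
  proof (rule IR_matrix_cong[OF IR_matrix_rescale[OF X c(1)]])
    show "X s t * c t / c s = X' s t" if st: "s \<in> S" "t \<in> S" for s t
    proof (cases "s = t")
      case True
      then show ?thesis
        using IR_matrixD(3)[OF X st(1)] IR_matrixD(3)[OF X' st(1)] c(1)[OF st(1)] by simp
    next
      case False
      then show ?thesis using c(2)[OF st] by simp
    qed
  qed
  from IR_matrix_iso[OF this X'] show ?thesis
    using V unfolding IR_iso_def by blast
qed

text \<open>Symmetry of \<delta> is contained in the normal coefficients; what remains is that a
  character of the chains restricts to a character of the subgroup of cycles.\<close>

lemma is_attached_IR_data: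
  assumes S: "coxeter_type S m" and u: "\<And>z. (u z)\<^sup>2 = z"
    and V: "(V, \<phi>) \<in> IR_reps S m" and att: "is_attached S m u (V, \<phi>) (\<delta>, \<chi>)"
  shows "(\<delta>, \<chi>) \<in> IR_data S m u"
proof -
  obtain \<alpha> X x a \<psi> where x: "normal_coeffs S m u x" "\<delta> = coeff_delta S m x"
    and A: "matrix_attached S X x \<chi> a \<psi>"
    using att unfolding is_attached_iff[OF S u IR_reps_representation[OF V]] by (elim exE conjE) (rule that)
  note A = matrix_attachedD[OF A]
  have "\<psi> \<in> hom (H1_group S (coeff_edges S x)) (units_of \<complex>\<^sub>R)"
    using A(3) by (simp add: hom_units_complex_iff H1_group_carrier H1_group_mult chain_group_mult)
  moreover have "\<chi> c = \<psi> c" if "c \<in> carrier (H1_group S (coeff_edges S x))" for c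
    using that by (simp add: A(5))
  moreover have "c \<otimes>\<^bsub>H1_group S (coeff_edges S x)\<^esub> d \<in> carrier (H1_group S (coeff_edges S x))"
    if "c \<in> carrier (H1_group S (coeff_edges S x))" "d \<in> carrier (H1_group S (coeff_edges S x))" for c d
    using that by (simp add: H1_group_carrier H1_group_mult chain_group_add_closed chain_boundary_add)
  ultimately have "\<chi> \<in> hom (H1_group S (coeff_edges S x)) (units_of \<complex>\<^sub>R)"
    by (simp add: hom_units_complex_iff)
  moreover have "\<chi> \<in> extensional (carrier (H1_group S (coeff_edges S x)))"
    by (simp add: A(5))
  ultimately have "\<chi> \<in> H1_characters S (coeff_edges S x)"
    by (simp add: H1_characters_def)
  then show ?thesis
    unfolding IR_data_iff[OF S u] using x by blast
qed

lemma is_attached_surj: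
  fixes \<iota> :: "complex \<Rightarrow> 'v"
  assumes S: "coxeter_type S m" and u: "\<And>z. (u z)\<^sup>2 = z" and \<iota>: "inj \<iota>"
    and d: "(\<delta>, \<chi>) \<in> IR_data S m u"
  obtains V :: "(complex, 'v) module" and \<phi>
  where "(V, \<phi>) \<in> IR_reps S m" "is_attached S m u (V, \<phi>) (\<delta>, \<chi>)"
proof -
  obtain x where x: "normal_coeffs S m u x" "\<delta> = coeff_delta S m x"
    and \<chi>: "\<chi> \<in> H1_characters S (coeff_edges S x)"
    using d unfolding IR_data_iff[OF S u] by blast
  obtain X a \<psi> where X: "cox_matrix S m X" and A: "matrix_attached S X x \<chi> a \<psi>"
    by (rule matrix_attached_surj[OF S x(1) \<chi>])
  obtain V :: "(complex, 'v) module" and \<phi> \<alpha> where V: "IR_matrix S m V \<phi> \<alpha> X"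
    using IR_matrix_exists[OF coxeter_typeD(1)[OF S] X \<iota>] by blast
  have VR: "(V, \<phi>) \<in> IR_reps S m"
    by (rule IR_matrix_IR_reps[OF V coxeter_typeD(1)[OF S]])
  have "is_attached S m u (V, \<phi>) (\<delta>, \<chi>)"
    unfolding is_attached_iff[OF S u IR_reps_representation[OF VR]] using V x A by blast
  then show ?thesis using that VR by blast
qed

section \<open>Passage to isomorphism classes\<close>

lemma equiv_IR_iso: "equiv (IR_reps S m) (IR_iso S m)"
proof (rule equivI)
  show "IR_iso S m \<subseteq> IR_reps S m \<times> IR_reps S m"
    unfolding IR_iso_def by blast
  show "refl_on (IR_reps S m) (IR_iso S m)"
  proof (rule refl_onI)
    fix p assume "p \<in> IR_reps S m"
    then show "(p, p) \<in> IR_iso S m"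
      using rep_iso_id IR_reps_representation unfolding IR_iso_def by (cases p) blast
  qed
  show "sym_on UNIV (IR_iso S m)"
  proof (rule symI)
    fix p q assume "(p, q) \<in> IR_iso S m"
    then show "(q, p) \<in> IR_iso S m"
      using rep_iso_sym IR_reps_representation unfolding IR_iso_def by (cases p; cases q) blast
  qed
  show "trans_on UNIV (IR_iso S m)"
  proof (rule transI)
    fix p q o' assume "(p, q) \<in> IR_iso S m" "(q, o') \<in> IR_iso S m"
    then show "(p, o') \<in> IR_iso S m"
      using rep_iso_trans unfolding IR_iso_def by (cases p; cases q; cases o') blast
  qed
qed

text \<open>\<open>f\<close> is constant on a class, so the image of the class is a singleton and
  \<open>the_elem\<close> returns the common value.\<close>

lemma bij_betw_quotient:
  assumes R: "equiv A R" and f: "f respects R"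
    and inj: "\<And>x y. x \<in> A \<Longrightarrow> y \<in> A \<Longrightarrow> f x = f y \<Longrightarrow> (x, y) \<in> R" and surj: "f ` A = B"
  shows "bij_betw (\<lambda>C. the_elem (f ` C)) (A // R) B"
proof -
  have val: "the_elem (f ` (R `` {x})) = f x" if "x \<in> A" for x
  proof -
    have "f ` (R `` {x}) \<subseteq> {f x}"
    proof (rule image_subsetI)
      fix y assume "y \<in> R `` {x}"
      then have "f x = f y"
        using congruentD[OF f, of x y] by simp
      then show "f y \<in> {f x}" by simp
    qed
    moreover have "f x \<in> f ` (R `` {x})"
      using equiv_class_self[OF R that] by (rule imageI)
    ultimately have "f ` (R `` {x}) = {f x}" by blast
    then show ?thesis by simp
  qed
  show ?thesis
    unfolding bij_betw_def
  proof
    show "inj_on (\<lambda>C. the_elem (f ` C)) (A // R)"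
    proof (rule inj_onI)
      fix C D assume C: "C \<in> A // R" and D: "D \<in> A // R" and eq: "the_elem (f ` C) = the_elem (f ` D)"
      obtain x where x: "x \<in> A" "C = R `` {x}" using C by (rule quotientE)
      obtain y where y: "y \<in> A" "D = R `` {y}" using D by (rule quotientE)
      have "f x = f y" using eq unfolding x(2) y(2) val[OF x(1)] val[OF y(1)] .
      then show "C = D"
        unfolding x(2) y(2) using equiv_class_eq[OF R] inj x(1) y(1) by blast
    qed
    have "(\<lambda>C. the_elem (f ` C)) ` (A // R) = (\<lambda>x. the_elem (f ` (R `` {x}))) ` A"
      by (auto simp: quotient_def)
    also have "\<dots> = f ` A"
      by (rule image_cong) (simp_all add: val)
    finally show "(\<lambda>C. the_elem (f ` C)) ` (A // R) = B"
      using surj by simp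
  qed
qed

theorem theorem7p1:
  fixes S :: "'s set" and m :: "'s \<Rightarrow> 's \<Rightarrow> enat" and u :: "complex \<Rightarrow> complex"
    and \<iota> :: "complex \<Rightarrow> 'v"
  assumes "finite S"
    and "\<And>s t. s \<in> S \<Longrightarrow> t \<in> S \<Longrightarrow> s \<noteq> t \<Longrightarrow> 2 \<le> m s t \<and> m s t = m t s"
    and "\<And>z. (u z)\<^sup>2 = z"
    and "\<And>z. z \<in> \<real> \<Longrightarrow> 0 < Re z \<Longrightarrow> u z \<in> \<real> \<and> 0 < Re (u z)"
    and "inj \<iota>"
  shows "(\<forall>V\<in>(IR_reps S m :: ((complex, 'v) module \<times> ('s word set \<Rightarrow> 'v \<Rightarrow> 'v)) set).
            \<exists>!d. is_attached S m u V d) \<and>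
    attached_data S m u respects
      (IR_iso S m :: (((complex, 'v) module \<times> ('s word set \<Rightarrow> 'v \<Rightarrow> 'v)) \<times> _) set) \<and>
    bij_betw (\<lambda>C. the_elem (attached_data S m u ` C))
      ((IR_reps S m :: ((complex, 'v) module \<times> ('s word set \<Rightarrow> 'v \<Rightarrow> 'v)) set) // IR_iso S m)
      (IR_data S m u)"
proof -
  let ?reps = "IR_reps S m :: ((complex, 'v) module \<times> ('s word set \<Rightarrow> 'v \<Rightarrow> 'v)) set"
  let ?iso = "IR_iso S m :: (((complex, 'v) module \<times> ('s word set \<Rightarrow> 'v \<Rightarrow> 'v)) \<times> _) set"
  have S: "coxeter_type S m"
    using assms(1,2) unfolding coxeter_type_def by blast
  note u = assms(3)
  have unique: "d = d'" if "(V, V') \<in> ?iso" "is_attached S m u V d" "is_attached S m u V' d'" for V V' d d'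
    using is_attached_iso_unique[OF S u] that by (cases V; cases V'; cases d; cases d') blast
  have refl: "(V, V) \<in> ?iso" if "V \<in> ?reps" for V
    using equiv_IR_iso that by (rule equiv_class_self[unfolded Image_singleton_iff])
  \<comment> \<open>Uniqueness is invariance under isomorphism, applied to the identity of
    \<open>V\<close>.\<close>
  have ex1: "\<exists>!d. is_attached S m u V d" if V: "V \<in> ?reps" for V
  proof -
    obtain W \<phi> where W: "V = (W, \<phi>)" by (cases V)
    obtain \<delta> \<chi> where "is_attached S m u V (\<delta>, \<chi>)"
      unfolding W by (rule is_attached_exists[OF S u V[unfolded W]])
    then show ?thesis
      using unique[OF refl[OF V]] by blast
  qed
  have att: "is_attached S m u V (attached_data S m u V)" if "V \<in> ?reps" for V
    unfolding attached_data_def by (rule theI'[OF ex1[OF that]])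
  have iso_reps: "V \<in> ?reps" "V' \<in> ?reps" if "(V, V') \<in> ?iso" for V V'
    using that unfolding IR_iso_def by blast+
  have respects: "attached_data S m u respects ?iso"
    by (rule congruentI) (rule unique[OF _ att[OF iso_reps(1)] att[OF iso_reps(2)]])
  have "bij_betw (\<lambda>C. the_elem (attached_data S m u ` C)) (?reps // ?iso) (IR_data S m u)"
  proof (rule bij_betw_quotient[OF equiv_IR_iso respects])
    fix V V' assume V: "V \<in> ?reps" "V' \<in> ?reps" and eq: "attached_data S m u V = attached_data S m u V'"
    obtain W \<phi> where W: "V = (W, \<phi>)" by (cases V)
    obtain W' \<phi>' where W': "V' = (W', \<phi>')" by (cases V')
    obtain \<delta> \<chi> where d: "attached_data S m u V' = (\<delta>, \<chi>)" by (cases "attached_data S m u V'")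
    have "is_attached S m u (W, \<phi>) (\<delta>, \<chi>)" "is_attached S m u (W', \<phi>') (\<delta>, \<chi>)"
      using att[OF V(1)] att[OF V(2)] unfolding eq d unfolding W W' by simp_all
    then show "(V, V') \<in> ?iso"
      unfolding W W' by (rule is_attached_imp_iso[OF S u V(1)[unfolded W] V(2)[unfolded W']])
  next
    show "attached_data S m u ` ?reps = IR_data S m u"
    proof (intro equalityI subsetI)
      fix d assume "d \<in> attached_data S m u ` ?reps"
      then obtain V where V: "V \<in> ?reps" "attached_data S m u V = d" by blast
      obtain W \<phi> where W: "V = (W, \<phi>)" by (cases V)
      obtain \<delta> \<chi> where \<delta>\<chi>: "d = (\<delta>, \<chi>)" by (cases d)
      have "is_attached S m u (W, \<phi>) (\<delta>, \<chi>)"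
        using att[OF V(1)] unfolding V(2) unfolding W \<delta>\<chi> .
      then show "d \<in> IR_data S m u"
        unfolding \<delta>\<chi> by (rule is_attached_IR_data[OF S u V(1)[unfolded W]])
    next
      fix d :: "'s IR_datum" assume d: "d \<in> IR_data S m u"
      obtain \<delta> \<chi> where \<delta>\<chi>: "d = (\<delta>, \<chi>)" by (cases d)
      obtain V :: "(complex, 'v) module" and \<phi> where V: "(V, \<phi>) \<in> ?reps" "is_attached S m u (V, \<phi>) d"
        unfolding \<delta>\<chi> by (rule is_attached_surj[OF S u assms(5) d[unfolded \<delta>\<chi>]])
      have "d = attached_data S m u (V, \<phi>)"
        by (rule unique[OF refl[OF V(1)] V(2) att[OF V(1)]])
      then show "d \<in> attached_data S m u ` ?reps"
        using V(1) by blast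
    qed
  qed
  with ex1 respects show ?thesis by blast
qed

end
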